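(* Let $W_\Box$ and $W_\Diamond$ be the axiom schemas $W_\Box:\ \Box(((x\rightarrow y)\rightarrow y)\wedge(y\rightarrow x))\rightarrow((\Box x\rightarrow\Box y)\rightarrow\Box y)$ and $W_\Diamond:\ ((\Diamond x\rightarrow\Diamond y)\wedge((\Diamond y\rightarrow\Diamond z)\rightarrow\Diamond z))\rightarrow(\Diamond z\vee\Diamond((x\rightarrow y)\wedge((y\rightarrow z)\rightarrow z)))$. Then the logic $KG+W_\Box+W_\Diamond$ is complete with respect to the class $\mathsf{KG}^\omega$ of crisp witnessed Gödel–Kripke models. Moreover, $KG_\Box+W_\Box$ (over $\Box$-formulas) and $KG_\Diamond+W_\Diamond$ (over $\Diamond$-formulas) are also complete with respect to $\mathsf{KG}^\omega$.
   Context: Standard Gödel algebra $[0,1]_G$: $a\wedge b=\min$, $a\vee b=\max$, $a\rightarrow b=1$ if $a\le b$, else $b$; $\neg a=a\rightarrow0$. Formulas are built from propositional variables and $\bot$ with $\wedge,\vee,\rightarrow,\Box,\Diamond$ ($\neg\varphi:=\varphi\rightarrow\bot$, $\top:=\neg\bot$). A Gödel–Kripke model is $\langle W,R,e\rangle$, $W\ne\emptyset$, $R\colon W\times W\to[0,1]$, $e$ assigning values in $[0,1]$ to variables at each world, extended world-wise as a homomorphism into $[0,1]_G$, with $e(v,\Box\varphi)=\bigwedge_w(R(v,w)\rightarrow e(w,\varphi))$, $e(v,\Diamond\varphi)=\bigvee_w(R(v,w)\wedge e(w,\varphi))$. It is crisp if $R$ is $\{0,1\}$-valued, and witnessed if for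 each $v$ and each $\Box\varphi$, $\Diamond\varphi$ the infimum/supremum is attained at some world. $KG$: Gödel–Dummett propositional axioms; $\Box(\varphi\rightarrow\psi)\rightarrow(\Box\varphi\rightarrow\Box\psi)$; $\neg\neg\Box\varphi\rightarrow\Box\neg\neg\varphi$; $\Diamond(\varphi\vee\psi)\rightarrow(\Diamond\varphi\vee\Diamond\psi)$; $\Diamond\neg\neg\varphi\rightarrow\neg\neg\Diamond\varphi$; $\neg\Diamond\bot$; $\Diamond(\varphi\rightarrow\psi)\rightarrow(\Box\varphi\rightarrow\Diamond\psi)$; $(\Diamond\varphi\rightarrow\Box\psi)\rightarrow\Box(\varphi\rightarrow\psi)$; $\Box(\varphi\vee\psi)\rightarrow(\Box\varphi\vee\Diamond\psi)$; modus ponens; from theorem $\varphi$ infer $\Box\varphi$; from theorem $\varphi\rightarrow\psi$ infer $\Diamond\varphi\rightarrow\Diamond\psi$. $KG_\Box$ ($\Box$-only): Gödel–Dummett axioms, $\Box(\varphi\rightarrow\psi)\rightarrow(\Box\varphi\rightarrow\Box\psi)$, $\neg\neg\Box\varphi\rightarrow\Box\neg\neg\varphi$, modus ponens, from theorem $\varphi$ infer $\Box\varphi$. $KG_\Diamond$ ($\Diamond$-only): Gödel–Dummett axioms, $\Diamond(\varphi\vee\psi)\rightarrow(\Diamond\varphi\vee\Diamond\psi)$, $\Diamond\neg\neg\varphi\rightarrow\neg\neg\Diamond\varphi$, $\neg\Diamond\bot$, modus ponens, from theorem $(\varphi\rightarrow\psi)\vee\chi$ infer $(\Diamond\varphi\rightarrow\Diamond\psi)\vee\Diamond\chi$.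 Adding a schema means adding all its substitution instances as axioms. Consequence is local ($\Gamma\vdash_L\varphi$ iff derivable by modus ponens from $\Gamma$ and theorems of $L$). $L$ is complete w.r.t. a class $\mathcal C$ if for all $\Gamma\cup\{\varphi\}$ in the language of $L$, $\Gamma\vdash_L\varphi$ iff for all models in $\mathcal C$ and worlds $v$, $e(v,\gamma)=1$ for all $\gamma\in\Gamma$ implies $e(v,\varphi)=1$. *)

theory Defs
  imports Complex_Main
begin

datatype fm =
    Var nat
  | Bot  (\<open>\<^bold>\<bottom>\<close>)
  | And fm fm  (infixr \<open>\<^bold>\<and>\<close> 65)
  | Or fm fm  (infixr \<open>\<^bold>\<or>\<close> 60)
  | Imp fm fm  (infixr \<open>\<^bold>\<longrightarrow>\<close> 55)
  | Box fm  (\<open>\<box>_\<close> [80] 80)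
  | Dia fm  (\<open>\<diamond>_\<close> [80] 80)

abbreviation Neg :: "fm \<Rightarrow> fm"  (\<open>\<^bold>\<not>_\<close> [80] 80)
  where "\<^bold>\<not>\<phi> \<equiv> \<phi> \<^bold>\<longrightarrow> \<^bold>\<bottom>"

primrec dia_free :: "fm \<Rightarrow> bool" where
  "dia_free (Var n) = True"
| "dia_free \<^bold>\<bottom> = True"
| "dia_free (\<phi> \<^bold>\<and> \<psi>) = (dia_free \<phi> \<and> dia_free \<psi>)"
| "dia_free (\<phi> \<^bold>\<or> \<psi>) = (dia_free \<phi> \<and> dia_free \<psi>)"
| "dia_free (\<phi> \<^bold>\<longrightarrow> \<psi>) = (dia_free \<phi> \<and> dia_free \<psi>)"
| "dia_free (\<box>\<phi>) = dia_free \<phi>"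
| "dia_free (\<diamond>\<phi>) = False"

primrec box_free :: "fm \<Rightarrow> bool" where
  "box_free (Var n) = True"
| "box_free \<^bold>\<bottom> = True"
| "box_free (\<phi> \<^bold>\<and> \<psi>) = (box_free \<phi> \<and> box_free \<psi>)"
| "box_free (\<phi> \<^bold>\<or> \<psi>) = (box_free \<phi> \<and> box_free \<psi>)"
| "box_free (\<phi> \<^bold>\<longrightarrow> \<psi>) = (box_free \<phi> \<and> box_free \<psi>)"
| "box_free (\<box>\<phi>) = False"
| "box_free (\<diamond>\<phi>) = box_free \<phi>"

definition box_fms :: "fm set" where "box_fms = {\<phi>. dia_free \<phi>}"
definition dia_fms :: "fm set" where "dia_fms = {\<phi>. box_free \<phi>}"

definition gimp :: "real \<Rightarrow> real \<Rightarrow> real"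
  where "gimp a b = (if a \<le> b then 1 else b)"

record 'w gk_model =
  worlds :: "'w set"
  acc :: "'w \<Rightarrow> 'w \<Rightarrow> real"
  val :: "'w \<Rightarrow> nat \<Rightarrow> real"

definition is_gk_model :: "'w gk_model \<Rightarrow> bool" where
  "is_gk_model M \<longleftrightarrow> worlds M \<noteq> {}
     \<and> (\<forall>v\<in>worlds M. \<forall>w\<in>worlds M. acc M v w \<in> {0..1})
     \<and> (\<forall>v\<in>worlds M. \<forall>n. val M v n \<in> {0..1})"

text \<open>In a model all values lie in \<open>[0,1]\<close> and the set of worlds is nonempty, so the
  infima and suprema below are the ones of the lattice \<open>[0,1]\<close>.\<close>

primrec sem :: "'w gk_model \<Rightarrow> fm \<Rightarrow> 'w \<Rightarrow> real" where
  "sem M (Var n) v = val M v n"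
| "sem M \<^bold>\<bottom> v = 0"
| "sem M (\<phi> \<^bold>\<and> \<psi>) v = min (sem M \<phi> v) (sem M \<psi> v)"
| "sem M (\<phi> \<^bold>\<or> \<psi>) v = max (sem M \<phi> v) (sem M \<psi> v)"
| "sem M (\<phi> \<^bold>\<longrightarrow> \<psi>) v = gimp (sem M \<phi> v) (sem M \<psi> v)"
| "sem M (\<box>\<phi>) v = (INF w\<in>worlds M. gimp (acc M v w) (sem M \<phi> w))"
| "sem M (\<diamond>\<phi>) v = (SUP w\<in>worlds M. min (acc M v w) (sem M \<phi> w))"

definition crisp :: "'w gk_model \<Rightarrow> bool" where
  "crisp M \<longleftrightarrow> (\<forall>v\<in>worlds M. \<forall>w\<in>worlds M. acc M v w \<in> {0, 1})"

definition witnessed :: "'w gk_model \<Rightarrow> bool" where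
  "witnessed M \<longleftrightarrow> (\<forall>v\<in>worlds M. \<forall>\<phi>.
     (\<exists>w\<in>worlds M. sem M (\<box>\<phi>) v = gimp (acc M v w) (sem M \<phi> w))
   \<and> (\<exists>w\<in>worlds M. sem M (\<diamond>\<phi>) v = min (acc M v w) (sem M \<phi> w)))"

definition crisp_witnessed_models :: "'w gk_model set" where
  "crisp_witnessed_models = {M. is_gk_model M \<and> crisp M \<and> witnessed M}"

text \<open>Goedel--Dummett logic: intuitionistic propositional logic plus prelinearity.\<close>

inductive_set gd_axioms :: "fm set" where
  "\<phi> \<^bold>\<longrightarrow> \<psi> \<^bold>\<longrightarrow> \<phi> \<in> gd_axioms"
| "(\<phi> \<^bold>\<longrightarrow> \<psi> \<^bold>\<longrightarrow> \<chi>) \<^bold>\<longrightarrow> (\<phi> \<^bold>\<longrightarrow> \<psi>) \<^bold>\<longrightarrow> \<phi> \<^bold>\<longrightarrow> \<chi> \<in> gd_axioms"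
| "\<phi> \<^bold>\<and> \<psi> \<^bold>\<longrightarrow> \<phi> \<in> gd_axioms"
| "\<phi> \<^bold>\<and> \<psi> \<^bold>\<longrightarrow> \<psi> \<in> gd_axioms"
| "\<phi> \<^bold>\<longrightarrow> \<psi> \<^bold>\<longrightarrow> \<phi> \<^bold>\<and> \<psi> \<in> gd_axioms"
| "\<phi> \<^bold>\<longrightarrow> \<phi> \<^bold>\<or> \<psi> \<in> gd_axioms"
| "\<psi> \<^bold>\<longrightarrow> \<phi> \<^bold>\<or> \<psi> \<in> gd_axioms"
| "(\<phi> \<^bold>\<longrightarrow> \<chi>) \<^bold>\<longrightarrow> (\<psi> \<^bold>\<longrightarrow> \<chi>) \<^bold>\<longrightarrow> \<phi> \<^bold>\<or> \<psi> \<^bold>\<longrightarrow> \<chi> \<in> gd_axioms"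
| "\<^bold>\<bottom> \<^bold>\<longrightarrow> \<phi> \<in> gd_axioms"
| "(\<phi> \<^bold>\<longrightarrow> \<psi>) \<^bold>\<or> (\<psi> \<^bold>\<longrightarrow> \<phi>) \<in> gd_axioms"

inductive_set box_axioms :: "fm set" where
  "\<box>(\<phi> \<^bold>\<longrightarrow> \<psi>) \<^bold>\<longrightarrow> (\<box>\<phi> \<^bold>\<longrightarrow> \<box>\<psi>) \<in> box_axioms"
| "\<^bold>\<not>\<^bold>\<not>\<box>\<phi> \<^bold>\<longrightarrow> \<box>\<^bold>\<not>\<^bold>\<not>\<phi> \<in> box_axioms"

inductive_set dia_axioms :: "fm set" where
  "\<diamond>(\<phi> \<^bold>\<or> \<psi>) \<^bold>\<longrightarrow> (\<diamond>\<phi> \<^bold>\<or> \<diamond>\<psi>) \<in> dia_axioms"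
| "\<diamond>\<^bold>\<not>\<^bold>\<not>\<phi> \<^bold>\<longrightarrow> \<^bold>\<not>\<^bold>\<not>\<diamond>\<phi> \<in> dia_axioms"
| "\<^bold>\<not>\<diamond>\<^bold>\<bottom> \<in> dia_axioms"

inductive_set mixed_axioms :: "fm set" where
  "\<diamond>(\<phi> \<^bold>\<longrightarrow> \<psi>) \<^bold>\<longrightarrow> (\<box>\<phi> \<^bold>\<longrightarrow> \<diamond>\<psi>) \<in> mixed_axioms"
| "(\<diamond>\<phi> \<^bold>\<longrightarrow> \<box>\<psi>) \<^bold>\<longrightarrow> \<box>(\<phi> \<^bold>\<longrightarrow> \<psi>) \<in> mixed_axioms"
| "\<box>(\<phi> \<^bold>\<or> \<psi>) \<^bold>\<longrightarrow> (\<box>\<phi> \<^bold>\<or> \<diamond>\<psi>) \<in> mixed_axioms"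

inductive_set W_box :: "fm set" where
  "\<box>(((x \<^bold>\<longrightarrow> y) \<^bold>\<longrightarrow> y) \<^bold>\<and> (y \<^bold>\<longrightarrow> x)) \<^bold>\<longrightarrow> ((\<box>x \<^bold>\<longrightarrow> \<box>y) \<^bold>\<longrightarrow> \<box>y) \<in> W_box"

inductive_set W_dia :: "fm set" where
  "((\<diamond>x \<^bold>\<longrightarrow> \<diamond>y) \<^bold>\<and> ((\<diamond>y \<^bold>\<longrightarrow> \<diamond>z) \<^bold>\<longrightarrow> \<diamond>z)) \<^bold>\<longrightarrow>
     (\<diamond>z \<^bold>\<or> \<diamond>((x \<^bold>\<longrightarrow> y) \<^bold>\<and> ((y \<^bold>\<longrightarrow> z) \<^bold>\<longrightarrow> z))) \<in> W_dia"

text \<open>The sets of theorems of the three logics extended by a set \<open>A\<close> of axioms. In the fragments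
  only axiom instances belonging to the fragment are admitted; every rule stays inside it.\<close>

inductive_set KG :: "fm set \<Rightarrow> fm set" for A :: "fm set" where
  ax: "\<phi> \<in> gd_axioms \<union> box_axioms \<union> dia_axioms \<union> mixed_axioms \<union> A \<Longrightarrow> \<phi> \<in> KG A"
| mp: "\<phi> \<^bold>\<longrightarrow> \<psi> \<in> KG A \<Longrightarrow> \<phi> \<in> KG A \<Longrightarrow> \<psi> \<in> KG A"
| nec_box: "\<phi> \<in> KG A \<Longrightarrow> \<box>\<phi> \<in> KG A"
| mono_dia: "\<phi> \<^bold>\<longrightarrow> \<psi> \<in> KG A \<Longrightarrow> \<diamond>\<phi> \<^bold>\<longrightarrow> \<diamond>\<psi> \<in> KG A"

inductive_set KG_box :: "fm set \<Rightarrow> fm set" for A :: "fm set" where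
  ax: "\<phi> \<in> gd_axioms \<union> box_axioms \<union> A \<Longrightarrow> \<phi> \<in> box_fms \<Longrightarrow> \<phi> \<in> KG_box A"
| mp: "\<phi> \<^bold>\<longrightarrow> \<psi> \<in> KG_box A \<Longrightarrow> \<phi> \<in> KG_box A \<Longrightarrow> \<psi> \<in> KG_box A"
| nec_box: "\<phi> \<in> KG_box A \<Longrightarrow> \<box>\<phi> \<in> KG_box A"

inductive_set KG_dia :: "fm set \<Rightarrow> fm set" for A :: "fm set" where
  ax: "\<phi> \<in> gd_axioms \<union> dia_axioms \<union> A \<Longrightarrow> \<phi> \<in> dia_fms \<Longrightarrow> \<phi> \<in> KG_dia A"
| mp: "\<phi> \<^bold>\<longrightarrow> \<psi> \<in> KG_dia A \<Longrightarrow> \<phi> \<in> KG_dia A \<Longrightarrow> \<psi> \<in> KG_dia A"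
| dia_rule: "(\<phi> \<^bold>\<longrightarrow> \<psi>) \<^bold>\<or> \<chi> \<in> KG_dia A \<Longrightarrow> (\<diamond>\<phi> \<^bold>\<longrightarrow> \<diamond>\<psi>) \<^bold>\<or> \<diamond>\<chi> \<in> KG_dia A"

text \<open>Local consequence: \<open>derivable L \<Gamma> \<phi>\<close>, for a logic given by its set \<open>L\<close> of theorems.\<close>

inductive derivable :: "fm set \<Rightarrow> fm set \<Rightarrow> fm \<Rightarrow> bool" for L \<Gamma> :: "fm set" where
  premise: "\<phi> \<in> \<Gamma> \<Longrightarrow> derivable L \<Gamma> \<phi>"
| logic_thm: "\<phi> \<in> L \<Longrightarrow> derivable L \<Gamma> \<phi>"
| mp: "derivable L \<Gamma> (\<phi> \<^bold>\<longrightarrow> \<psi>) \<Longrightarrow> derivable L \<Gamma> \<phi> \<Longrightarrow> derivable L \<Gamma> \<psi>"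

definition entails :: "'w gk_model set \<Rightarrow> fm set \<Rightarrow> fm \<Rightarrow> bool" where
  "entails C \<Gamma> \<phi> \<longleftrightarrow>
     (\<forall>M\<in>C. \<forall>v\<in>worlds M. (\<forall>\<gamma>\<in>\<Gamma>. sem M \<gamma> v = 1) \<longrightarrow> sem M \<phi> v = 1)"

text \<open>\<open>F\<close> is the language, i.e. the set of formulas over which the logic \<open>L\<close> is formulated.\<close>

definition complete_wrt :: "fm set \<Rightarrow> fm set \<Rightarrow> 'w gk_model set \<Rightarrow> bool" where
  "complete_wrt F L C \<longleftrightarrow>
     (\<forall>\<Gamma> \<phi>. \<Gamma> \<subseteq> F \<longrightarrow> \<phi> \<in> F \<longrightarrow> (derivable L \<Gamma> \<phi> \<longleftrightarrow> entails C \<Gamma> \<phi>))"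

end

theory Submission
  imports Defs "HOL-Library.Countable_Set"
begin

text \<open>
  A world is a homomorphism \<open>v\<close> from formulas to the standard algebra that maps all theorems to 1.
  If \<open>v (\<box>\<phi>) < 1\<close>, a successor \<open>w\<close> with \<open>w \<phi> = v (\<box>\<phi>)\<close> is sought with
  \<open>v (\<box>\<psi>) \<le> w \<psi> \<le> v (\<diamond>\<psi>)\<close> for all \<open>\<psi>\<close>; these are conditions on the order of the values
  of \<open>w\<close> relative to those of \<open>v\<close>. In terms of the theory of \<open>w\<close> they say that some implications
  are true and others are not, and the schemas \<open>W_box\<close> and \<open>W_dia\<close> are what makes them
  consistent. The chain of values of \<open>w\<close> need not embed into \<open>[0,1]\<close> over the values already
  in use, but it can be merged with them after an order isomorphism. As only the order matters in
  witnessed models, all worlds can be added one after another in this way, and the countable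
  limit order is embedded into \<open>[0,1]\<close> at the end.

  For the fragments this gives models witnessed for one modality only. Finite parts of them refute
  every formula that is not a theorem, and strong completeness is obtained from the
  compactness that the full logic provides.
\<close>

section \<open>Embedding countable chains into the unit interval\<close>

text \<open>The formula \<open>(x \<rightarrow> y) \<rightarrow> y\<close> is the strict comparison
  of the algebra: it is 1 where y < x and equals y elsewhere. Read this way, \<open>W_box\<close>
  says that if y < x holds at all successors, then \<box>y < \<box>x or \<box>y = 1, which an
  infimum that is approached but not attained can violate. \<open>W_dia\<close> says that if
  \<diamond>x \<le> \<diamond>y and \<diamond>z < \<diamond>y, then the formula expressing that x
  \<le> y and z < y hold together has value 1 under \<diamond>. The obstacle is that a witness must
  meet infinitely many comparisons at once, and that the strict ones are implications which must
  fail rather than hold. A prime theory can be kept away from a whole set of formulas if that set is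
  directed. Here directedness comes from \<box> commuting with conjunction and \<diamond> with
  disjunction: finitely many comparisons with \<phi> merge into a single one, and a single one is
  what an instance of a schema can treat.\<close>

abbreviation Top :: fm  (\<open>\<^bold>\<top>\<close>)
  where "\<^bold>\<top> \<equiv> \<^bold>\<not>\<^bold>\<bottom>"

instance fm :: countable
  by countable_datatype

text \<open>Give x the sum of \<open>(1/2)^n\<close> over the indices n whose enumerated element
  lies strictly below x. If x lies strictly below y, an index of x counts for y and not for x, which
  makes the map strict. A preorder is allowed, so that equivalent formulas, or tied elements of two
  chains, receive one value.\<close>

lemma countable_preorder_embedding:
  fixes r :: "'a \<Rightarrow> 'a \<Rightarrow> bool"
  assumes S: "countable S"
    and total: "\<And>x y. x \<in> S \<Longrightarrow> y \<in> S \<Longrightarrow> r x y \<or> r y x"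
    and trans: "\<And>x y z. x \<in> S \<Longrightarrow> y \<in> S \<Longrightarrow> z \<in> S \<Longrightarrow> r x y \<Longrightarrow> r y z \<Longrightarrow> r x z"
    and zS: "z \<in> S" and tS: "t \<in> S"
    and bot: "\<And>x. x \<in> S \<Longrightarrow> r z x" and top: "\<And>x. x \<in> S \<Longrightarrow> r x t"
    and nontriv: "\<not> r t z"
  obtains f :: "'a \<Rightarrow> real"
  where "\<And>x y. x \<in> S \<Longrightarrow> y \<in> S \<Longrightarrow> f x \<le> f y \<longleftrightarrow> r x y" and "f z = 0" and "f t = 1"
proof -
  define s where "s = from_nat_into S"
  have sS: "s n \<in> S" for n
    unfolding s_def using zS by (intro from_nat_into) auto
  have s_surj: "\<exists>n. s n = x" if "x \<in> S" for x
    unfolding s_def using S that from_nat_into_surj by metis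
  define c :: "'a \<Rightarrow> nat \<Rightarrow> real"
    where "c x n = (if r (s n) x \<and> \<not> r x (s n) then (1/2)^n else 0)" for x n
  define F where "F x = suminf (c x)" for x
  have summ: "summable (c x)" for x
    by (rule summable_comparison_test'[where g = "\<lambda>n. (1/2)^n" and N = 0])
       (auto simp: c_def summable_geometric)
  have mono: "c x n \<le> c y n" if "x \<in> S" "y \<in> S" "r x y" for x y n
    using that sS[of n] trans[of "s n" x y] trans[of x y "s n"] by (auto simp: c_def)
  have F_mono: "F x \<le> F y" if "x \<in> S" "y \<in> S" "r x y" for x y
    unfolding F_def using mono[OF that] summ by (intro suminf_le) auto
  have F_strict: "F x < F y" if xy: "x \<in> S" "y \<in> S" "\<not> r y x" for x y
  proof -
    have "r x y" using total xy by blast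
    obtain n where n: "s n = x" using s_surj xy by blast
    have "0 < suminf (\<lambda>k. c y k - c x k)"
      using mono[OF xy(1,2) \<open>r x y\<close>] n xy \<open>r x y\<close> total[OF xy(1,1)]
      by (intro suminf_pos2[where i = n] summable_diff summ) (auto simp: c_def)
    then show ?thesis
      by (simp add: F_def suminf_diff[OF summ summ, symmetric])
  qed
  have F_iff: "F x \<le> F y \<longleftrightarrow> r x y" if "x \<in> S" "y \<in> S" for x y
    using F_mono[OF that] F_strict[OF that(2,1)] by force
  have pos: "F z < F t" using F_strict[OF zS tS nontriv] .
  show thesis
    by (rule that[of "\<lambda>x. (F x - F z) / (F t - F z)"])
       (use pos F_iff in \<open>auto simp: divide_le_cancel\<close>)
qed

text \<open>Cuts determined by \<open>U\<close> (lower bounds) and \<open>V\<close> (upper bounds) place each value of the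
  chain \<open>D\<close> among those of \<open>C\<close>; pairs not decided by \<open>V\<close> are put strictly above.\<close>

lemma merge_chains:
  fixes C D :: "real set" and U V :: "(real \<times> real) set"
  assumes C: "countable C" "C \<subseteq> {0..1}" "0 \<in> C" "1 \<in> C"
    and D: "countable D" "D \<subseteq> {0..1}" "0 \<in> D" "1 \<in> D"
    and U: "(0, 0) \<in> U" "(1, 1) \<in> U" and V: "(0, 0) \<in> V" "(1, 1) \<in> V"
    and UV: "\<And>x b y d. (x, b) \<in> U \<Longrightarrow> (y, d) \<in> V \<Longrightarrow> (d \<le> b \<longrightarrow> y \<le> x) \<and> (d < b \<longrightarrow> y < x)"
  obtains f g :: "real \<Rightarrow> real"
  where "\<And>a b. a \<in> C \<Longrightarrow> b \<in> C \<Longrightarrow> f a \<le> f b \<longleftrightarrow> a \<le> b"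
    and "\<And>x y. x \<in> D \<Longrightarrow> y \<in> D \<Longrightarrow> g x \<le> g y \<longleftrightarrow> x \<le> y"
    and "f 0 = 0" "f 1 = 1" "g 0 = 0" "g 1 = 1"
    and "\<And>x b. (x, b) \<in> U \<Longrightarrow> x \<in> D \<Longrightarrow> b \<in> C \<Longrightarrow> f b \<le> g x"
    and "\<And>y d. (y, d) \<in> V \<Longrightarrow> y \<in> D \<Longrightarrow> d \<in> C \<Longrightarrow> g y \<le> f d"
proof -
  define below where "below x a \<longleftrightarrow> (\<exists>y d. (y, d) \<in> V \<and> x \<le> y \<and> d \<le> a)" for x a
  define above where "above a x \<longleftrightarrow> \<not> below x a \<or> (\<exists>y b. (y, b) \<in> U \<and> a \<le> b \<and> y \<le> x)" for a x
  define r :: "real + real \<Rightarrow> real + real \<Rightarrow> bool" where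
    "r p q = (case p of
        Inl a \<Rightarrow> (case q of Inl b \<Rightarrow> a \<le> b | Inr y \<Rightarrow> above a y)
      | Inr x \<Rightarrow> (case q of Inl b \<Rightarrow> below x b | Inr y \<Rightarrow> x \<le> y))" for p q
  let ?S = "Inl ` C \<union> Inr ` D"
  \<comment> \<open>The facts \<open>cut1\<close> to \<open>cut6\<close> are the mixed cases of
    transitivity. Only the last two, where an element of one chain lies between two elements of the
    other, depend on \<open>UV\<close>: the weak half gives \<open>cut5\<close>, the strict half
    gives \<open>cut6\<close>.\<close>
  have cut1: "below x b" if "below x a" "a \<le> b" for x a b
    using that unfolding below_def by (meson order_trans)
  have cut2: "below x a" if "below y a" "x \<le> y" for x y a
    using that unfolding below_def by (meson order_trans)
  have cut3: "above a x" if "above b x" "a \<le> b" for x a b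
    using that cut1[of x a b] unfolding above_def by (meson order_trans)
  have cut4: "above a y" if "above a x" "x \<le> y" for x y a
    using that cut2[of y a x] unfolding above_def by (meson order_trans)
  have cut5: "x \<le> y" if lo: "below x a" and hi: "above a y" for x y a
  proof (cases "below y a")
    case True
    then obtain y' b where "(y', b) \<in> U" "a \<le> b" "y' \<le> y"
      using hi unfolding above_def by (meson order_trans)
    moreover obtain x' d where "(x', d) \<in> V" "x \<le> x'" "d \<le> a"
      using lo unfolding below_def by (meson order_trans)
    ultimately show ?thesis using UV[of y' b x' d] by force
  next
    case False
    then show ?thesis using cut2[of x a y] lo by force
  qed
  have cut6: "a \<le> b" if hi: "above a x" and lo: "below x b" for x a b
  proof (rule ccontr)
    assume ba: "\<not> a \<le> b"
    then have "below x a" using cut1 lo by force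
    then obtain y' b' where "(y', b') \<in> U" "a \<le> b'" "y' \<le> x"
      using hi unfolding above_def by (meson order_trans)
    moreover obtain x' d where "(x', d) \<in> V" "x \<le> x'" "d \<le> b"
      using lo unfolding below_def by (meson order_trans)
    ultimately show False using UV[of y' b' x' d] ba by force
  qed
  obtain h :: "real + real \<Rightarrow> real" where
    h: "\<And>p q. p \<in> ?S \<Longrightarrow> q \<in> ?S \<Longrightarrow> h p \<le> h q \<longleftrightarrow> r p q" and h0: "h (Inl 0) = 0" and h1: "h (Inl 1) = 1"
  proof (rule countable_preorder_embedding[of ?S r "Inl 0" "Inl 1"])
    show "countable ?S" using C D by blast
    show "r p q \<or> r q p" if "p \<in> ?S" "q \<in> ?S" for p q
      using that by (auto simp: r_def above_def)
    show "r p q" if "p \<in> ?S" "q \<in> ?S" "o' \<in> ?S" "r p o'" "r o' q" for p o' q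
      using that(4,5)
      by (cases p; cases o'; cases q; simp add: r_def) (blast intro: cut1 cut2 cut3 cut4 cut5 cut6)+
    show "Inl 0 \<in> ?S" "Inl 1 \<in> ?S" using C by auto
    show "r (Inl 0) p" if "p \<in> ?S" for p
      using that C D U by (fastforce simp: r_def above_def)
    show "r p (Inl 1)" if "p \<in> ?S" for p
      using that C D V by (fastforce simp: r_def below_def)
    show "\<not> r (Inl 1) (Inl 0)" by (simp add: r_def)
  qed auto
  have S: "a \<in> C \<Longrightarrow> Inl a \<in> ?S" "x \<in> D \<Longrightarrow> Inr x \<in> ?S" for a x by auto
  \<comment> \<open>The pairs (0, 0) and (1, 1) in \<open>U\<close> and \<open>V\<close> tie the end
    points of the two chains, so both embeddings fix 0 and 1.\<close>
  have "h (Inr 0) = h (Inl 0)"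
    by (intro antisym; subst h) (use C D U V in \<open>auto simp: r_def above_def below_def\<close>)
  moreover have "h (Inr 1) = h (Inl 1)"
    by (intro antisym; subst h) (use C D U V in \<open>auto simp: r_def above_def below_def\<close>)
  moreover have "h (Inl b) \<le> h (Inr x)" if "(x, b) \<in> U" "x \<in> D" "b \<in> C" for x b
    using that by (subst h) (auto simp: r_def above_def)
  moreover have "h (Inr y) \<le> h (Inl d)" if "(y, d) \<in> V" "y \<in> D" "d \<in> C" for y d
    using that by (subst h) (auto simp: r_def below_def)
  ultimately show thesis
    using that[of "\<lambda>a. h (Inl a)" "\<lambda>x. h (Inr x)"] h h0 h1 S by (simp add: r_def)
qed

section \<open>Propositional homomorphisms\<close>

definition ghom :: "(fm \<Rightarrow> real) \<Rightarrow> bool" where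
  "ghom w \<longleftrightarrow> (\<forall>\<phi>. 0 \<le> w \<phi> \<and> w \<phi> \<le> 1) \<and> w \<^bold>\<bottom> = 0
     \<and> (\<forall>\<phi> \<psi>. w (\<phi> \<^bold>\<and> \<psi>) = min (w \<phi>) (w \<psi>))
     \<and> (\<forall>\<phi> \<psi>. w (\<phi> \<^bold>\<or> \<psi>) = max (w \<phi>) (w \<psi>))
     \<and> (\<forall>\<phi> \<psi>. w (\<phi> \<^bold>\<longrightarrow> \<psi>) = gimp (w \<phi>) (w \<psi>))"

definition lhom :: "fm set \<Rightarrow> (fm \<Rightarrow> real) \<Rightarrow> bool" where
  "lhom L w \<longleftrightarrow> ghom w \<and> (\<forall>\<phi>\<in>L. w \<phi> = 1)"

lemma ghom_simps:
  assumes "ghom w"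
  shows "w \<^bold>\<bottom> = 0" "w (\<phi> \<^bold>\<and> \<psi>) = min (w \<phi>) (w \<psi>)" "w (\<phi> \<^bold>\<or> \<psi>) = max (w \<phi>) (w \<psi>)"
    "w (\<phi> \<^bold>\<longrightarrow> \<psi>) = gimp (w \<phi>) (w \<psi>)" "0 \<le> w \<phi>" "w \<phi> \<le> 1"
  using assms by (auto simp: ghom_def)

lemma ghom_Imp_eq_1: "ghom w \<Longrightarrow> w (\<phi> \<^bold>\<longrightarrow> \<psi>) = 1 \<longleftrightarrow> w \<phi> \<le> w \<psi>"
  using ghom_simps(6)[of w \<phi>] by (auto simp: ghom_simps gimp_def)

text \<open>Minimum, maximum and Goedel implication return one of their arguments or 1, and which
  one depends only on a comparison. Being a homomorphism is therefore a matter of the order of the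
  values and of the two end points, so worlds may be relabelled by order isomorphisms.\<close>

lemma ghom_order_transfer:
  assumes w: "ghom w" and order: "\<And>\<phi> \<psi>. w' \<phi> \<le> w' \<psi> \<longleftrightarrow> w \<phi> \<le> w \<psi>"
    and "w' \<^bold>\<bottom> = 0" "w' \<^bold>\<top> = 1"
  shows "ghom w'"
proof -
  have eq: "w' \<phi> = w' \<psi> \<longleftrightarrow> w \<phi> = w \<psi>" for \<phi> \<psi>
    using order by (metis order_antisym order_refl)
  have top: "w \<^bold>\<top> = 1" using w by (simp add: ghom_simps gimp_def)
  have range: "0 \<le> w' \<phi> \<and> w' \<phi> \<le> 1" for \<phi>
    using order[of "\<^bold>\<bottom>" \<phi>] order[of \<phi> "\<^bold>\<top>"] assms(3,4) top ghom_simps[OF w] by auto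
  moreover have "w' (\<phi> \<^bold>\<and> \<psi>) = min (w' \<phi>) (w' \<psi>)" for \<phi> \<psi>
    using order[of \<phi> \<psi>] eq[of "\<phi> \<^bold>\<and> \<psi>" \<phi>] eq[of "\<phi> \<^bold>\<and> \<psi>" \<psi>] ghom_simps(2)[OF w, of \<phi> \<psi>]
    by (auto simp: min_def)
  moreover have "w' (\<phi> \<^bold>\<or> \<psi>) = max (w' \<phi>) (w' \<psi>)" for \<phi> \<psi>
    using order[of \<phi> \<psi>] eq[of "\<phi> \<^bold>\<or> \<psi>" \<phi>] eq[of "\<phi> \<^bold>\<or> \<psi>" \<psi>] ghom_simps(3)[OF w, of \<phi> \<psi>]
    by (auto simp: max_def)
  moreover have "w' (\<phi> \<^bold>\<longrightarrow> \<psi>) = gimp (w' \<phi>) (w' \<psi>)" for \<phi> \<psi>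
    using order[of \<phi> \<psi>] eq[of "\<phi> \<^bold>\<longrightarrow> \<psi>" "\<^bold>\<top>"] eq[of "\<phi> \<^bold>\<longrightarrow> \<psi>" \<psi>] ghom_simps(4)[OF w, of \<phi> \<psi>]
      top assms(4)
    by (auto simp: gimp_def)
  ultimately show ?thesis using assms(3) by (simp add: ghom_def)
qed

lemma lhom_ghom: "lhom L w \<Longrightarrow> ghom w"
  by (simp add: lhom_def)

lemma lhom_Imp_le: "lhom L w \<Longrightarrow> \<phi> \<^bold>\<longrightarrow> \<psi> \<in> L \<Longrightarrow> w \<phi> \<le> w \<psi>"
  using ghom_Imp_eq_1 by (auto simp: lhom_def)

lemma lhom_order_transfer:
  assumes "lhom L w" and order: "\<And>\<phi> \<psi>. w' \<phi> \<le> w' \<psi> \<longleftrightarrow> w \<phi> \<le> w \<psi>"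
    and "w' \<^bold>\<bottom> = 0" "w' \<^bold>\<top> = 1"
  shows "lhom L w'"
proof -
  have w: "ghom w" and w': "ghom w'"
    using assms ghom_order_transfer[of w w'] by (auto simp: lhom_def)
  have "w' \<phi> = 1" if "\<phi> \<in> L" for \<phi>
    using order[of "\<^bold>\<top>" \<phi>] assms(1,4) that ghom_simps(6)[OF w, of "\<^bold>\<top>"] ghom_simps(6)[OF w', of \<phi>]
    by (simp add: lhom_def)
  with w' show ?thesis by (simp add: lhom_def)
qed

section \<open>Derivability and its refutation by homomorphisms\<close>

lemma derivable_mono: "derivable L \<Gamma> \<phi> \<Longrightarrow> \<Gamma> \<subseteq> \<Delta> \<Longrightarrow> derivable L \<Delta> \<phi>"
  by (induction rule: derivable.induct) (auto intro: derivable.intros)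

lemma derivable_finite:
  assumes "derivable L \<Gamma> \<phi>"
  shows "\<exists>\<Delta>. finite \<Delta> \<and> \<Delta> \<subseteq> \<Gamma> \<and> derivable L \<Delta> \<phi>"
  using assms
proof (induction rule: derivable.induct)
  case (premise \<phi>)
  then show ?case by (intro exI[of _ "{\<phi>}"]) (auto intro: derivable.intros)
next
  case (logic_thm \<phi>)
  then show ?case by (intro exI[of _ "{}"]) (auto intro: derivable.intros)
next
  case (mp \<phi> \<psi>)
  then obtain \<Delta>1 \<Delta>2 where "finite \<Delta>1" "\<Delta>1 \<subseteq> \<Gamma>" "derivable L \<Delta>1 (\<phi> \<^bold>\<longrightarrow> \<psi>)"
    "finite \<Delta>2" "\<Delta>2 \<subseteq> \<Gamma>" "derivable L \<Delta>2 \<phi>" by blast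
  then show ?case
    by (intro exI[of _ "\<Delta>1 \<union> \<Delta>2"]) (auto intro: derivable.mp derivable_mono)
qed

lemma derivable_sound:
  assumes "lhom L w" "derivable L \<Gamma> \<phi>" "\<And>\<gamma>. \<gamma> \<in> \<Gamma> \<Longrightarrow> w \<gamma> = 1"
  shows "w \<phi> = 1"
  using assms(2)
proof (induction rule: derivable.induct)
  case (mp \<phi> \<psi>)
  have w: "ghom w" using assms(1) by (simp add: lhom_def)
  show ?case
    using mp.IH ghom_simps(6)[OF w, of \<psi>] by (simp add: ghom_Imp_eq_1[OF w])
qed (use assms in \<open>auto simp: lhom_def\<close>)

context
  fixes L :: "fm set"
  assumes gd: "gd_axioms \<subseteq> L"
begin

lemma derivable_gd: "\<phi> \<in> gd_axioms \<Longrightarrow> derivable L \<Gamma> \<phi>"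
  using gd by (blast intro: derivable.logic_thm)

lemma derivable_weaken: "derivable L \<Gamma> \<phi> \<Longrightarrow> derivable L \<Gamma> (\<psi> \<^bold>\<longrightarrow> \<phi>)"
  using derivable.mp[OF derivable_gd[OF gd_axioms.intros(1)]] .

lemma derivable_refl: "derivable L \<Gamma> (\<phi> \<^bold>\<longrightarrow> \<phi>)"
  using derivable_gd[OF gd_axioms.intros(1)] derivable_gd[OF gd_axioms.intros(2)]
    derivable.mp by metis

lemma deduction:
  assumes "derivable L (insert \<psi> \<Gamma>) \<phi>"
  shows "derivable L \<Gamma> (\<psi> \<^bold>\<longrightarrow> \<phi>)"
  using assms
proof (induction rule: derivable.induct)
  case (premise \<phi>)
  then show ?case
    by (auto intro: derivable_refl derivable_weaken derivable.premise)
next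
  case (logic_thm \<phi>)
  then show ?case by (auto intro: derivable_weaken derivable.logic_thm)
next
  case (mp \<phi> \<chi>)
  then show ?case
    using derivable.mp[OF derivable.mp[OF derivable_gd[OF gd_axioms.intros(2)]]] by blast
qed

lemma derivable_trans:
  assumes "derivable L \<Gamma> (\<phi> \<^bold>\<longrightarrow> \<psi>)" "derivable L \<Gamma> (\<psi> \<^bold>\<longrightarrow> \<chi>)"
  shows "derivable L \<Gamma> (\<phi> \<^bold>\<longrightarrow> \<chi>)"
  using assms derivable.mp[OF derivable.mp[OF derivable_gd[OF gd_axioms.intros(2)]]]
    derivable_weaken by blast

lemma derivable_disjE:
  assumes "derivable L \<Gamma> (\<phi> \<^bold>\<or> \<psi>)" "derivable L \<Gamma> (\<phi> \<^bold>\<longrightarrow> \<chi>)" "derivable L \<Gamma> (\<psi> \<^bold>\<longrightarrow> \<chi>)"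
  shows "derivable L \<Gamma> \<chi>"
  using assms derivable_gd[OF gd_axioms.intros(8)] derivable.mp by metis

text \<open>Zorn's lemma gives a maximal theory deriving nothing in \<open>B\<close>. Directedness
  of \<open>B\<close> makes it prime: if both disjuncts were missing, each would imply a member of
  \<open>B\<close>, these two would imply a common third member, and the disjunction would derive
  that one.\<close>

lemma prime_extension:
  assumes B: "B \<noteq> {}"
    and dir: "\<And>b c. b \<in> B \<Longrightarrow> c \<in> B \<Longrightarrow>
      \<exists>d\<in>B. derivable L A (b \<^bold>\<longrightarrow> d) \<and> derivable L A (c \<^bold>\<longrightarrow> d)"
    and AB: "\<And>b. b \<in> B \<Longrightarrow> \<not> derivable L A b"
  obtains T where "A \<subseteq> T" "T \<inter> B = {}" "\<And>\<phi>. derivable L T \<phi> \<longleftrightarrow> \<phi> \<in> T"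
    "\<And>\<phi> \<psi>. \<phi> \<^bold>\<or> \<psi> \<in> T \<Longrightarrow> \<phi> \<in> T \<or> \<psi> \<in> T"
proof -
  define P where "P = {T. A \<subseteq> T \<and> (\<forall>b\<in>B. \<not> derivable L T b)}"
  have "\<exists>T\<in>P. \<forall>X\<in>P. T \<subseteq> X \<longrightarrow> X = T"
  proof (rule subset_Zorn_nonempty)
    show "P \<noteq> {}" using AB by (auto simp: P_def)
    fix C assume C: "C \<noteq> {}" "subset.chain P C"
    have "\<not> derivable L (\<Union>C) b" if b: "b \<in> B" for b
    proof
      assume "derivable L (\<Union>C) b"
      from derivable_finite[OF this]
      obtain \<Delta> where \<Delta>: "finite \<Delta>" "\<Delta> \<subseteq> \<Union>C" "derivable L \<Delta> b" by metis
      obtain T where "T \<in> C" "\<Delta> \<subseteq> T"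
        using finite_subset_Union_chain[OF \<Delta>(1,2) C] by metis
      moreover from this have "\<not> derivable L T b"
        using C(2) b by (auto simp: subset_chain_def P_def)
      ultimately show False
        using derivable_mono[OF \<Delta>(3)] by metis
    qed
    moreover have "A \<subseteq> \<Union>C" using C by (fastforce simp: subset_chain_def P_def)
    ultimately show "\<Union>C \<in> P" by (simp add: P_def)
  qed
  then obtain T where TP: "T \<in> P" and max: "\<forall>X\<in>P. T \<subseteq> X \<longrightarrow> X = T" by metis
  then have T: "A \<subseteq> T" "\<And>b. b \<in> B \<Longrightarrow> \<not> derivable L T b" by (auto simp: P_def)
  have ins: "\<exists>b\<in>B. derivable L T (\<phi> \<^bold>\<longrightarrow> b)" if "\<phi> \<notin> T" for \<phi>
  proof -
    have "insert \<phi> T \<noteq> T" using that by auto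
    then have "insert \<phi> T \<notin> P" using max by (metis subset_insertI)
    then obtain b where "b \<in> B" "derivable L (insert \<phi> T) b" using T(1) by (auto simp: P_def)
    then show ?thesis using deduction by auto
  qed
  have closed: "derivable L T \<phi> \<longleftrightarrow> \<phi> \<in> T" for \<phi>
    using ins[of \<phi>] T derivable.premise derivable.mp by metis
  have prime: "\<phi> \<in> T \<or> \<psi> \<in> T" if or: "\<phi> \<^bold>\<or> \<psi> \<in> T" for \<phi> \<psi>
  proof (rule ccontr)
    assume "\<not> (\<phi> \<in> T \<or> \<psi> \<in> T)"
    then obtain b c where bc: "b \<in> B" "c \<in> B" "derivable L T (\<phi> \<^bold>\<longrightarrow> b)" "derivable L T (\<psi> \<^bold>\<longrightarrow> c)"
      using ins by blast
    obtain d where d: "d \<in> B" "derivable L T (b \<^bold>\<longrightarrow> d)" "derivable L T (c \<^bold>\<longrightarrow> d)"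
      using dir[OF bc(1,2)] derivable_mono T(1) by blast
    have "derivable L T d"
      using derivable_disjE[OF derivable.premise[OF or]] derivable_trans bc d by blast
    then show False using T d by blast
  qed
  show thesis
    by (rule that[OF T(1) _ closed prime]) (use T(2) closed in auto)
qed

text \<open>Prelinearity and primality make \<open>\<phi> \<rightarrow> \<psi> \<in> T\<close> a
  total preorder on the countably many formulas. Its quotient is the Lindenbaum chain of
  \<open>T\<close>, and an embedding into [0,1] that sends \<bottom> to 0 and \<top> to 1 is a
  homomorphism because the order determines all connectives.\<close>

lemma hom_extension:
  assumes B: "B \<noteq> {}"
    and dir: "\<And>b c. b \<in> B \<Longrightarrow> c \<in> B \<Longrightarrow>
      \<exists>d\<in>B. derivable L A (b \<^bold>\<longrightarrow> d) \<and> derivable L A (c \<^bold>\<longrightarrow> d)"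
    and AB: "\<And>b. b \<in> B \<Longrightarrow> \<not> derivable L A b"
  obtains w where "lhom L w" "\<And>\<phi>. \<phi> \<in> A \<Longrightarrow> w \<phi> = 1" "\<And>b. b \<in> B \<Longrightarrow> w b < 1"
proof -
  obtain T where T: "A \<subseteq> T" "T \<inter> B = {}" "\<And>\<phi>. derivable L T \<phi> \<longleftrightarrow> \<phi> \<in> T"
    "\<And>\<phi> \<psi>. \<phi> \<^bold>\<or> \<psi> \<in> T \<Longrightarrow> \<phi> \<in> T \<or> \<psi> \<in> T"
    using prime_extension[OF assms] by metis
  have LT: "\<phi> \<in> T" if "\<phi> \<in> L" for \<phi>
    using that T(3) derivable.logic_thm by blast
  have ax: "\<phi> \<in> T" if "\<phi> \<in> gd_axioms" for \<phi>
    using that gd LT by blast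
  have mp: "\<psi> \<in> T" if "\<phi> \<^bold>\<longrightarrow> \<psi> \<in> T" "\<phi> \<in> T" for \<phi> \<psi>
    using that T(3) derivable.premise derivable.mp by metis
  have imp_trans: "\<phi> \<^bold>\<longrightarrow> \<chi> \<in> T" if "\<phi> \<^bold>\<longrightarrow> \<psi> \<in> T" "\<psi> \<^bold>\<longrightarrow> \<chi> \<in> T" for \<phi> \<psi> \<chi>
    using that derivable_trans T(3) by blast
  have imp_refl: "\<phi> \<^bold>\<longrightarrow> \<phi> \<in> T" for \<phi>
    using derivable_refl T(3) by blast
  have imp_mp: "\<chi> \<^bold>\<longrightarrow> \<psi> \<in> T" if "\<chi> \<^bold>\<longrightarrow> \<phi> \<^bold>\<longrightarrow> \<psi> \<in> T" "\<chi> \<^bold>\<longrightarrow> \<phi> \<in> T" for \<phi> \<psi> \<chi>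
    using mp[OF mp[OF ax[OF gd_axioms.intros(2)] that(1)] that(2)] .
  have bot: "\<^bold>\<bottom> \<notin> T"
    using B T(2) mp ax[OF gd_axioms.intros(9)] by blast
  have top: "\<phi> \<^bold>\<longrightarrow> \<^bold>\<top> \<in> T" for \<phi>
    using derivable_weaken[OF derivable_refl] T(3) by blast
  have top_imp: "\<^bold>\<top> \<^bold>\<longrightarrow> \<phi> \<in> T \<longleftrightarrow> \<phi> \<in> T" for \<phi>
    using mp imp_refl derivable_weaken T(3) by blast
  obtain w :: "fm \<Rightarrow> real" where w: "\<And>\<phi> \<psi>. w \<phi> \<le> w \<psi> \<longleftrightarrow> \<phi> \<^bold>\<longrightarrow> \<psi> \<in> T" and w0: "w \<^bold>\<bottom> = 0"
    and w1: "w \<^bold>\<top> = 1"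
  proof (rule countable_preorder_embedding[of "UNIV :: fm set" "\<lambda>\<phi> \<psi>. \<phi> \<^bold>\<longrightarrow> \<psi> \<in> T" "\<^bold>\<bottom>" "\<^bold>\<top>"])
    show "\<phi> \<^bold>\<longrightarrow> \<psi> \<in> T \<or> \<psi> \<^bold>\<longrightarrow> \<phi> \<in> T" for \<phi> \<psi>
      using T(4) ax[OF gd_axioms.intros(10)] by blast
  qed (use imp_trans ax[OF gd_axioms.intros(9)] top bot in \<open>auto simp: top_imp\<close>)
  have one: "w \<phi> = 1 \<longleftrightarrow> \<phi> \<in> T" for \<phi>
    using w[of \<phi> "\<^bold>\<top>"] w[of "\<^bold>\<top>" \<phi>] w1 top[of \<phi>] top_imp[of \<phi>] by force
  have range: "0 \<le> w \<phi>" "w \<phi> \<le> 1" for \<phi>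
    using w[of "\<^bold>\<bottom>" \<phi>] w[of \<phi> "\<^bold>\<top>"] w0 w1 top ax[OF gd_axioms.intros(9)] by auto
  have conj: "w (\<phi> \<^bold>\<and> \<psi>) = min (w \<phi>) (w \<psi>)" for \<phi> \<psi>
  proof -
    have "\<chi> \<^bold>\<longrightarrow> \<phi> \<^bold>\<and> \<psi> \<in> T" if "\<chi> \<^bold>\<longrightarrow> \<phi> \<in> T" "\<chi> \<^bold>\<longrightarrow> \<psi> \<in> T" for \<chi>
      using imp_mp[OF imp_trans[OF that(1) ax[OF gd_axioms.intros(5)]] that(2)] .
    then have "w \<chi> \<le> w (\<phi> \<^bold>\<and> \<psi>)" if "w \<chi> \<le> w \<phi>" "w \<chi> \<le> w \<psi>" for \<chi>
      using that w by blast
    moreover have "w (\<phi> \<^bold>\<and> \<psi>) \<le> w \<phi>" "w (\<phi> \<^bold>\<and> \<psi>) \<le> w \<psi>"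
      using w ax gd_axioms.intros(3,4) by blast+
    ultimately show ?thesis
      by (cases "w \<phi> \<le> w \<psi>") (auto intro!: antisym simp: min_def)
  qed
  have disj: "w (\<phi> \<^bold>\<or> \<psi>) = max (w \<phi>) (w \<psi>)" for \<phi> \<psi>
  proof -
    have "\<phi> \<^bold>\<or> \<psi> \<^bold>\<longrightarrow> \<chi> \<in> T" if "\<phi> \<^bold>\<longrightarrow> \<chi> \<in> T" "\<psi> \<^bold>\<longrightarrow> \<chi> \<in> T" for \<chi>
      using that ax[OF gd_axioms.intros(8)] mp by blast
    then have "w (\<phi> \<^bold>\<or> \<psi>) \<le> w \<chi>" if "w \<phi> \<le> w \<chi>" "w \<psi> \<le> w \<chi>" for \<chi>
      using that w by blast
    moreover have "w \<phi> \<le> w (\<phi> \<^bold>\<or> \<psi>)" "w \<psi> \<le> w (\<phi> \<^bold>\<or> \<psi>)"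
      using w ax gd_axioms.intros(6,7) by blast+
    ultimately show ?thesis
      by (cases "w \<phi> \<le> w \<psi>") (auto intro!: antisym simp: max_def)
  qed
  \<comment> \<open>Residuation determines implication from the order. Taking for \<chi> the
    implication itself and then its conclusion computes its value when the comparison fails.\<close>
  have resid: "w \<chi> \<le> w (\<phi> \<^bold>\<longrightarrow> \<psi>) \<longleftrightarrow> min (w \<chi>) (w \<phi>) \<le> w \<psi>" for \<chi> \<phi> \<psi>
  proof
    assume "w \<chi> \<le> w (\<phi> \<^bold>\<longrightarrow> \<psi>)"
    then have "\<chi> \<^bold>\<longrightarrow> (\<phi> \<^bold>\<longrightarrow> \<psi>) \<in> T" using w by blast
    moreover have "(\<chi> \<^bold>\<and> \<phi>) \<^bold>\<longrightarrow> \<chi> \<in> T" "(\<chi> \<^bold>\<and> \<phi>) \<^bold>\<longrightarrow> \<phi> \<in> T"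
      using ax gd_axioms.intros(3,4) by blast+
    ultimately have "(\<chi> \<^bold>\<and> \<phi>) \<^bold>\<longrightarrow> \<psi> \<in> T"
      using imp_mp imp_trans by blast
    then show "min (w \<chi>) (w \<phi>) \<le> w \<psi>" using w conj by metis
  next
    assume "min (w \<chi>) (w \<phi>) \<le> w \<psi>"
    then have "\<chi> \<^bold>\<and> \<phi> \<^bold>\<longrightarrow> \<psi> \<in> T" using w conj by metis
    then have "derivable L (insert \<phi> (insert \<chi> T)) (\<chi> \<^bold>\<and> \<phi> \<^bold>\<longrightarrow> \<psi>)"
      by (auto intro: derivable.premise)
    moreover have "derivable L (insert \<phi> (insert \<chi> T)) (\<chi> \<^bold>\<and> \<phi>)"
      by (rule derivable.mp[OF derivable.mp[OF derivable_gd[OF gd_axioms.intros(5)]]])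
         (auto intro: derivable.premise)
    ultimately have "derivable L (insert \<phi> (insert \<chi> T)) \<psi>" by (rule derivable.mp)
    then have "\<chi> \<^bold>\<longrightarrow> (\<phi> \<^bold>\<longrightarrow> \<psi>) \<in> T"
      using deduction T(3) by blast
    then show "w \<chi> \<le> w (\<phi> \<^bold>\<longrightarrow> \<psi>)" using w by blast
  qed
  have imp: "w (\<phi> \<^bold>\<longrightarrow> \<psi>) = gimp (w \<phi>) (w \<psi>)" for \<phi> \<psi>
  proof (cases "w \<phi> \<le> w \<psi>")
    case True
    then show ?thesis using w one by (simp add: gimp_def)
  next
    case False
    then show ?thesis
      using resid[of "\<phi> \<^bold>\<longrightarrow> \<psi>" \<phi> \<psi>] resid[of \<psi> \<phi> \<psi>] by (auto simp: gimp_def min_def split: if_splits)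
  qed
  have "lhom L w"
    using range w0 conj disj imp LT one by (auto simp: lhom_def ghom_def)
  moreover have "w b < 1" if "b \<in> B" for b
    using that T(2) one[of b] range(2)[of b] by force
  ultimately show thesis
    using that[of w] T(1) one by blast
qed

text \<open>Hilbert derivations of propositional steps are replaced by calculations with
  \<open>min\<close>, \<open>max\<close> and \<open>gimp\<close>, where modal formulas count as
  atoms subject to the theorems of \<open>L\<close>.\<close>

lemma prop_complete:
  assumes "\<And>w. lhom L w \<Longrightarrow> (\<And>\<gamma>. \<gamma> \<in> \<Gamma> \<Longrightarrow> w \<gamma> = 1) \<Longrightarrow> w \<phi> = 1"
  shows "derivable L \<Gamma> \<phi>"
proof (rule ccontr)
  assume "\<not> derivable L \<Gamma> \<phi>"
  then obtain w where "lhom L w" "\<And>\<gamma>. \<gamma> \<in> \<Gamma> \<Longrightarrow> w \<gamma> = 1" "w \<phi> < 1"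
    using hom_extension[of "{\<phi>}" \<Gamma>] derivable_refl by (metis empty_not_insert singleton_iff)
  then show False using assms by force
qed

text \<open>A derivation uses finitely many members of \<open>P\<close>, and directedness replaces
  them by a single stronger one. This reduces an inconsistent set of requirements to one
  implication, from which a schema instance can be formed.\<close>

lemma derivable_directed:
  assumes "derivable L (S \<union> P) \<phi>" and P: "P \<noteq> {}"
    and dir: "\<And>p q. p \<in> P \<Longrightarrow> q \<in> P \<Longrightarrow>
      \<exists>r\<in>P. derivable L S (r \<^bold>\<longrightarrow> p) \<and> derivable L S (r \<^bold>\<longrightarrow> q)"
  shows "\<exists>p\<in>P. derivable L S (p \<^bold>\<longrightarrow> \<phi>)"
  using assms(1)
proof (induction rule: derivable.induct)
  case (premise \<phi>)
  then show ?case
    using P derivable_refl derivable_weaken[OF derivable.premise] by blast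
next
  case (logic_thm \<phi>)
  then show ?case
    using P derivable_weaken[OF derivable.logic_thm] by blast
next
  case (mp \<phi> \<psi>)
  then obtain p q where pq: "p \<in> P" "derivable L S (p \<^bold>\<longrightarrow> \<phi> \<^bold>\<longrightarrow> \<psi>)" "q \<in> P" "derivable L S (q \<^bold>\<longrightarrow> \<phi>)"
    by blast
  obtain r where r: "r \<in> P" "derivable L S (r \<^bold>\<longrightarrow> p)" "derivable L S (r \<^bold>\<longrightarrow> q)"
    using dir pq by blast
  then have "derivable L S (r \<^bold>\<longrightarrow> \<psi>)"
    using derivable.mp[OF derivable.mp[OF derivable_gd[OF gd_axioms.intros(2)]]]
      derivable_trans pq by blast
  with r show ?case by blast
qed

end

section \<open>Witnesses for a single modal formula\<close>

text \<open>The bounds that a world with valuation \<open>v\<close> imposes on a successor, where \<open>\<phi>\<close> is to take the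
  value \<open>a\<close> at that successor. The flags select the modalities of the language.\<close>

definition lower_bounds :: "bool \<Rightarrow> (fm \<Rightarrow> real) \<Rightarrow> fm \<Rightarrow> real \<Rightarrow> (fm \<times> real) set" where
  "lower_bounds ub v \<phi> a = {(\<^bold>\<bottom>, 0), (\<^bold>\<top>, 1), (\<phi>, a)} \<union> (if ub then range (\<lambda>\<beta>. (\<beta>, v (\<box>\<beta>))) else {})"

definition upper_bounds :: "bool \<Rightarrow> (fm \<Rightarrow> real) \<Rightarrow> fm \<Rightarrow> real \<Rightarrow> (fm \<times> real) set" where
  "upper_bounds ud v \<phi> a = {(\<^bold>\<bottom>, 0), (\<^bold>\<top>, 1), (\<phi>, a)} \<union> (if ud then range (\<lambda>\<delta>. (\<delta>, v (\<diamond>\<delta>))) else {})"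

text \<open>Values of \<open>w\<close> are compared with each other and bounds with each other,
  never a value with a bound, so the conditions are insensitive to moving either chain. They are the
  requirement \<open>UV\<close> of \<open>merge_chains\<close>.\<close>

definition separates :: "(fm \<Rightarrow> real) \<Rightarrow> (fm \<times> real) set \<Rightarrow> (fm \<times> real) set \<Rightarrow> bool" where
  "separates w U V \<longleftrightarrow> (\<forall>(\<beta>, b)\<in>U. \<forall>(\<delta>, d)\<in>V. (d \<le> b \<longrightarrow> w \<delta> \<le> w \<beta>) \<and> (d < b \<longrightarrow> w \<delta> < w \<beta>))"

text \<open>The letters f, b, c, g are the values of \<phi>, \<beta>, the side disjunct and \<gamma>
  in \<open>box_witness\<close>. The left argument of \<open>max\<close> is 1 as soon as y < x or x
  = y = 1. If c < 1 and f < g, the hypothesis forces b < f, hence y = b < f = x; if g \<le> f, then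
  x = 1.\<close>

lemma box_schema_value:
  assumes "gimp (gimp f b) (max (gimp g f) c) = 1" "b \<le> 1" "c \<le> 1" "f \<le> 1" "g \<le> 1"
  defines "x \<equiv> gimp g f" and "y \<equiv> min b (min f g)"
  shows "max (min (gimp (gimp x y) y) (gimp y x)) c = 1"
proof (cases "c = 1")
  case False
  then have "c < 1" using assms by simp
  show ?thesis
  proof (cases "g \<le> f")
    case True
    then show ?thesis using assms by (simp add: gimp_def)
  next
    case gf: False
    then have "b < f" using assms(1) \<open>c < 1\<close> assms(2,3,4,5) by (auto simp: gimp_def max_def split: if_splits)
    then show ?thesis using gf assms(2-5) by (auto simp: x_def y_def gimp_def)
  qed
qed (use assms in \<open>auto simp: gimp_def\<close>)

text \<open>The letters d, f, e, z are the values of \<delta>, \<phi>, \<eta>, \<zeta> in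
  \<open>dia_witness\<close>. The minimum exceeds f only where d \<le> f and e < f, and there the
  hypothesis forces z = 1.\<close>

lemma dia_schema_value:
  assumes "gimp (gimp d f) (max (gimp f e) z) = 1" "d \<le> 1" "f \<le> 1" "e \<le> 1" "z \<le> 1"
  shows "max (gimp (min (gimp (max d e) f) (gimp (gimp f e) e)) f) z = 1"
proof (cases "z = 1")
  case False
  then have "z < 1" using assms by simp
  then show ?thesis using assms by (auto simp: gimp_def max_def min_def split: if_splits)
qed (use assms in \<open>auto simp: gimp_def\<close>)

section \<open>Successors that witness a box\<close>

locale box_logic =
  fixes L :: "fm set"
  assumes gd: "gd_axioms \<subseteq> L" and box: "box_axioms \<subseteq> L" and W: "W_box \<subseteq> L"
    and nec: "\<phi> \<in> L \<Longrightarrow> \<box>\<phi> \<in> L"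
    and closed: "derivable L {} \<phi> \<Longrightarrow> \<phi> \<in> L"
begin

lemma box_K: "lhom L v \<Longrightarrow> v (\<box>(\<phi> \<^bold>\<longrightarrow> \<psi>)) \<le> gimp (v (\<box>\<phi>)) (v (\<box>\<psi>))"
  using lhom_Imp_le[of L v] subsetD[OF box box_axioms.intros(1)]
  by (simp add: ghom_simps(4)[OF lhom_ghom, symmetric])

lemma box_mono:
  assumes v: "lhom L v" and "\<And>w. lhom L w \<Longrightarrow> w \<phi> \<le> w \<psi>"
  shows "v (\<box>\<phi>) \<le> v (\<box>\<psi>)"
proof -
  have "\<phi> \<^bold>\<longrightarrow> \<psi> \<in> L"
    using assms(2) by (intro closed prop_complete gd) (auto simp: lhom_def ghom_Imp_eq_1)
  then have "v (\<box>(\<phi> \<^bold>\<longrightarrow> \<psi>)) = 1" using nec v by (auto simp: lhom_def)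
  then show ?thesis
    using box_K[OF v, of \<phi> \<psi>] ghom_simps(6)[OF lhom_ghom[OF v], of "\<box>\<phi>"]
    by (auto simp: gimp_def split: if_splits)
qed

lemma box_top: "lhom L v \<Longrightarrow> v (\<box>\<^bold>\<top>) = 1"
  using nec[OF closed[OF derivable_refl[OF gd]]] by (auto simp: lhom_def)

lemma box_conj:
  assumes v: "lhom L v"
  shows "v (\<box>(\<phi> \<^bold>\<and> \<psi>)) = min (v (\<box>\<phi>)) (v (\<box>\<psi>))"
proof -
  have "v (\<box>\<phi>) \<le> v (\<box>(\<psi> \<^bold>\<longrightarrow> \<phi> \<^bold>\<and> \<psi>))"
    by (rule box_mono[OF v]) (auto simp: lhom_def ghom_simps gimp_def)
  with box_K[OF v, of \<psi> "\<phi> \<^bold>\<and> \<psi>"] have "min (v (\<box>\<phi>)) (v (\<box>\<psi>)) \<le> v (\<box>(\<phi> \<^bold>\<and> \<psi>))"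
    by (auto simp: gimp_def split: if_splits)
  moreover have "v (\<box>(\<phi> \<^bold>\<and> \<psi>)) \<le> v (\<box>\<phi>)" "v (\<box>(\<phi> \<^bold>\<and> \<psi>)) \<le> v (\<box>\<psi>)"
    by (auto intro!: box_mono[OF v] simp: lhom_def ghom_simps)
  ultimately show ?thesis by simp
qed

lemma derivable_boxed:
  assumes v: "lhom L v" and "derivable L {\<psi>. v (\<box>\<psi>) = 1} \<phi>"
  shows "v (\<box>\<phi>) = 1"
  using assms(2)
proof (induction rule: derivable.induct)
  case (logic_thm \<phi>)
  then show ?case using nec v by (auto simp: lhom_def)
next
  case (mp \<phi> \<psi>)
  then show ?case
    using box_K[OF v, of \<phi> \<psi>] v ghom_simps(6)[of v "\<box>\<psi>"] by (auto simp: lhom_def gimp_def split: if_splits)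
qed simp

text \<open>\<open>N\<close> collects the formulas that are to stay below 1 at the successor for reasons unrelated
  to \<open>\<phi>\<close>. The instance of \<open>W_box\<close> with \<open>x = \<gamma> \<rightarrow> \<phi>\<close> and \<open>y = \<beta> \<and> \<phi> \<and> \<gamma>\<close> shows that the remaining
  requirements are consistent.\<close>

lemma box_witness:
  assumes v: "lhom L v" and \<phi>: "v (\<box>\<phi>) < 1"
    and N: "\<^bold>\<bottom> \<in> N" "\<And>b c. b \<in> N \<Longrightarrow> c \<in> N \<Longrightarrow> b \<^bold>\<or> c \<in> N"
      "\<And>\<psi> b. b \<in> N \<Longrightarrow> v (\<box>(\<psi> \<^bold>\<or> b)) = 1 \<Longrightarrow> v (\<box>\<psi>) = 1"
  obtains w where "lhom L w" "\<And>\<psi>. v (\<box>\<psi>) = 1 \<Longrightarrow> w \<psi> = 1" "\<And>b. b \<in> N \<Longrightarrow> w b < 1"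
    "\<And>\<beta>. v (\<box>\<phi>) \<le> v (\<box>\<beta>) \<Longrightarrow> w \<phi> \<le> w \<beta>" "\<And>\<gamma>. v (\<box>\<phi>) < v (\<box>\<gamma>) \<Longrightarrow> w \<phi> < w \<gamma>"
proof -
  \<comment> \<open>A true member of \<open>P\<close> says that \<phi> stays below some \<beta>. A
    member of \<open>B\<close> has value below 1 exactly if \<phi> < \<gamma> holds strictly and b
    stays below 1; putting both into one disjunction keeps the family to be avoided
    directed.\<close>
  define S where "S = {\<psi>. v (\<box>\<psi>) = 1}"
  define P where "P = {\<phi> \<^bold>\<longrightarrow> \<beta> |\<beta>. v (\<box>\<phi>) \<le> v (\<box>\<beta>)}"
  define B where "B = {(\<gamma> \<^bold>\<longrightarrow> \<phi>) \<^bold>\<or> b |\<gamma> b. v (\<box>\<phi>) < v (\<box>\<gamma>) \<and> b \<in> N}"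
  have "\<phi> \<^bold>\<longrightarrow> \<phi> \<in> P" by (auto simp: P_def)
  then have P_ne: "P \<noteq> {}" by blast
  have "(\<^bold>\<top> \<^bold>\<longrightarrow> \<phi>) \<^bold>\<or> \<^bold>\<bottom> \<in> B" using \<phi> box_top[OF v] N(1) by (auto simp: B_def)
  then have B_ne: "B \<noteq> {}" by blast
  have P_dir: "\<exists>r\<in>P. derivable L S (r \<^bold>\<longrightarrow> p) \<and> derivable L S (r \<^bold>\<longrightarrow> q)" if pq: "p \<in> P" "q \<in> P" for p q
  proof -
    obtain \<beta>1 \<beta>2 where \<beta>: "p = \<phi> \<^bold>\<longrightarrow> \<beta>1" "q = \<phi> \<^bold>\<longrightarrow> \<beta>2" "v (\<box>\<phi>) \<le> v (\<box>\<beta>1)" "v (\<box>\<phi>) \<le> v (\<box>\<beta>2)"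
      using pq by (auto simp: P_def)
    then have "\<phi> \<^bold>\<longrightarrow> (\<beta>1 \<^bold>\<and> \<beta>2) \<in> P" by (auto simp: P_def box_conj[OF v])
    moreover have "derivable L S ((\<phi> \<^bold>\<longrightarrow> (\<beta>1 \<^bold>\<and> \<beta>2)) \<^bold>\<longrightarrow> p)" "derivable L S ((\<phi> \<^bold>\<longrightarrow> (\<beta>1 \<^bold>\<and> \<beta>2)) \<^bold>\<longrightarrow> q)"
      using \<beta> by (auto intro!: prop_complete[OF gd] simp: lhom_def ghom_simps gimp_def)
    ultimately show ?thesis by blast
  qed
  have B_dir: "\<exists>d\<in>B. derivable L (S \<union> P) (b \<^bold>\<longrightarrow> d) \<and> derivable L (S \<union> P) (c \<^bold>\<longrightarrow> d)"
    if bc: "b \<in> B" "c \<in> B" for b c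
  proof -
    obtain \<gamma>1 b1 \<gamma>2 b2 where eq: "b = (\<gamma>1 \<^bold>\<longrightarrow> \<phi>) \<^bold>\<or> b1" "c = (\<gamma>2 \<^bold>\<longrightarrow> \<phi>) \<^bold>\<or> b2"
      "v (\<box>\<phi>) < v (\<box>\<gamma>1)" "v (\<box>\<phi>) < v (\<box>\<gamma>2)" "b1 \<in> N" "b2 \<in> N"
      using bc by (auto simp: B_def)
    let ?d = "((\<gamma>1 \<^bold>\<and> \<gamma>2) \<^bold>\<longrightarrow> \<phi>) \<^bold>\<or> (b1 \<^bold>\<or> b2)"
    have "?d \<in> B" using eq N(2) box_conj[OF v] by (fastforce simp: B_def)
    moreover have "derivable L (S \<union> P) (b \<^bold>\<longrightarrow> ?d)" "derivable L (S \<union> P) (c \<^bold>\<longrightarrow> ?d)"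
      unfolding eq by (rule prop_complete[OF gd]; force simp: lhom_def ghom_simps gimp_def)+
    ultimately show ?thesis by blast
  qed
  have cons: "\<not> derivable L (S \<union> P) b" if bB: "b \<in> B" for b
  proof
    assume "derivable L (S \<union> P) b"
    then obtain p where p: "p \<in> P" "derivable L S (p \<^bold>\<longrightarrow> b)"
      using derivable_directed[OF gd _ P_ne P_dir] by blast
    obtain \<gamma> c where b: "b = (\<gamma> \<^bold>\<longrightarrow> \<phi>) \<^bold>\<or> c" "v (\<box>\<phi>) < v (\<box>\<gamma>)" "c \<in> N"
      using bB by (auto simp: B_def)
    obtain \<beta> where \<beta>: "p = \<phi> \<^bold>\<longrightarrow> \<beta>" "v (\<box>\<phi>) \<le> v (\<box>\<beta>)" using p by (auto simp: P_def)
    let ?x = "\<gamma> \<^bold>\<longrightarrow> \<phi>" and ?y = "\<beta> \<^bold>\<and> \<phi> \<^bold>\<and> \<gamma>"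
    let ?p = "((?x \<^bold>\<longrightarrow> ?y) \<^bold>\<longrightarrow> ?y) \<^bold>\<and> (?y \<^bold>\<longrightarrow> ?x)"
    have "derivable L S (?p \<^bold>\<or> c)"
    proof (rule prop_complete[OF gd])
      fix w assume w: "lhom L w" "\<And>\<gamma>. \<gamma> \<in> S \<Longrightarrow> w \<gamma> = 1"
      then have "w (p \<^bold>\<longrightarrow> b) = 1" using derivable_sound[OF _ p(2)] by blast
      then show "w (?p \<^bold>\<or> c) = 1"
        using ghom_simps(6)[OF lhom_ghom[OF w(1)]] unfolding \<beta> b
        by (simp only: ghom_simps[OF lhom_ghom[OF w(1)]] box_schema_value)
    qed
    then have "v (\<box>(?p \<^bold>\<or> c)) = 1" using derivable_boxed[OF v] S_def by simp
    \<comment> \<open>The third property of \<open>N\<close> strips the side disjunct under \<box>,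
      so that \<open>W_box\<close> applies. As \<box>x \<le> \<box>\<phi> = \<box>y, the schema
      would force \<box>\<phi> = 1.\<close>
    then have "v (\<box>?p) = 1" using N(3) b by blast
    moreover have "v (\<box>?p \<^bold>\<longrightarrow> ((\<box>?x \<^bold>\<longrightarrow> \<box>?y) \<^bold>\<longrightarrow> \<box>?y)) = 1"
      using v subsetD[OF W W_box.intros] unfolding lhom_def by blast
    moreover have "v (\<box>?y) = v (\<box>\<phi>)" using box_conj[OF v] b \<beta> by simp
    moreover have "v (\<box>?x) \<le> v (\<box>\<phi>)" using box_K[OF v, of \<gamma> \<phi>] b by (simp add: gimp_def)
    ultimately show False using \<phi> by (simp add: ghom_simps(4)[OF lhom_ghom[OF v]] gimp_def)
  qed
  obtain w where w: "lhom L w" "\<And>\<psi>. \<psi> \<in> S \<union> P \<Longrightarrow> w \<psi> = 1" "\<And>b. b \<in> B \<Longrightarrow> w b < 1"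
    using hom_extension[OF gd B_ne B_dir cons] by blast
  show thesis
  proof (rule that[OF w(1)])
    have wB: "w (\<gamma> \<^bold>\<longrightarrow> \<phi>) < 1 \<and> w b < 1" if "v (\<box>\<phi>) < v (\<box>\<gamma>)" "b \<in> N" for \<gamma> b
      using w(3)[of "(\<gamma> \<^bold>\<longrightarrow> \<phi>) \<^bold>\<or> b"] that w(1) by (auto simp: B_def lhom_def ghom_simps)
    show "w \<psi> = 1" if "v (\<box>\<psi>) = 1" for \<psi> using that w(2) S_def by blast
    show "w b < 1" if "b \<in> N" for b using wB[of "\<^bold>\<top>"] box_top[OF v] \<phi> that by simp
    show "w \<phi> \<le> w \<beta>" if "v (\<box>\<phi>) \<le> v (\<box>\<beta>)" for \<beta>
      using w(1) w(2)[of "\<phi> \<^bold>\<longrightarrow> \<beta>"] that by (auto simp: P_def lhom_def ghom_Imp_eq_1)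
    show "w \<phi> < w \<gamma>" if "v (\<box>\<phi>) < v (\<box>\<gamma>)" for \<gamma>
      using wB[OF that N(1)] w(1) by (auto simp: lhom_def ghom_simps(4) gimp_def split: if_splits)
  qed
qed

end

section \<open>Successors that witness a diamond\<close>

locale dia_logic =
  fixes L :: "fm set"
  assumes gd: "gd_axioms \<subseteq> L" and dia: "dia_axioms \<subseteq> L" and W: "W_dia \<subseteq> L"
    and dia_mono_rule: "\<phi> \<^bold>\<longrightarrow> \<psi> \<in> L \<Longrightarrow> \<diamond>\<phi> \<^bold>\<longrightarrow> \<diamond>\<psi> \<in> L"
    and closed: "derivable L {} \<phi> \<Longrightarrow> \<phi> \<in> L"
begin

lemma dia_mono:
  assumes v: "lhom L v" and "\<And>w. lhom L w \<Longrightarrow> w \<phi> \<le> w \<psi>"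
  shows "v (\<diamond>\<phi>) \<le> v (\<diamond>\<psi>)"
proof -
  have "\<phi> \<^bold>\<longrightarrow> \<psi> \<in> L"
    using assms(2) by (intro closed prop_complete gd) (auto simp: lhom_def ghom_Imp_eq_1)
  then show ?thesis
    using dia_mono_rule v by (auto simp: lhom_def ghom_Imp_eq_1[symmetric])
qed

lemma dia_bot:
  assumes v: "lhom L v"
  shows "v (\<diamond>\<^bold>\<bottom>) = 0"
  using lhom_Imp_le[OF v subsetD[OF dia dia_axioms.intros(3)]] ghom_simps(1,5)[OF lhom_ghom[OF v]]
  by (simp add: order_antisym)

lemma dia_disj:
  assumes v: "lhom L v"
  shows "v (\<diamond>(\<phi> \<^bold>\<or> \<psi>)) = max (v (\<diamond>\<phi>)) (v (\<diamond>\<psi>))"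
proof -
  have "v (\<diamond>(\<phi> \<^bold>\<or> \<psi>)) \<le> max (v (\<diamond>\<phi>)) (v (\<diamond>\<psi>))"
    using lhom_Imp_le[OF v subsetD[OF dia dia_axioms.intros(1)]]
    by (simp add: ghom_simps[OF lhom_ghom[OF v]])
  moreover have "v (\<diamond>\<phi>) \<le> v (\<diamond>(\<phi> \<^bold>\<or> \<psi>))" "v (\<diamond>\<psi>) \<le> v (\<diamond>(\<phi> \<^bold>\<or> \<psi>))"
    by (auto intro!: dia_mono[OF v] simp: lhom_def ghom_simps)
  ultimately show ?thesis by simp
qed

text \<open>The hypothesis on \<open>S\<close> states what \<diamond> retains of derivations from
  premises that hold at all successors; each logic supplies its own such premises. If
  \<diamond>\<phi> = 1, it suffices to make \<phi> true and to keep every \<zeta> with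
  \<diamond>\<zeta> < 1 below 1. Otherwise a failure would give \<diamond>Q \<le> \<diamond>\<phi> <
  1 for the formula Q on the right of \<open>W_dia\<close>, with \<diamond>\<eta> <
  \<diamond>\<phi>, while the schema demands that \<diamond>\<eta> or \<diamond>Q be 1.\<close>

lemma dia_witness:
  assumes v: "lhom L v"
    and S: "\<And>\<phi> \<psi> \<zeta>. derivable L S ((\<phi> \<^bold>\<longrightarrow> \<psi>) \<^bold>\<or> \<zeta>) \<Longrightarrow> v (\<diamond>\<zeta>) < 1 \<Longrightarrow> v (\<diamond>\<phi>) \<le> v (\<diamond>\<psi>)"
    and \<phi>: "0 < v (\<diamond>\<phi>)"
  obtains w where "lhom L w" "\<And>\<psi>. \<psi> \<in> S \<Longrightarrow> w \<psi> = 1" "\<And>\<zeta>. v (\<diamond>\<zeta>) < 1 \<Longrightarrow> w \<zeta> < 1"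
    "\<And>\<delta>. v (\<diamond>\<delta>) \<le> v (\<diamond>\<phi>) \<Longrightarrow> w \<delta> \<le> w \<phi>" "\<And>\<eta>. v (\<diamond>\<eta>) < v (\<diamond>\<phi>) \<Longrightarrow> w \<eta> < w \<phi>"
    "v (\<diamond>\<phi>) = 1 \<Longrightarrow> w \<phi> = 1"
proof (cases "v (\<diamond>\<phi>) = 1")
  case True
  define B where "B = {\<zeta>. v (\<diamond>\<zeta>) < 1}"
  have "\<^bold>\<bottom> \<in> B" using dia_bot[OF v] by (simp add: B_def)
  then have B_ne: "B \<noteq> {}" by blast
  have B_dir: "\<exists>d\<in>B. derivable L (insert \<phi> S) (b \<^bold>\<longrightarrow> d) \<and> derivable L (insert \<phi> S) (c \<^bold>\<longrightarrow> d)"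
    if "b \<in> B" "c \<in> B" for b c
    using that dia_disj[OF v]
    by (intro bexI[of _ "b \<^bold>\<or> c"] conjI prop_complete[OF gd])
       (auto simp: B_def lhom_def ghom_simps gimp_def)
  have cons: "\<not> derivable L (insert \<phi> S) \<zeta>" if "\<zeta> \<in> B" for \<zeta>
  proof
    assume "derivable L (insert \<phi> S) \<zeta>"
    then have "derivable L S (\<phi> \<^bold>\<longrightarrow> \<zeta>)" by (rule deduction[OF gd])
    then have "derivable L S ((\<phi> \<^bold>\<longrightarrow> \<zeta>) \<^bold>\<or> \<^bold>\<bottom>)"
      using derivable.mp[OF derivable_gd[OF gd gd_axioms.intros(6)]] by blast
    then show False using S dia_bot[OF v] True that by (fastforce simp: B_def)
  qed
  obtain w where w: "lhom L w" "\<And>\<psi>. \<psi> \<in> insert \<phi> S \<Longrightarrow> w \<psi> = 1" "\<And>b. b \<in> B \<Longrightarrow> w b < 1"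
    using hom_extension[OF gd B_ne B_dir cons] by blast
  show thesis
    by (rule that[OF w(1)]) (use w ghom_simps(6)[of w] True in \<open>auto simp: B_def lhom_def\<close>)
next
  case False
  then have lt1: "v (\<diamond>\<phi>) < 1" using v ghom_simps(6)[of v "\<diamond>\<phi>"] by (auto simp: lhom_def)
  define P where "P = {\<delta> \<^bold>\<longrightarrow> \<phi> |\<delta>. v (\<diamond>\<delta>) \<le> v (\<diamond>\<phi>)}"
  define B where "B = {(\<phi> \<^bold>\<longrightarrow> \<eta>) \<^bold>\<or> \<zeta> |\<eta> \<zeta>. v (\<diamond>\<eta>) < v (\<diamond>\<phi>) \<and> v (\<diamond>\<zeta>) < 1}"
  have "\<phi> \<^bold>\<longrightarrow> \<phi> \<in> P" by (auto simp: P_def)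
  then have P_ne: "P \<noteq> {}" by blast
  have "(\<phi> \<^bold>\<longrightarrow> \<^bold>\<bottom>) \<^bold>\<or> \<^bold>\<bottom> \<in> B" using \<phi> dia_bot[OF v] by (auto simp: B_def)
  then have B_ne: "B \<noteq> {}" by blast
  have P_dir: "\<exists>r\<in>P. derivable L S (r \<^bold>\<longrightarrow> p) \<and> derivable L S (r \<^bold>\<longrightarrow> q)" if pq: "p \<in> P" "q \<in> P" for p q
  proof -
    obtain \<delta>1 \<delta>2 where \<delta>: "p = \<delta>1 \<^bold>\<longrightarrow> \<phi>" "q = \<delta>2 \<^bold>\<longrightarrow> \<phi>" "v (\<diamond>\<delta>1) \<le> v (\<diamond>\<phi>)" "v (\<diamond>\<delta>2) \<le> v (\<diamond>\<phi>)"
      using pq by (auto simp: P_def)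
    then have "(\<delta>1 \<^bold>\<or> \<delta>2) \<^bold>\<longrightarrow> \<phi> \<in> P" by (auto simp: P_def dia_disj[OF v])
    moreover have "derivable L S (((\<delta>1 \<^bold>\<or> \<delta>2) \<^bold>\<longrightarrow> \<phi>) \<^bold>\<longrightarrow> p)" "derivable L S (((\<delta>1 \<^bold>\<or> \<delta>2) \<^bold>\<longrightarrow> \<phi>) \<^bold>\<longrightarrow> q)"
      using \<delta> by (auto intro!: prop_complete[OF gd] simp: lhom_def ghom_simps gimp_def)
    ultimately show ?thesis by blast
  qed
  have B_dir: "\<exists>d\<in>B. derivable L (S \<union> P) (b \<^bold>\<longrightarrow> d) \<and> derivable L (S \<union> P) (c \<^bold>\<longrightarrow> d)"
    if bc: "b \<in> B" "c \<in> B" for b c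
  proof -
    obtain \<eta>1 \<zeta>1 \<eta>2 \<zeta>2 where eq: "b = (\<phi> \<^bold>\<longrightarrow> \<eta>1) \<^bold>\<or> \<zeta>1" "c = (\<phi> \<^bold>\<longrightarrow> \<eta>2) \<^bold>\<or> \<zeta>2"
      "v (\<diamond>\<eta>1) < v (\<diamond>\<phi>)" "v (\<diamond>\<eta>2) < v (\<diamond>\<phi>)" "v (\<diamond>\<zeta>1) < 1" "v (\<diamond>\<zeta>2) < 1"
      using bc by (auto simp: B_def)
    let ?d = "(\<phi> \<^bold>\<longrightarrow> (\<eta>1 \<^bold>\<or> \<eta>2)) \<^bold>\<or> (\<zeta>1 \<^bold>\<or> \<zeta>2)"
    have "?d \<in> B" using eq dia_disj[OF v] by (fastforce simp: B_def)
    moreover have "derivable L (S \<union> P) (b \<^bold>\<longrightarrow> ?d)" "derivable L (S \<union> P) (c \<^bold>\<longrightarrow> ?d)"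
      unfolding eq by (rule prop_complete[OF gd]; force simp: lhom_def ghom_simps gimp_def)+
    ultimately show ?thesis by blast
  qed
  have cons: "\<not> derivable L (S \<union> P) b" if bB: "b \<in> B" for b
  proof
    assume "derivable L (S \<union> P) b"
    then obtain p where p: "p \<in> P" "derivable L S (p \<^bold>\<longrightarrow> b)"
      using derivable_directed[OF gd _ P_ne P_dir] by blast
    obtain \<eta> \<zeta> where b: "b = (\<phi> \<^bold>\<longrightarrow> \<eta>) \<^bold>\<or> \<zeta>" "v (\<diamond>\<eta>) < v (\<diamond>\<phi>)" "v (\<diamond>\<zeta>) < 1"
      using bB by (auto simp: B_def)
    obtain \<delta> where \<delta>: "p = \<delta> \<^bold>\<longrightarrow> \<phi>" "v (\<diamond>\<delta>) \<le> v (\<diamond>\<phi>)" using p by (auto simp: P_def)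
    \<comment> \<open>With \<delta> alone in place of this disjunction, \<open>?Q\<close> could
      exceed \<phi> where \<phi> < \<eta>. Adding \<eta> prevents this and leaves \<diamond>x \<le>
      \<diamond>\<phi> intact.\<close>
    let ?x = "\<delta> \<^bold>\<or> \<eta>"
    let ?Q = "(?x \<^bold>\<longrightarrow> \<phi>) \<^bold>\<and> ((\<phi> \<^bold>\<longrightarrow> \<eta>) \<^bold>\<longrightarrow> \<eta>)"
    have "derivable L S ((?Q \<^bold>\<longrightarrow> \<phi>) \<^bold>\<or> \<zeta>)"
    proof (rule prop_complete[OF gd])
      fix w assume w: "lhom L w" "\<And>\<gamma>. \<gamma> \<in> S \<Longrightarrow> w \<gamma> = 1"
      then have "w (p \<^bold>\<longrightarrow> b) = 1" using derivable_sound[OF _ p(2)] by blast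
      then show "w ((?Q \<^bold>\<longrightarrow> \<phi>) \<^bold>\<or> \<zeta>) = 1"
        using ghom_simps(6)[OF lhom_ghom[OF w(1)]] unfolding \<delta> b
        by (simp only: ghom_simps[OF lhom_ghom[OF w(1)]] dia_schema_value)
    qed
    then have "v (\<diamond>?Q) \<le> v (\<diamond>\<phi>)" using S b by blast
    moreover have "v (((\<diamond>?x \<^bold>\<longrightarrow> \<diamond>\<phi>) \<^bold>\<and> ((\<diamond>\<phi> \<^bold>\<longrightarrow> \<diamond>\<eta>) \<^bold>\<longrightarrow> \<diamond>\<eta>)) \<^bold>\<longrightarrow> (\<diamond>\<eta> \<^bold>\<or> \<diamond>?Q)) = 1"
      using v subsetD[OF W W_dia.intros] unfolding lhom_def by blast
    moreover have "v (\<diamond>?x) \<le> v (\<diamond>\<phi>)" using dia_disj[OF v] b \<delta> by simp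
    ultimately show False
      using b lt1 by (simp add: ghom_simps[OF lhom_ghom[OF v]] gimp_def split: if_splits)
  qed
  obtain w where w: "lhom L w" "\<And>\<psi>. \<psi> \<in> S \<union> P \<Longrightarrow> w \<psi> = 1" "\<And>b. b \<in> B \<Longrightarrow> w b < 1"
    using hom_extension[OF gd B_ne B_dir cons] by blast
  show thesis
  proof (rule that[OF w(1)])
    have wB: "w (\<phi> \<^bold>\<longrightarrow> \<eta>) < 1 \<and> w \<zeta> < 1" if "v (\<diamond>\<eta>) < v (\<diamond>\<phi>)" "v (\<diamond>\<zeta>) < 1" for \<eta> \<zeta>
      using w(3)[of "(\<phi> \<^bold>\<longrightarrow> \<eta>) \<^bold>\<or> \<zeta>"] that w(1) by (auto simp: B_def lhom_def ghom_simps)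
    show "w \<psi> = 1" if "\<psi> \<in> S" for \<psi> using that w(2) by blast
    show "w \<zeta> < 1" if "v (\<diamond>\<zeta>) < 1" for \<zeta> using wB[of "\<^bold>\<bottom>"] dia_bot[OF v] \<phi> that by simp
    show "w \<delta> \<le> w \<phi>" if "v (\<diamond>\<delta>) \<le> v (\<diamond>\<phi>)" for \<delta>
      using w(1) w(2)[of "\<delta> \<^bold>\<longrightarrow> \<phi>"] that by (auto simp: P_def lhom_def ghom_Imp_eq_1)
    show "w \<eta> < w \<phi>" if "v (\<diamond>\<eta>) < v (\<diamond>\<phi>)" for \<eta>
      using wB[OF that, of "\<^bold>\<bottom>"] dia_bot[OF v] w(1)
      by (auto simp: lhom_def ghom_simps(4) gimp_def split: if_splits)
    show "w \<phi> = 1" if "v (\<diamond>\<phi>) = 1" using that lt1 by simp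
  qed
qed

end

section \<open>Families of valuations closed under witnesses\<close>

definition accessible :: "bool \<Rightarrow> bool \<Rightarrow> (fm \<Rightarrow> real) \<Rightarrow> (fm \<Rightarrow> real) \<Rightarrow> bool" where
  "accessible ub ud v w \<longleftrightarrow> (ub \<longrightarrow> (\<forall>\<psi>. v (\<box>\<psi>) \<le> w \<psi>)) \<and> (ud \<longrightarrow> (\<forall>\<psi>. w \<psi> \<le> v (\<diamond>\<psi>)))"

text \<open>Values of different worlds are compared too, since accessibility and witnessing are
  comparisons across worlds and have to survive a change of values.\<close>

definition same_order :: "nat \<Rightarrow> (nat \<Rightarrow> fm \<Rightarrow> real) \<Rightarrow> (nat \<Rightarrow> fm \<Rightarrow> real) \<Rightarrow> bool" where
  "same_order n e e' \<longleftrightarrow> (\<forall>i\<le>n. \<forall>j\<le>n. \<forall>\<phi> \<psi>. e' i \<phi> \<le> e' j \<psi> \<longleftrightarrow> e i \<phi> \<le> e j \<psi>)"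

lemma same_order_trans:
  "same_order n e e' \<Longrightarrow> same_order m e' e'' \<Longrightarrow> n \<le> m \<Longrightarrow> same_order n e e''"
  by (simp add: same_order_def)

text \<open>A box of value 1 and a diamond of value 0 make no demand, because in a crisp model any
  world witnesses them.\<close>

definition witness_at :: "bool \<Rightarrow> bool \<Rightarrow> (nat \<Rightarrow> fm \<Rightarrow> real) \<Rightarrow> fm \<Rightarrow> nat \<Rightarrow> nat \<Rightarrow> bool" where
  "witness_at ub ud e \<alpha> m n \<longleftrightarrow> (case \<alpha> of
      \<box>\<phi> \<Rightarrow> ub \<longrightarrow> e m \<alpha> < 1 \<longrightarrow> accessible ub ud (e m) (e n) \<and> e n \<phi> = e m \<alpha>
    | \<diamond>\<phi> \<Rightarrow> ud \<longrightarrow> 0 < e m \<alpha> \<longrightarrow> accessible ub ud (e m) (e n) \<and> e n \<phi> = e m \<alpha>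
    | _ \<Rightarrow> True)"

lemma lhom_bot_top:
  assumes "lhom L w"
  shows "w \<^bold>\<bottom> = 0" "w \<^bold>\<top> = 1" "0 \<le> w \<phi>" "w \<phi> \<le> 1"
  using ghom_simps[OF lhom_ghom[OF assms]] by (simp_all add: gimp_def)

definition witness_family :: "fm set \<Rightarrow> bool \<Rightarrow> bool \<Rightarrow> (nat \<Rightarrow> fm \<Rightarrow> real) \<Rightarrow> bool" where
  "witness_family L ub ud E \<longleftrightarrow> (\<forall>n. lhom L (E n)) \<and>
    (\<forall>m \<phi>. ub \<longrightarrow> E m (\<box>\<phi>) < 1 \<longrightarrow> (\<exists>n. accessible ub ud (E m) (E n) \<and> E n \<phi> = E m (\<box>\<phi>))) \<and>
    (\<forall>m \<phi>. ud \<longrightarrow> 0 < E m (\<diamond>\<phi>) \<longrightarrow> (\<exists>n. accessible ub ud (E m) (E n) \<and> E n \<phi> = E m (\<diamond>\<phi>)))"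

text \<open>This isolates what a logic has to contribute: for each demand a homomorphism whose
  values stand in the right order. Fitting real numbers is then done once for the full logic and
  both fragments.\<close>

locale witness_logic =
  fixes L :: "fm set" and ub ud :: bool
  assumes box_step: "ub \<Longrightarrow> lhom L v \<Longrightarrow> v (\<box>\<phi>) < 1 \<Longrightarrow>
      \<exists>w. lhom L w \<and> separates w (lower_bounds ub v \<phi> (v (\<box>\<phi>))) (upper_bounds ud v \<phi> (v (\<box>\<phi>)))"
    and dia_step: "ud \<Longrightarrow> lhom L v \<Longrightarrow> 0 < v (\<diamond>\<phi>) \<Longrightarrow>
      \<exists>w. lhom L w \<and> separates w (lower_bounds ub v \<phi> (v (\<diamond>\<phi>))) (upper_bounds ud v \<phi> (v (\<diamond>\<phi>)))"
begin

text \<open>All values in use so far form one countable chain, which is merged with the range of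
  \<open>w\<close>. Old worlds are composed with the embedding of the first chain and the new world
  with that of the second. The pair of \<phi> and its target value is both a lower and an upper
  bound, so the target is hit exactly.\<close>

lemma add_world:
  assumes e: "\<And>i. i \<le> n \<Longrightarrow> lhom L (e i)" and m: "m \<le> n" and w: "lhom L w"
    and sep: "separates w (lower_bounds ub (e m) \<phi> (e m \<alpha>)) (upper_bounds ud (e m) \<phi> (e m \<alpha>))"
  obtains e' where "\<And>i. i \<le> Suc n \<Longrightarrow> lhom L (e' i)" "same_order n e e'"
    "accessible ub ud (e' m) (e' (Suc n))" "e' (Suc n) \<phi> = e' m \<alpha>"
proof -
  define C where "C = (\<Union>i\<le>n. range (e i))"
  define U where "U = (\<lambda>(\<beta>, b). (w \<beta>, b)) ` lower_bounds ub (e m) \<phi> (e m \<alpha>)"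
  define V where "V = (\<lambda>(\<delta>, d). (w \<delta>, d)) ` upper_bounds ud (e m) \<phi> (e m \<alpha>)"
  have eC: "e i \<psi> \<in> C" if "i \<le> n" for i \<psi> using that by (auto simp: C_def)
  have C: "countable C" "C \<subseteq> {0..1}" "0 \<in> C" "1 \<in> C"
    using lhom_bot_top[OF e] eC[of 0 "\<^bold>\<bottom>"] eC[of 0 "\<^bold>\<top>"] by (auto simp: C_def)
  have D: "countable (range w)" "range w \<subseteq> {0..1}" "0 \<in> range w" "1 \<in> range w"
    using lhom_bot_top[OF w] by (auto intro: rev_image_eqI)
  have UV0: "(0, 0) \<in> U" "(1, 1) \<in> U" "(0, 0) \<in> V" "(1, 1) \<in> V"
    using lhom_bot_top[OF w] by (force simp: U_def V_def lower_bounds_def upper_bounds_def)+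
  have UV: "(d \<le> b \<longrightarrow> y \<le> x) \<and> (d < b \<longrightarrow> y < x)" if "(x, b) \<in> U" "(y, d) \<in> V" for x b y d
    using that sep unfolding U_def V_def separates_def by fastforce
  obtain f g :: "real \<Rightarrow> real" where
    f: "\<And>a b. a \<in> C \<Longrightarrow> b \<in> C \<Longrightarrow> f a \<le> f b \<longleftrightarrow> a \<le> b" "f 0 = 0" "f 1 = 1"
    and g: "\<And>x y. x \<in> range w \<Longrightarrow> y \<in> range w \<Longrightarrow> g x \<le> g y \<longleftrightarrow> x \<le> y" "g 0 = 0" "g 1 = 1"
    and lo: "\<And>x b. (x, b) \<in> U \<Longrightarrow> x \<in> range w \<Longrightarrow> b \<in> C \<Longrightarrow> f b \<le> g x"
    and hi: "\<And>y d. (y, d) \<in> V \<Longrightarrow> y \<in> range w \<Longrightarrow> d \<in> C \<Longrightarrow> g y \<le> f d"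
    by (rule merge_chains[OF C D UV0], erule (1) UV) (rule that)
  define e' where "e' i = (if i \<le> n then f \<circ> e i else g \<circ> w)" for i
  have "lhom L (e' i)" for i
  proof (cases "i \<le> n")
    case True
    then show ?thesis
      using f eC lhom_bot_top[OF e[OF True]]
      by (intro lhom_order_transfer[OF e[OF True]]) (auto simp: e'_def)
  next
    case False
    then show ?thesis
      using g lhom_bot_top[OF w] by (intro lhom_order_transfer[OF w]) (auto simp: e'_def)
  qed
  moreover have "same_order n e e'"
    using f(1) eC by (simp add: same_order_def e'_def)
  moreover have "accessible ub ud (e' m) (e' (Suc n))"
  proof -
    have "f (e m (\<box>\<psi>)) \<le> g (w \<psi>)" if ub for \<psi>
      using that eC[OF m] by (intro lo) (force simp: U_def lower_bounds_def)+
    moreover have "g (w \<psi>) \<le> f (e m (\<diamond>\<psi>))" if ud for \<psi>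
      using that eC[OF m] by (intro hi) (force simp: V_def upper_bounds_def)+
    ultimately show ?thesis using m by (simp add: accessible_def e'_def)
  qed
  moreover have "e' (Suc n) \<phi> = e' m \<alpha>"
  proof -
    have "f (e m \<alpha>) \<le> g (w \<phi>)"
      using eC[OF m] by (intro lo) (force simp: U_def lower_bounds_def)+
    moreover have "g (w \<phi>) \<le> f (e m \<alpha>)"
      using eC[OF m] by (intro hi) (force simp: V_def upper_bounds_def)+
    ultimately show ?thesis using m by (simp add: e'_def)
  qed
  ultimately show thesis using that by blast
qed

lemma stage:
  assumes e: "\<And>i. i \<le> n \<Longrightarrow> lhom L (e i)" and m: "m \<le> n"
  shows "\<exists>e'. (\<forall>i\<le>Suc n. lhom L (e' i)) \<and> same_order n e e' \<and> witness_at ub ud e' \<alpha> m (Suc n)"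
proof -
  have less: "e m \<alpha> < 1 \<longleftrightarrow> e' m \<alpha> < 1" "0 < e m \<alpha> \<longleftrightarrow> 0 < e' m \<alpha>"
    if so: "same_order n e e'" and e': "\<And>i. i \<le> Suc n \<Longrightarrow> lhom L (e' i)" for e'
  proof -
    have "lhom L (e m)" "lhom L (e' m)" using e e' m by auto
    note ends = lhom_bot_top[OF this(1)] lhom_bot_top[OF this(2)]
    show "e m \<alpha> < 1 \<longleftrightarrow> e' m \<alpha> < 1" "0 < e m \<alpha> \<longleftrightarrow> 0 < e' m \<alpha>"
      using so m ends(1,2,5,6) unfolding same_order_def by (metis not_le)+
  qed
  have trivial: ?thesis if "\<And>e'. same_order n e e' \<Longrightarrow> (\<And>i. i \<le> Suc n \<Longrightarrow> lhom L (e' i)) \<Longrightarrow>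
      witness_at ub ud e' \<alpha> m (Suc n)"
  proof -
    \<comment> \<open>Nothing has to be witnessed, so a copy of world n fills the new index.\<close>
    have "same_order n e (e(Suc n := e n))" by (simp add: same_order_def)
    moreover have "lhom L ((e(Suc n := e n)) i)" if "i \<le> Suc n" for i
      using e that by auto
    ultimately show ?thesis using that by blast
  qed
  have active: ?thesis
    if w: "lhom L w" and sep: "separates w (lower_bounds ub (e m) \<phi> (e m \<alpha>)) (upper_bounds ud (e m) \<phi> (e m \<alpha>))"
      and \<alpha>: "\<alpha> = \<box>\<phi> \<or> \<alpha> = \<diamond>\<phi>" for w \<phi>
  proof -
    obtain e' where "\<And>i. i \<le> Suc n \<Longrightarrow> lhom L (e' i)" "same_order n e e'"
      "accessible ub ud (e' m) (e' (Suc n))" "e' (Suc n) \<phi> = e' m \<alpha>"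
      using add_world[of n e m w \<phi> \<alpha>] e m w sep by metis
    then show ?thesis using \<alpha> by (intro exI[of _ e']) (auto simp: witness_at_def)
  qed
  show ?thesis
  proof (cases \<alpha>)
    case (Box \<phi>)
    show ?thesis
    proof (cases "ub \<and> e m \<alpha> < 1")
      case True
      then show ?thesis using box_step[of "e m" \<phi>] e[OF m] active Box by blast
    next
      case False
      then show ?thesis using less by (intro trivial) (auto simp: Box witness_at_def)
    qed
  next
    case (Dia \<phi>)
    show ?thesis
    proof (cases "ud \<and> 0 < e m \<alpha>")
      case True
      then show ?thesis using dia_step[of "e m" \<phi>] e[OF m] active Dia by blast
    next
      case False
      then show ?thesis using less by (intro trivial) (auto simp: Dia witness_at_def)
    qed
  qed (rule trivial, simp add: witness_at_def)+
qed

text \<open>Each stage adds one world and changes the values of the earlier worlds only by an order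
  isomorphism, so the orders stabilise and the limit order can be embedded into \<open>[0,1]\<close> again.\<close>

theorem witness_family_exists:
  assumes v0: "lhom L v0"
  shows "\<exists>E. witness_family L ub ud E \<and> (\<forall>\<phi>. E 0 \<phi> = 1 \<longleftrightarrow> v0 \<phi> = 1)"
proof -
  \<comment> \<open>Stage n adds world \<open>Suc n\<close>, and its task concerns a world of index
    at most n, hence one that exists already. Visiting each demand once suffices: a witness is
    described by the order of values, which later stages preserve.\<close>
  define task where "task n = (fst (prod_decode n), from_nat (snd (prod_decode n)) :: fm)" for n
  have task_le: "fst (task n) \<le> n" for n
    using le_prod_encode_1[of "fst (prod_decode n)" "snd (prod_decode n)"] by (simp add: task_def)
  have task_surj: "\<exists>n. task n = (m, \<alpha>)" for m \<alpha>
    by (rule exI[of _ "prod_encode (m, to_nat \<alpha>)"]) (simp add: task_def)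
  have "\<exists>s. \<forall>n. ((\<forall>i\<le>n. lhom L (s n i)) \<and> (n = 0 \<longrightarrow> s n = (\<lambda>_. v0))) \<and>
      (same_order n (s n) (s (Suc n)) \<and>
       witness_at ub ud (s (Suc n)) (snd (task n)) (fst (task n)) (Suc n))"
    by (rule dependent_nat_choice) (use v0 stage[OF _ task_le] in auto)
  then obtain s where s: "\<And>n i. i \<le> n \<Longrightarrow> lhom L (s n i)" "s 0 = (\<lambda>_. v0)"
    "\<And>n. same_order n (s n) (s (Suc n))"
    "\<And>n. witness_at ub ud (s (Suc n)) (snd (task n)) (fst (task n)) (Suc n)"
    by metis
  have so: "same_order n (s n) (s N)" if "n \<le> N" for n N
    using that
  proof (induction rule: dec_induct)
    case base
    show ?case by (simp add: same_order_def)
  next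
    case (step k)
    then show ?case using same_order_trans s(3) by blast
  qed
  \<comment> \<open>Two values are compared at the first stage at which both of their worlds exist;
    by \<open>so\<close> every later stage gives the same answer.\<close>
  define r :: "nat \<times> fm \<Rightarrow> nat \<times> fm \<Rightarrow> bool" where
    "r p q \<longleftrightarrow> s (max (fst p) (fst q)) (fst p) (snd p) \<le> s (max (fst p) (fst q)) (fst q) (snd q)" for p q
  have r: "r (i, \<phi>) (j, \<psi>) \<longleftrightarrow> s N i \<phi> \<le> s N j \<psi>" if "i \<le> N" "j \<le> N" for i j N \<phi> \<psi>
    using so[of "max i j" N] that by (simp add: r_def same_order_def)
  obtain h :: "nat \<times> fm \<Rightarrow> real" where h: "\<And>p q. h p \<le> h q \<longleftrightarrow> r p q"
    and h0: "h (0, \<^bold>\<bottom>) = 0" and h1: "h (0, \<^bold>\<top>) = 1"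
  proof (rule countable_preorder_embedding[of "UNIV :: (nat \<times> fm) set" r "(0, \<^bold>\<bottom>)" "(0, \<^bold>\<top>)"])
    show "r p q \<or> r q p" for p q by (auto simp: r_def max.commute)
    show "r p q" if "r p t" "r t q" for p t q
    proof -
      let ?N = "max (fst p) (max (fst t) (fst q))"
      have *: "r a b \<longleftrightarrow> s ?N (fst a) (snd a) \<le> s ?N (fst b) (snd b)"
        if "fst a \<le> ?N" "fst b \<le> ?N" for a b
        using r[OF that, of "snd a" "snd b"] by simp
      show ?thesis using that *[of p t] *[of t q] *[of p q] by (simp add: le_max_iff_disj)
    qed
    show "r (0, \<^bold>\<bottom>) p" for p
      using lhom_bot_top[OF s(1)] by (auto simp: r_def)
    show "r p (0, \<^bold>\<top>)" for p
      using lhom_bot_top[OF s(1)] by (auto simp: r_def)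
    show "\<not> r (0, \<^bold>\<top>) (0, \<^bold>\<bottom>)"
      using lhom_bot_top[OF s(1)] by (auto simp: r_def)
  qed auto
  define E where "E i \<phi> = h (i, \<phi>)" for i \<phi>
  have E: "E i \<phi> \<le> E j \<psi> \<longleftrightarrow> s N i \<phi> \<le> s N j \<psi>" if "i \<le> N" "j \<le> N" for i j N \<phi> \<psi>
    using r[OF that] h by (simp add: E_def)
  have E_eq: "E i \<phi> = E j \<psi> \<longleftrightarrow> s N i \<phi> = s N j \<psi>" if "i \<le> N" "j \<le> N" for i j N \<phi> \<psi>
    using E[OF that, of \<phi> \<psi>] E[OF that(2,1), of \<psi> \<phi>] by (metis order_antisym order_refl)
  have bt: "E i \<^bold>\<bottom> = 0" "E i \<^bold>\<top> = 1" for i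
    using E_eq[of i i 0 "\<^bold>\<bottom>" "\<^bold>\<bottom>"] E_eq[of i i 0 "\<^bold>\<top>" "\<^bold>\<top>"] h0 h1 lhom_bot_top[OF s(1)]
    by (auto simp: E_def)
  have lh: "lhom L (E i)" for i
    by (rule lhom_order_transfer[OF s(1)[of i i]]) (auto simp: E bt)
  have acc: "accessible ub ud (E i) (E j)" if "accessible ub ud (s N i) (s N j)" "i \<le> N" "j \<le> N" for i j N
    using that by (simp add: accessible_def E[OF that(2,3)] E[OF that(3,2)])
  have lt1: "s N i \<phi> < 1 \<longleftrightarrow> E i \<phi> < 1" and gt0: "0 < s N i \<phi> \<longleftrightarrow> 0 < E i \<phi>" if "i \<le> N" for i N \<phi>
    using E[OF that that, of "\<^bold>\<top>" \<phi>] E[OF that that, of \<phi> "\<^bold>\<bottom>"] bt lhom_bot_top[OF s(1)[OF that]]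
    by (auto simp: not_le[symmetric])
  show ?thesis
    unfolding witness_family_def
  proof (intro exI[of _ E] conjI allI impI)
    show "lhom L (E n)" for n by (rule lh)
    show "E 0 \<phi> = 1 \<longleftrightarrow> v0 \<phi> = 1" for \<phi>
      using E_eq[of 0 0 0 \<phi> "\<^bold>\<top>"] bt s(2) lhom_bot_top[OF v0] by simp
    fix m \<phi>
    {
      assume "ub" "E m (\<box>\<phi>) < 1"
      obtain n where n: "task n = (m, \<box>\<phi>)" using task_surj by blast
      then have "m \<le> Suc n" using task_le[of n] by simp
      then show "\<exists>n. accessible ub ud (E m) (E n) \<and> E n \<phi> = E m (\<box>\<phi>)"
        using s(4)[of n] n acc[of "Suc n" m "Suc n"] E_eq[of "Suc n" "Suc n" m \<phi> "\<box>\<phi>"]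
          lt1[of m "Suc n" "\<box>\<phi>"] \<open>ub\<close> \<open>E m (\<box>\<phi>) < 1\<close>
        by (auto simp: witness_at_def)
    }
    {
      assume "ud" "0 < E m (\<diamond>\<phi>)"
      obtain n where n: "task n = (m, \<diamond>\<phi>)" using task_surj by blast
      then have "m \<le> Suc n" using task_le[of n] by simp
      then show "\<exists>n. accessible ub ud (E m) (E n) \<and> E n \<phi> = E m (\<diamond>\<phi>)"
        using s(4)[of n] n acc[of "Suc n" m "Suc n"] E_eq[of "Suc n" "Suc n" m \<phi> "\<diamond>\<phi>"]
          gt0[of m "Suc n" "\<diamond>\<phi>"] \<open>ud\<close> \<open>0 < E m (\<diamond>\<phi>)\<close>
        by (auto simp: witness_at_def)
    }
  qed
qed

end

section \<open>The three logics\<close>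

text \<open>There are four kinds of lower and four kinds of upper bounds. The pairs involving
  \<bottom> or \<top> amount to saying when a value is 0, positive, below 1 or equal to 1; the
  remaining pairs compare \<phi>, the boxes and the diamonds with each other.\<close>

lemma separates_boundsI:
  assumes w: "lhom L w" and a: "0 \<le> a" "a \<le> 1"
    and "a = 0 \<Longrightarrow> w \<phi> = 0" "a < 1 \<Longrightarrow> w \<phi> < 1" "a = 1 \<Longrightarrow> w \<phi> = 1" "0 < a \<Longrightarrow> 0 < w \<phi>"
    and v: "lhom L v"
    and "\<And>\<beta>. ub \<Longrightarrow> v (\<box>\<beta>) = 1 \<Longrightarrow> w \<beta> = 1" "\<And>\<beta>. ub \<Longrightarrow> 0 < v (\<box>\<beta>) \<Longrightarrow> 0 < w \<beta>"
      "\<And>\<beta>. ub \<Longrightarrow> a \<le> v (\<box>\<beta>) \<Longrightarrow> w \<phi> \<le> w \<beta>" "\<And>\<beta>. ub \<Longrightarrow> a < v (\<box>\<beta>) \<Longrightarrow> w \<phi> < w \<beta>"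
    and "\<And>\<delta>. ud \<Longrightarrow> v (\<diamond>\<delta>) = 0 \<Longrightarrow> w \<delta> = 0" "\<And>\<delta>. ud \<Longrightarrow> v (\<diamond>\<delta>) < 1 \<Longrightarrow> w \<delta> < 1"
      "\<And>\<delta>. ud \<Longrightarrow> v (\<diamond>\<delta>) \<le> a \<Longrightarrow> w \<delta> \<le> w \<phi>" "\<And>\<delta>. ud \<Longrightarrow> v (\<diamond>\<delta>) < a \<Longrightarrow> w \<delta> < w \<phi>"
    and "\<And>\<beta> \<delta>. ub \<Longrightarrow> ud \<Longrightarrow> v (\<diamond>\<delta>) \<le> v (\<box>\<beta>) \<Longrightarrow> w \<delta> \<le> w \<beta>"
      "\<And>\<beta> \<delta>. ub \<Longrightarrow> ud \<Longrightarrow> v (\<diamond>\<delta>) < v (\<box>\<beta>) \<Longrightarrow> w \<delta> < w \<beta>"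
  shows "separates w (lower_bounds ub v \<phi> a) (upper_bounds ud v \<phi> a)"
proof -
  have *: "(d \<le> b \<longrightarrow> w \<delta> \<le> w \<beta>) \<and> (d < b \<longrightarrow> w \<delta> < w \<beta>)"
    if lo: "(\<beta>, b) \<in> lower_bounds ub v \<phi> a" and hi: "(\<delta>, d) \<in> upper_bounds ud v \<phi> a" for \<beta> b \<delta> d
  proof -
    note ends = lhom_bot_top(1,2)[OF w]
    have range: "0 \<le> w \<psi>" "w \<psi> \<le> 1" "0 \<le> v \<psi>" "v \<psi> \<le> 1" for \<psi>
      using lhom_bot_top[OF w] lhom_bot_top[OF v] by auto
    consider "\<beta> = \<^bold>\<bottom>" "b = 0" | "\<beta> = \<^bold>\<top>" "b = 1" | "\<beta> = \<phi>" "b = a" | "ub" "b = v (\<box>\<beta>)"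
      using lo by (auto simp: lower_bounds_def split: if_splits)
    moreover consider "\<delta> = \<^bold>\<bottom>" "d = 0" | "\<delta> = \<^bold>\<top>" "d = 1" | "\<delta> = \<phi>" "d = a" | "ud" "d = v (\<diamond>\<delta>)"
      using hi by (auto simp: upper_bounds_def split: if_splits)
    ultimately show ?thesis
      using a ends range[of \<phi>] range[of \<beta>] range[of \<delta>] range(3,4)[of "\<box>\<beta>"] range(3,4)[of "\<diamond>\<delta>"] assms(4-7,9-)
      by (smt (verit))
  qed
  then show ?thesis by (auto simp: separates_def)
qed

section \<open>Witnesses in the full logic\<close>

abbreviation KGW :: "fm set"
  where "KGW \<equiv> KG (W_box \<union> W_dia)"

lemma KGW_closed: "derivable KGW {} \<phi> \<Longrightarrow> \<phi> \<in> KGW"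
  by (induction rule: derivable.induct) (auto intro: KG.mp)

interpretation KGW_box: box_logic KGW
  by unfold_locales (auto intro: KG.intros KGW_closed)

interpretation KGW_dia: dia_logic KGW
  by unfold_locales (auto intro: KG.intros KGW_closed)

lemma KGW_mixed:
  assumes v: "lhom KGW v"
  shows "v (\<diamond>(\<phi> \<^bold>\<longrightarrow> \<psi>)) \<le> gimp (v (\<box>\<phi>)) (v (\<diamond>\<psi>))"
    and "gimp (v (\<diamond>\<phi>)) (v (\<box>\<psi>)) \<le> v (\<box>(\<phi> \<^bold>\<longrightarrow> \<psi>))"
    and "v (\<box>(\<phi> \<^bold>\<or> \<psi>)) \<le> max (v (\<box>\<phi>)) (v (\<diamond>\<psi>))"
proof -
  have "\<chi> \<in> KGW" if "\<chi> \<in> mixed_axioms" for \<chi> using that by (auto intro: KG.ax)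
  note le = lhom_Imp_le[OF v this]
  show "v (\<diamond>(\<phi> \<^bold>\<longrightarrow> \<psi>)) \<le> gimp (v (\<box>\<phi>)) (v (\<diamond>\<psi>))" "gimp (v (\<diamond>\<phi>)) (v (\<box>\<psi>)) \<le> v (\<box>(\<phi> \<^bold>\<longrightarrow> \<psi>))"
    "v (\<box>(\<phi> \<^bold>\<or> \<psi>)) \<le> max (v (\<box>\<phi>)) (v (\<diamond>\<psi>))"
    using le[OF mixed_axioms.intros(1)[of \<phi> \<psi>]] le[OF mixed_axioms.intros(2)[of \<phi> \<psi>]]
      le[OF mixed_axioms.intros(3)[of \<phi> \<psi>]]
    by (simp_all add: ghom_simps(3,4)[OF lhom_ghom[OF v]])
qed

text \<open>Two mixed axioms reduce all comparisons of diamonds with boxes to end values. If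
  \<diamond>\<delta> \<le> \<box>\<beta>, then \<box>(\<delta> \<rightarrow> \<beta>) = 1, so the
  implication is true at the successor. If \<diamond>\<delta> < \<box>\<beta>, then
  \<diamond>(\<beta> \<rightarrow> \<delta>) \<le> \<diamond>\<delta> < 1, so the reverse
  implication fails there.\<close>

lemma KGW_successor_bounds:
  assumes v: "lhom KGW v" and w: "lhom KGW w"
    and S: "\<And>\<psi>. v (\<box>\<psi>) = 1 \<Longrightarrow> w \<psi> = 1" and N: "\<And>\<zeta>. v (\<diamond>\<zeta>) < 1 \<Longrightarrow> w \<zeta> < 1"
  shows "v (\<diamond>\<delta>) \<le> v (\<box>\<beta>) \<Longrightarrow> w \<delta> \<le> w \<beta>" "v (\<diamond>\<delta>) < v (\<box>\<beta>) \<Longrightarrow> w \<delta> < w \<beta>"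
proof -
  note g = lhom_ghom[OF w] and range = lhom_bot_top(3,4)[OF v]
  show "w \<delta> \<le> w \<beta>" if "v (\<diamond>\<delta>) \<le> v (\<box>\<beta>)"
    using that KGW_mixed(2)[OF v, of \<delta> \<beta>] S[of "\<delta> \<^bold>\<longrightarrow> \<beta>"] range(2)[of "\<box>(\<delta> \<^bold>\<longrightarrow> \<beta>)"]
    by (simp add: ghom_Imp_eq_1[OF g] gimp_def)
  show "w \<delta> < w \<beta>" if "v (\<diamond>\<delta>) < v (\<box>\<beta>)"
    using that KGW_mixed(1)[OF v, of \<beta> \<delta>] N[of "\<beta> \<^bold>\<longrightarrow> \<delta>"] range(2)[of "\<box>\<beta>"]
    by (auto simp: ghom_simps(4)[OF g] gimp_def split: if_splits)
qed

text \<open>This is the hypothesis of \<open>dia_witness\<close> for premises under \<box>. The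
  axiom \<box>(\<phi> \<or> \<psi>) \<rightarrow> (\<box>\<phi> \<or> \<diamond>\<psi>) removes
  \<zeta>, and \<box>(\<phi> \<rightarrow> \<psi>) = 1 gives the inequality because \<phi> implies
  (\<phi> \<rightarrow> \<psi>) \<rightarrow> \<psi>.\<close>

lemma KGW_dia_le:
  assumes v: "lhom KGW v" and "derivable KGW {\<psi>. v (\<box>\<psi>) = 1} ((\<phi> \<^bold>\<longrightarrow> \<psi>) \<^bold>\<or> \<zeta>)" "v (\<diamond>\<zeta>) < 1"
  shows "v (\<diamond>\<phi>) \<le> v (\<diamond>\<psi>)"
proof -
  have "v (\<box>((\<phi> \<^bold>\<longrightarrow> \<psi>) \<^bold>\<or> \<zeta>)) = 1" by (rule KGW_box.derivable_boxed[OF v assms(2)])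
  then have 1: "v (\<box>(\<phi> \<^bold>\<longrightarrow> \<psi>)) = 1"
    using KGW_mixed(3)[OF v, of "\<phi> \<^bold>\<longrightarrow> \<psi>" \<zeta>] assms(3) lhom_bot_top(4)[OF v, of "\<box>(\<phi> \<^bold>\<longrightarrow> \<psi>)"] by simp
  have "v (\<diamond>\<phi>) \<le> v (\<diamond>((\<phi> \<^bold>\<longrightarrow> \<psi>) \<^bold>\<longrightarrow> \<psi>))"
    by (rule KGW_dia.dia_mono[OF v]) (auto simp: lhom_def ghom_simps gimp_def)
  also have "\<dots> \<le> gimp 1 (v (\<diamond>\<psi>))"
    using KGW_mixed(1)[OF v, of "\<phi> \<^bold>\<longrightarrow> \<psi>" \<psi>] 1 by simp
  also have "\<dots> = v (\<diamond>\<psi>)" using lhom_bot_top(4)[OF v, of "\<diamond>\<psi>"] by (simp add: gimp_def)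
  finally show ?thesis .
qed

interpretation KGW: witness_logic KGW True True
proof
  fix v \<phi> assume v: "lhom KGW v"
  note range = lhom_bot_top(3,4)[OF v]
  {
    assume \<phi>: "v (\<box>\<phi>) < 1"
    obtain w where w: "lhom KGW w" "\<And>\<psi>. v (\<box>\<psi>) = 1 \<Longrightarrow> w \<psi> = 1" "\<And>b. b \<in> {\<zeta>. v (\<diamond>\<zeta>) < 1} \<Longrightarrow> w b < 1"
      "\<And>\<beta>. v (\<box>\<phi>) \<le> v (\<box>\<beta>) \<Longrightarrow> w \<phi> \<le> w \<beta>" "\<And>\<gamma>. v (\<box>\<phi>) < v (\<box>\<gamma>) \<Longrightarrow> w \<phi> < w \<gamma>"
    \<comment> \<open>Formulas whose diamond is below 1 must stay below 1 at the successor. They may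
      serve as \<open>N\<close> because \<box>(\<psi> \<or> b) \<le> max (\<box>\<psi>)
      (\<diamond>b).\<close>
    proof (rule KGW_box.box_witness[OF v \<phi>, of "{\<zeta>. v (\<diamond>\<zeta>) < 1}"])
      show "v (\<box>\<psi>) = 1" if "b \<in> {\<zeta>. v (\<diamond>\<zeta>) < 1}" "v (\<box>(\<psi> \<^bold>\<or> b)) = 1" for \<psi> b
        using that KGW_mixed(3)[OF v, of \<psi> b] range(2)[of "\<box>\<psi>"] by simp
    qed (use KGW_dia.dia_bot[OF v] KGW_dia.dia_disj[OF v] in auto)
    have N: "w \<zeta> < 1" if "v (\<diamond>\<zeta>) < 1" for \<zeta> using that w(3) by simp
    note sb = KGW_successor_bounds[OF v w(1,2) N]
    have "separates w (lower_bounds True v \<phi> (v (\<box>\<phi>))) (upper_bounds True v \<phi> (v (\<box>\<phi>)))"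
    proof (rule separates_boundsI[OF w(1) range _ _ _ _ v])
      note wr = lhom_bot_top[OF w(1)]
      show "w \<phi> = 0" if "v (\<box>\<phi>) = 0"
        using w(4)[of "\<^bold>\<bottom>"] that range(1)[of "\<box>\<^bold>\<bottom>"] wr(1) wr(3)[of \<phi>] by simp
      show "w \<phi> < 1" using w(5)[of "\<^bold>\<top>"] \<phi> KGW_box.box_top[OF v] wr(2) by simp
      show "w \<phi> = 1" if "v (\<box>\<phi>) = 1" using \<phi> that by simp
      have pos: "0 < w \<beta>" if "0 < v (\<box>\<beta>)" for \<beta>
        using sb(2)[of "\<^bold>\<bottom>" \<beta>] KGW_dia.dia_bot[OF v] that wr(1) by simp
      then show "0 < w \<phi>" if "0 < v (\<box>\<phi>)" using that by simp
      show "0 < w \<beta>" if "0 < v (\<box>\<beta>)" for \<beta> using pos that by simp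
      show "w \<delta> = 0" if "v (\<diamond>\<delta>) = 0" for \<delta>
        using sb(1)[of \<delta> "\<^bold>\<bottom>"] that range(1)[of "\<box>\<^bold>\<bottom>"] wr(1) wr(3)[of \<delta>] by simp
    qed (use w sb N in auto)
    then show "\<exists>w. lhom KGW w \<and>
        separates w (lower_bounds True v \<phi> (v (\<box>\<phi>))) (upper_bounds True v \<phi> (v (\<box>\<phi>)))"
      using w(1) by blast
  }
  {
    assume \<phi>: "0 < v (\<diamond>\<phi>)"
    obtain w where w: "lhom KGW w" "\<And>\<psi>. \<psi> \<in> {\<psi>. v (\<box>\<psi>) = 1} \<Longrightarrow> w \<psi> = 1" "\<And>\<zeta>. v (\<diamond>\<zeta>) < 1 \<Longrightarrow> w \<zeta> < 1"
      "\<And>\<delta>. v (\<diamond>\<delta>) \<le> v (\<diamond>\<phi>) \<Longrightarrow> w \<delta> \<le> w \<phi>" "\<And>\<eta>. v (\<diamond>\<eta>) < v (\<diamond>\<phi>) \<Longrightarrow> w \<eta> < w \<phi>"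
      "v (\<diamond>\<phi>) = 1 \<Longrightarrow> w \<phi> = 1"
      by (rule KGW_dia.dia_witness[OF v KGW_dia_le[OF v] \<phi>]) (assumption+, rule that)
    have S: "w \<psi> = 1" if "v (\<box>\<psi>) = 1" for \<psi> using that w(2) by simp
    note sb = KGW_successor_bounds[OF v w(1) S w(3)]
    have "separates w (lower_bounds True v \<phi> (v (\<diamond>\<phi>))) (upper_bounds True v \<phi> (v (\<diamond>\<phi>)))"
    proof (rule separates_boundsI[OF w(1) range _ _ _ _ v])
      note wr = lhom_bot_top[OF w(1)]
      show "w \<phi> = 0" if "v (\<diamond>\<phi>) = 0" using \<phi> that by simp
      show "0 < w \<phi>" using w(5)[of "\<^bold>\<bottom>"] \<phi> KGW_dia.dia_bot[OF v] wr(1) by simp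
      show "0 < w \<beta>" if "0 < v (\<box>\<beta>)" for \<beta>
        using sb(2)[of "\<^bold>\<bottom>" \<beta>] KGW_dia.dia_bot[OF v] that wr(1) by simp
      show "w \<delta> = 0" if "v (\<diamond>\<delta>) = 0" for \<delta>
        using sb(1)[of \<delta> "\<^bold>\<bottom>"] that range(1)[of "\<box>\<^bold>\<bottom>"] wr(1) wr(3)[of \<delta>] by simp
    qed (use w S sb \<phi> in auto)
    then show "\<exists>w. lhom KGW w \<and>
        separates w (lower_bounds True v \<phi> (v (\<diamond>\<phi>))) (upper_bounds True v \<phi> (v (\<diamond>\<phi>)))"
      using w(1) by blast
  }
qed

text \<open>The two fragments without their restriction to \<open>box_fms\<close> and \<open>dia_fms\<close>: the modality
  outside the fragment is then uninterpreted.\<close>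

inductive_set box_theorems :: "fm set" where
  ax: "\<phi> \<in> gd_axioms \<union> box_axioms \<union> W_box \<Longrightarrow> \<phi> \<in> box_theorems"
| mp: "\<phi> \<^bold>\<longrightarrow> \<psi> \<in> box_theorems \<Longrightarrow> \<phi> \<in> box_theorems \<Longrightarrow> \<psi> \<in> box_theorems"
| nec_box: "\<phi> \<in> box_theorems \<Longrightarrow> \<box>\<phi> \<in> box_theorems"

inductive_set dia_theorems :: "fm set" where
  ax: "\<phi> \<in> gd_axioms \<union> dia_axioms \<union> W_dia \<Longrightarrow> \<phi> \<in> dia_theorems"
| mp: "\<phi> \<^bold>\<longrightarrow> \<psi> \<in> dia_theorems \<Longrightarrow> \<phi> \<in> dia_theorems \<Longrightarrow> \<psi> \<in> dia_theorems"
| dia_rule: "(\<phi> \<^bold>\<longrightarrow> \<psi>) \<^bold>\<or> \<chi> \<in> dia_theorems \<Longrightarrow> (\<diamond>\<phi> \<^bold>\<longrightarrow> \<diamond>\<psi>) \<^bold>\<or> \<diamond>\<chi> \<in> dia_theorems"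

section \<open>Witnesses in the fragments\<close>

lemma box_theorems_closed: "derivable box_theorems {} \<phi> \<Longrightarrow> \<phi> \<in> box_theorems"
  by (induction rule: derivable.induct) (auto intro: box_theorems.mp)

lemma dia_theorems_closed: "derivable dia_theorems {} \<phi> \<Longrightarrow> \<phi> \<in> dia_theorems"
  by (induction rule: derivable.induct) (auto intro: dia_theorems.mp)

lemma gd_dia_theorems: "gd_axioms \<subseteq> dia_theorems"
  by (auto intro: dia_theorems.ax)

interpretation box_theorems: box_logic box_theorems
  by unfold_locales (auto intro: box_theorems.intros box_theorems_closed)

text \<open>Monotonicity of \<diamond> is the case \<chi> = \<bottom> of the rule of the fragment,
  since the side disjunct \<diamond>\<bottom> has value 0.\<close>

interpretation dia_theorems: dia_logic dia_theorems
proof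
  fix \<phi> \<psi> assume "\<phi> \<^bold>\<longrightarrow> \<psi> \<in> dia_theorems"
  then have "(\<phi> \<^bold>\<longrightarrow> \<psi>) \<^bold>\<or> \<^bold>\<bottom> \<in> dia_theorems"
    using dia_theorems.mp gd_dia_theorems gd_axioms.intros(6) by blast
  then have rule: "(\<diamond>\<phi> \<^bold>\<longrightarrow> \<diamond>\<psi>) \<^bold>\<or> \<diamond>\<^bold>\<bottom> \<in> dia_theorems" by (rule dia_theorems.dia_rule)
  have bot: "\<^bold>\<not>\<diamond>\<^bold>\<bottom> \<in> dia_theorems" by (auto intro: dia_theorems.ax dia_axioms.intros)
  show "\<diamond>\<phi> \<^bold>\<longrightarrow> \<diamond>\<psi> \<in> dia_theorems"
  proof (rule dia_theorems_closed, rule prop_complete[OF gd_dia_theorems])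
    fix w assume w: "lhom dia_theorems w"
    have "max (w (\<diamond>\<phi> \<^bold>\<longrightarrow> \<diamond>\<psi>)) (w (\<diamond>\<^bold>\<bottom>)) = 1"
      using w rule by (auto simp: lhom_def ghom_simps(3)[symmetric])
    moreover have "w (\<diamond>\<^bold>\<bottom>) \<le> 0" using lhom_Imp_le[OF w bot] lhom_bot_top[OF w] by simp
    ultimately show "w (\<diamond>\<phi> \<^bold>\<longrightarrow> \<diamond>\<psi>) = 1" by (simp add: max_def split: if_splits)
  qed
qed (auto intro: dia_theorems.intros dia_theorems_closed)

interpretation box_theorems: witness_logic box_theorems True False
proof
  fix v \<phi> assume v: "lhom box_theorems v" and \<phi>: "v (\<box>\<phi>) < 1"
  note range = lhom_bot_top(3,4)[OF v]
  let ?N = "{b. v (\<box>\<^bold>\<not>b) = 1}"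
  obtain w where w: "lhom box_theorems w" "\<And>\<psi>. v (\<box>\<psi>) = 1 \<Longrightarrow> w \<psi> = 1" "\<And>b. b \<in> ?N \<Longrightarrow> w b < 1"
    "\<And>\<beta>. v (\<box>\<phi>) \<le> v (\<box>\<beta>) \<Longrightarrow> w \<phi> \<le> w \<beta>" "\<And>\<gamma>. v (\<box>\<phi>) < v (\<box>\<gamma>) \<Longrightarrow> w \<phi> < w \<gamma>"
  proof (rule box_theorems.box_witness[OF v \<phi>, of ?N])
    show "\<^bold>\<bottom> \<in> ?N" using box_theorems.box_top[OF v] by simp
    show "b \<^bold>\<or> c \<in> ?N" if "b \<in> ?N" "c \<in> ?N" for b c
    proof -
      have "v (\<box>(\<^bold>\<not>b \<^bold>\<and> \<^bold>\<not>c)) \<le> v (\<box>\<^bold>\<not>(b \<^bold>\<or> c))"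
        by (rule box_theorems.box_mono[OF v]) (auto simp: lhom_def ghom_simps gimp_def)
      then show ?thesis
        using that range(2)[of "\<box>\<^bold>\<not>(b \<^bold>\<or> c)"] by (simp add: box_theorems.box_conj[OF v])
    qed
    show "v (\<box>\<psi>) = 1" if "b \<in> ?N" "v (\<box>(\<psi> \<^bold>\<or> b)) = 1" for \<psi> b
    proof -
      have "v (\<box>((\<psi> \<^bold>\<or> b) \<^bold>\<and> \<^bold>\<not>b)) \<le> v (\<box>\<psi>)"
      proof (rule box_theorems.box_mono[OF v])
        fix w assume w: "lhom box_theorems w"
        show "w ((\<psi> \<^bold>\<or> b) \<^bold>\<and> \<^bold>\<not>b) \<le> w \<psi>"
          using lhom_bot_top(3)[OF w, of b] lhom_bot_top(3)[OF w, of \<psi>]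
          by (auto simp: ghom_simps(1-4)[OF lhom_ghom[OF w]] gimp_def max_def)
      qed
      then show ?thesis
        using that range(2)[of "\<box>\<psi>"] by (simp add: box_theorems.box_conj[OF v])
    qed
  qed auto
  \<comment> \<open>With \<diamond> absent, positivity passes to the successor through
    \<not>\<not>\<box>\<beta> \<rightarrow> \<box>\<not>\<not>\<beta>: a positive \<box>\<beta>
    gives \<box>\<not>\<not>\<beta> = 1, so \<not>\<beta> belongs to \<open>?N\<close>.\<close>
  have pos: "0 < w \<beta>" if "0 < v (\<box>\<beta>)" for \<beta>
  proof -
    have "v (\<^bold>\<not>\<^bold>\<not>\<box>\<beta>) \<le> v (\<box>\<^bold>\<not>\<^bold>\<not>\<beta>)"
      by (rule lhom_Imp_le[OF v]) (auto intro: box_theorems.ax box_axioms.intros)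
    then have "v (\<box>\<^bold>\<not>\<^bold>\<not>\<beta>) = 1"
      using that range(2)[of "\<box>\<^bold>\<not>\<^bold>\<not>\<beta>"] by (simp add: ghom_simps[OF lhom_ghom[OF v]] gimp_def)
    then have "w (\<^bold>\<not>\<beta>) < 1" using w(3) by simp
    then show ?thesis
      using lhom_bot_top(3)[OF w(1), of \<beta>] by (auto simp: ghom_simps(1,4)[OF lhom_ghom[OF w(1)]] gimp_def split: if_splits)
  qed
  have "separates w (lower_bounds True v \<phi> (v (\<box>\<phi>))) (upper_bounds False v \<phi> (v (\<box>\<phi>)))"
  proof (rule separates_boundsI[OF w(1) range _ _ _ _ v])
    note wr = lhom_bot_top[OF w(1)]
    show "w \<phi> = 0" if "v (\<box>\<phi>) = 0"
      using w(4)[of "\<^bold>\<bottom>"] that range(1)[of "\<box>\<^bold>\<bottom>"] wr(1) wr(3)[of \<phi>] by simp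
    show "w \<phi> < 1" using w(5)[of "\<^bold>\<top>"] \<phi> box_theorems.box_top[OF v] wr(2) by simp
    show "w \<phi> = 1" if "v (\<box>\<phi>) = 1" using \<phi> that by simp
  qed (use w pos in auto)
  then show "\<exists>w. lhom box_theorems w \<and>
      separates w (lower_bounds True v \<phi> (v (\<box>\<phi>))) (upper_bounds False v \<phi> (v (\<box>\<phi>)))"
    using w(1) by blast
qed simp

text \<open>A premise \<not>\<delta> may be traded for a disjunct \<not>\<not>\<delta> in the
  conclusion of the implication: where \<delta> is 0 the premise holds, and elsewhere
  \<not>\<not>\<delta> is 1.\<close>

lemma neg_neg_value:
  assumes "gimp (gimp d 0) (max (gimp f p) z) = 1" "0 \<le> d" "f \<le> 1" "p \<le> 1" "z \<le> 1"
  shows "max (gimp f (max p (gimp (gimp d 0) 0))) z = 1"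
proof (cases "d = 0")
  case True
  then have "gimp f p = 1 \<or> z = 1"
    using assms by (auto simp: gimp_def max_def split: if_splits)
  then show ?thesis using True assms(3-) by (auto simp: gimp_def max_def split: if_splits)
next
  case False
  then show ?thesis using assms(2-) by (simp add: gimp_def)
qed

text \<open>The premises \<not>\<delta> with \<diamond>\<delta> = 0 make such \<delta> vanish at the
  successor. One of them suffices, since \<diamond> distributes over \<or>, and it moves under the
  diamond as the disjunct \<not>\<not>\<delta>. The side disjunct in the rule of the fragment takes
  care of \<zeta>, and \<diamond>\<not>\<not>\<delta> \<le> \<not>\<not>\<diamond>\<delta> = 0 makes
  the new disjunct disappear.\<close>

lemma dia_theorems_dia_le:
  assumes v: "lhom dia_theorems v"
    and der: "derivable dia_theorems {\<^bold>\<not>\<delta> |\<delta>. v (\<diamond>\<delta>) = 0} ((\<phi> \<^bold>\<longrightarrow> \<psi>) \<^bold>\<or> \<zeta>)" and \<zeta>: "v (\<diamond>\<zeta>) < 1"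
  shows "v (\<diamond>\<phi>) \<le> v (\<diamond>\<psi>)"
proof -
  let ?S = "{\<^bold>\<not>\<delta> |\<delta>. v (\<diamond>\<delta>) = 0}"
  note gd = gd_dia_theorems
  have "\<exists>p\<in>?S. derivable dia_theorems {} (p \<^bold>\<longrightarrow> ((\<phi> \<^bold>\<longrightarrow> \<psi>) \<^bold>\<or> \<zeta>))"
  proof (rule derivable_directed[OF gd])
    show "derivable dia_theorems ({} \<union> ?S) ((\<phi> \<^bold>\<longrightarrow> \<psi>) \<^bold>\<or> \<zeta>)" using der by simp
    show "?S \<noteq> {}" using dia_theorems.dia_bot[OF v] by blast
    fix p q assume "p \<in> ?S" "q \<in> ?S"
    then obtain \<delta>1 \<delta>2 where \<delta>: "p = \<^bold>\<not>\<delta>1" "q = \<^bold>\<not>\<delta>2" "v (\<diamond>\<delta>1) = 0" "v (\<diamond>\<delta>2) = 0" by auto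
    then have "\<^bold>\<not>(\<delta>1 \<^bold>\<or> \<delta>2) \<in> ?S" using dia_theorems.dia_disj[OF v] by auto
    moreover have "derivable dia_theorems {} (\<^bold>\<not>(\<delta>1 \<^bold>\<or> \<delta>2) \<^bold>\<longrightarrow> p)"
      "derivable dia_theorems {} (\<^bold>\<not>(\<delta>1 \<^bold>\<or> \<delta>2) \<^bold>\<longrightarrow> q)"
      unfolding \<delta> by (rule prop_complete[OF gd]; force simp: lhom_def ghom_simps gimp_def)+
    ultimately show "\<exists>r\<in>?S. derivable dia_theorems {} (r \<^bold>\<longrightarrow> p) \<and> derivable dia_theorems {} (r \<^bold>\<longrightarrow> q)"
      by blast
  qed
  then obtain \<delta> where \<delta>: "v (\<diamond>\<delta>) = 0" and
    der': "derivable dia_theorems {} (\<^bold>\<not>\<delta> \<^bold>\<longrightarrow> ((\<phi> \<^bold>\<longrightarrow> \<psi>) \<^bold>\<or> \<zeta>))" by blast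
  have "derivable dia_theorems {} ((\<phi> \<^bold>\<longrightarrow> (\<psi> \<^bold>\<or> \<^bold>\<not>\<^bold>\<not>\<delta>)) \<^bold>\<or> \<zeta>)"
  proof (rule prop_complete[OF gd])
    fix w assume w: "lhom dia_theorems w"
    have "w (\<^bold>\<not>\<delta> \<^bold>\<longrightarrow> ((\<phi> \<^bold>\<longrightarrow> \<psi>) \<^bold>\<or> \<zeta>)) = 1" using derivable_sound[OF w der'] by simp
    then show "w ((\<phi> \<^bold>\<longrightarrow> (\<psi> \<^bold>\<or> \<^bold>\<not>\<^bold>\<not>\<delta>)) \<^bold>\<or> \<zeta>) = 1"
      using lhom_bot_top(3,4)[OF w]
      by (simp only: ghom_simps(1-4)[OF lhom_ghom[OF w]] neg_neg_value)
  qed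
  then have "(\<diamond>\<phi> \<^bold>\<longrightarrow> \<diamond>(\<psi> \<^bold>\<or> \<^bold>\<not>\<^bold>\<not>\<delta>)) \<^bold>\<or> \<diamond>\<zeta> \<in> dia_theorems"
    using dia_theorems_closed dia_theorems.dia_rule by blast
  then have "v ((\<diamond>\<phi> \<^bold>\<longrightarrow> \<diamond>(\<psi> \<^bold>\<or> \<^bold>\<not>\<^bold>\<not>\<delta>)) \<^bold>\<or> \<diamond>\<zeta>) = 1" using v by (auto simp: lhom_def)
  then have "v (\<diamond>\<phi> \<^bold>\<longrightarrow> \<diamond>(\<psi> \<^bold>\<or> \<^bold>\<not>\<^bold>\<not>\<delta>)) = 1"
    using \<zeta> unfolding ghom_simps(3)[OF lhom_ghom[OF v]] by (auto simp: max_def split: if_splits)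
  then have "v (\<diamond>\<phi>) \<le> v (\<diamond>(\<psi> \<^bold>\<or> \<^bold>\<not>\<^bold>\<not>\<delta>))" by (simp add: ghom_Imp_eq_1[OF lhom_ghom[OF v]])
  moreover have "v (\<diamond>\<^bold>\<not>\<^bold>\<not>\<delta>) \<le> v (\<^bold>\<not>\<^bold>\<not>\<diamond>\<delta>)"
    by (rule lhom_Imp_le[OF v]) (auto intro: dia_theorems.ax dia_axioms.intros)
  ultimately show ?thesis
    using \<delta> lhom_bot_top(3)[OF v, of "\<diamond>\<psi>"]
    by (simp add: dia_theorems.dia_disj[OF v] ghom_simps(1,4)[OF lhom_ghom[OF v]] gimp_def)
qed

interpretation dia_theorems: witness_logic dia_theorems False True
proof
  fix v \<phi> assume v: "lhom dia_theorems v" and \<phi>: "0 < v (\<diamond>\<phi>)"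
  note range = lhom_bot_top(3,4)[OF v]
  obtain w where w: "lhom dia_theorems w" "\<And>\<psi>. \<psi> \<in> {\<^bold>\<not>\<delta> |\<delta>. v (\<diamond>\<delta>) = 0} \<Longrightarrow> w \<psi> = 1"
    "\<And>\<zeta>. v (\<diamond>\<zeta>) < 1 \<Longrightarrow> w \<zeta> < 1"
    "\<And>\<delta>. v (\<diamond>\<delta>) \<le> v (\<diamond>\<phi>) \<Longrightarrow> w \<delta> \<le> w \<phi>" "\<And>\<eta>. v (\<diamond>\<eta>) < v (\<diamond>\<phi>) \<Longrightarrow> w \<eta> < w \<phi>"
    "v (\<diamond>\<phi>) = 1 \<Longrightarrow> w \<phi> = 1"
    by (rule dia_theorems.dia_witness[OF v dia_theorems_dia_le[OF v] \<phi>]) (assumption+, rule that)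
  have "separates w (lower_bounds False v \<phi> (v (\<diamond>\<phi>))) (upper_bounds True v \<phi> (v (\<diamond>\<phi>)))"
  proof (rule separates_boundsI[OF w(1) range _ _ _ _ v])
    note wr = lhom_bot_top[OF w(1)]
    show "w \<phi> = 0" if "v (\<diamond>\<phi>) = 0" using \<phi> that by simp
    show "0 < w \<phi>" using w(5)[of "\<^bold>\<bottom>"] \<phi> dia_theorems.dia_bot[OF v] wr(1) by simp
    show "w \<delta> = 0" if "v (\<diamond>\<delta>) = 0" for \<delta>
      using w(2)[of "\<^bold>\<not>\<delta>"] that wr(1) wr(3)[of \<delta>] ghom_Imp_eq_1[OF lhom_ghom[OF w(1)], of \<delta> "\<^bold>\<bottom>"] by auto
  qed (use w \<phi> in auto)
  then show "\<exists>w. lhom dia_theorems w \<and>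
      separates w (lower_bounds False v \<phi> (v (\<diamond>\<phi>))) (upper_bounds True v \<phi> (v (\<diamond>\<phi>)))"
    using w(1) by blast
qed simp

section \<open>Soundness\<close>

lemma sem_range:
  assumes M: "is_gk_model M" and v: "v \<in> worlds M"
  shows "0 \<le> sem M \<phi> v \<and> sem M \<phi> v \<le> 1"
  using v
proof (induction \<phi> arbitrary: v)
  case (Box \<phi>)
  let ?f = "\<lambda>w. gimp (acc M v w) (sem M \<phi> w)"
  have r: "0 \<le> ?f w" "?f w \<le> 1" if "w \<in> worlds M" for w
    using Box.IH[OF that] by (auto simp: gimp_def)
  have "(INF w\<in>worlds M. ?f w) \<le> ?f v"
    using r Box.prems by (intro cINF_lower bdd_belowI[of _ 0]) auto
  moreover have "0 \<le> (INF w\<in>worlds M. ?f w)"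
    using r Box.prems by (intro cINF_greatest) auto
  ultimately show ?case using r(2)[OF Box.prems] by simp
next
  case (Dia \<phi>)
  let ?f = "\<lambda>w. min (acc M v w) (sem M \<phi> w)"
  have r: "0 \<le> ?f w" "?f w \<le> 1" if "w \<in> worlds M" for w
    using Dia.IH[OF that] M that Dia.prems by (auto simp: is_gk_model_def)
  have "?f v \<le> (SUP w\<in>worlds M. ?f w)"
    using r Dia.prems by (intro cSUP_upper bdd_aboveI[of _ 1]) auto
  moreover have "(SUP w\<in>worlds M. ?f w) \<le> 1"
    using r Dia.prems by (intro cSUP_least) auto
  ultimately show ?case using r(1)[OF Dia.prems] by (simp del: min.bounded_iff)
qed (use M in \<open>auto simp: is_gk_model_def gimp_def min_def max_def\<close>)

lemma sem_ghom:
  "is_gk_model M \<Longrightarrow> v \<in> worlds M \<Longrightarrow> ghom (\<lambda>\<phi>. sem M \<phi> v)"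
  using sem_range[of M v] by (simp add: ghom_def)

lemma sem_Box_le:
  assumes M: "is_gk_model M" and v: "v \<in> worlds M" and w: "w \<in> worlds M" "acc M v w = 1"
  shows "sem M (\<box>\<phi>) v \<le> sem M \<phi> w"
proof -
  have "sem M (\<box>\<phi>) v \<le> gimp (acc M v w) (sem M \<phi> w)"
    unfolding sem.simps using sem_range[OF M] w(1)
    by (intro cINF_lower bdd_belowI[of _ 0]) (auto simp: gimp_def)
  then show ?thesis using w sem_range[OF M w(1), of \<phi>] by (auto simp: gimp_def split: if_splits)
qed

lemma sem_Dia_ge:
  assumes M: "is_gk_model M" and v: "v \<in> worlds M" and w: "w \<in> worlds M" "acc M v w = 1"
  shows "sem M \<phi> w \<le> sem M (\<diamond>\<phi>) v"
proof -
  have "min (acc M v w) (sem M \<phi> w) \<le> sem M (\<diamond>\<phi>) v"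
    unfolding sem.simps using sem_range[OF M] w(1) M
    by (intro cSUP_upper bdd_aboveI[of _ 1]) (auto simp: min_le_iff_disj)
  then show ?thesis using w sem_range[OF M w(1), of \<phi>] by simp
qed

text \<open>An inaccessible witness can only produce the value 1 of a box or 0 of a diamond; any
  other value is attained at an accessible world. All soundness arguments for the modalities rest on
  this.\<close>

lemma crisp_witness:
  assumes M: "M \<in> crisp_witnessed_models" and v: "v \<in> worlds M"
  shows "sem M (\<box>\<phi>) v = 1 \<or> (\<exists>w\<in>worlds M. acc M v w = 1 \<and> sem M \<phi> w = sem M (\<box>\<phi>) v)"
    and "sem M (\<diamond>\<phi>) v = 0 \<or> (\<exists>w\<in>worlds M. acc M v w = 1 \<and> sem M \<phi> w = sem M (\<diamond>\<phi>) v)"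
proof -
  have M': "is_gk_model M" "crisp M" "witnessed M"
    using M by (auto simp: crisp_witnessed_models_def)
  obtain w u where w: "w \<in> worlds M" "sem M (\<box>\<phi>) v = gimp (acc M v w) (sem M \<phi> w)"
    and u: "u \<in> worlds M" "sem M (\<diamond>\<phi>) v = min (acc M v u) (sem M \<phi> u)"
    using M'(3) v unfolding witnessed_def by meson
  have cr: "acc M v x = 0 \<or> acc M v x = 1" if "x \<in> worlds M" for x
    using M'(2) v that by (auto simp: crisp_def)
  show "sem M (\<box>\<phi>) v = 1 \<or> (\<exists>w\<in>worlds M. acc M v w = 1 \<and> sem M \<phi> w = sem M (\<box>\<phi>) v)"
    using cr[OF w(1)] w sem_range[OF M'(1) w(1), of \<phi>]
    by (force simp: gimp_def split: if_splits)
  show "sem M (\<diamond>\<phi>) v = 0 \<or> (\<exists>w\<in>worlds M. acc M v w = 1 \<and> sem M \<phi> w = sem M (\<diamond>\<phi>) v)"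
    using cr[OF u(1)] u sem_range[OF M'(1) u(1), of \<phi>] by force
qed

definition valid :: "'w gk_model set \<Rightarrow> fm \<Rightarrow> bool" where
  "valid C \<phi> \<longleftrightarrow> (\<forall>M\<in>C. \<forall>v\<in>worlds M. sem M \<phi> v = 1)"

lemma valid_mp:
  assumes "valid (crisp_witnessed_models :: 'w gk_model set) (\<phi> \<^bold>\<longrightarrow> \<psi>)"
    and "valid (crisp_witnessed_models :: 'w gk_model set) \<phi>"
  shows "valid (crisp_witnessed_models :: 'w gk_model set) \<psi>"
  unfolding valid_def
proof (intro ballI)
  fix M :: "'w gk_model" and v assume M: "M \<in> crisp_witnessed_models" "v \<in> worlds M"
  then have "gimp (sem M \<phi> v) (sem M \<psi> v) = 1" "sem M \<phi> v = 1"
    using assms by (auto simp: valid_def)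
  moreover have "sem M \<psi> v \<le> 1"
    using M sem_range[of M v \<psi>] by (auto simp: crisp_witnessed_models_def)
  ultimately show "sem M \<psi> v = 1" by (auto simp: gimp_def split: if_splits)
qed

lemma gd_valid:
  assumes "\<phi> \<in> gd_axioms" and w: "ghom w"
  shows "w \<phi> = 1"
  using assms(1)
proof (cases rule: gd_axioms.cases)
  case (10 \<psi> \<chi>)
  then show ?thesis
    using ghom_simps(6)[OF w, of \<psi>] ghom_simps(6)[OF w, of \<chi>]
    by (cases "w \<psi> \<le> w \<chi>") (auto simp: ghom_simps(3,4)[OF w] gimp_def)
qed (simp_all add: ghom_Imp_eq_1[OF w] ghom_simps(1-4)[OF w] ghom_simps(5,6)[OF w] gimp_def)

lemma crisp_witnessed_is_gk: "M \<in> crisp_witnessed_models \<Longrightarrow> is_gk_model M"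
  by (simp add: crisp_witnessed_models_def)

context
  fixes M :: "'w gk_model" and v :: 'w
  assumes M: "M \<in> crisp_witnessed_models" and v: "v \<in> worlds M"
begin

lemma le_sem_Box:
  assumes "a \<le> 1" "\<And>w. w \<in> worlds M \<Longrightarrow> acc M v w = 1 \<Longrightarrow> a \<le> sem M \<phi> w"
  shows "a \<le> sem M (\<box>\<phi>) v"
  using crisp_witness(1)[OF M v, of \<phi>] assms by metis

lemma sem_Dia_le:
  assumes "0 \<le> a" "\<And>w. w \<in> worlds M \<Longrightarrow> acc M v w = 1 \<Longrightarrow> sem M \<phi> w \<le> a"
  shows "sem M (\<diamond>\<phi>) v \<le> a"
  using crisp_witness(2)[OF M v, of \<phi>] assms by metis

lemma sem_Imp_1I: "sem M \<phi> v \<le> sem M \<psi> v \<Longrightarrow> sem M (\<phi> \<^bold>\<longrightarrow> \<psi>) v = 1"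
  by (simp add: gimp_def)

lemmas model_gk = crisp_witnessed_is_gk[OF M]
lemmas model_Box_le = sem_Box_le[OF model_gk v] and model_Dia_ge = sem_Dia_ge[OF model_gk v]
  and model_sem_range = sem_range[OF model_gk]

lemma box_axioms_valid: "\<phi> \<in> box_axioms \<Longrightarrow> sem M \<phi> v = 1"
proof (induction rule: box_axioms.induct)
  case (1 \<phi> \<psi>)
  have "min (sem M (\<box>(\<phi> \<^bold>\<longrightarrow> \<psi>)) v) (sem M (\<box>\<phi>) v) \<le> sem M (\<box>\<psi>) v"
  proof (rule le_sem_Box)
    fix w assume w: "w \<in> worlds M" "acc M v w = 1"
    show "min (sem M (\<box>(\<phi> \<^bold>\<longrightarrow> \<psi>)) v) (sem M (\<box>\<phi>) v) \<le> sem M \<psi> w"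
      using model_Box_le[OF w, of \<phi>] model_Box_le[OF w, of "\<phi> \<^bold>\<longrightarrow> \<psi>"]
      by (auto simp del: sem.simps(6) simp: gimp_def min_le_iff_disj split: if_splits)
  qed (use model_sem_range[OF v, of "\<box>\<phi>"] in \<open>simp del: sem.simps(6) add: min_le_iff_disj\<close>)
  then show ?case
    by (intro sem_Imp_1I) (use model_sem_range[OF v, of "\<box>(\<phi> \<^bold>\<longrightarrow> \<psi>)"] in \<open>auto simp del: sem.simps(6) simp: gimp_def\<close>)
next
  case (2 \<phi>)
  show ?case
  proof (intro sem_Imp_1I le_sem_Box)
    fix w assume w: "w \<in> worlds M" "acc M v w = 1"
    show "sem M (\<^bold>\<not>\<^bold>\<not>\<box>\<phi>) v \<le> sem M (\<^bold>\<not>\<^bold>\<not>\<phi>) w"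
      using model_Box_le[OF w, of \<phi>] by (auto simp del: sem.simps(6) simp: gimp_def)
  qed (use model_sem_range[OF v] in blast)
qed

lemma dia_axioms_valid: "\<phi> \<in> dia_axioms \<Longrightarrow> sem M \<phi> v = 1"
proof (induction rule: dia_axioms.induct)
  case (1 \<phi> \<psi>)
  show ?case
  proof (intro sem_Imp_1I sem_Dia_le)
    fix w assume w: "w \<in> worlds M" "acc M v w = 1"
    show "sem M (\<phi> \<^bold>\<or> \<psi>) w \<le> sem M (\<diamond>\<phi> \<^bold>\<or> \<diamond>\<psi>) v"
      using model_Dia_ge[OF w, of \<phi>] model_Dia_ge[OF w, of \<psi>] by (auto simp del: sem.simps(7))
  qed (use model_sem_range[OF v] in blast)
next
  case (2 \<phi>)
  show ?case
  proof (intro sem_Imp_1I sem_Dia_le)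
    fix w assume w: "w \<in> worlds M" "acc M v w = 1"
    show "sem M (\<^bold>\<not>\<^bold>\<not>\<phi>) w \<le> sem M (\<^bold>\<not>\<^bold>\<not>\<diamond>\<phi>) v"
      using model_Dia_ge[OF w, of \<phi>] model_sem_range[OF w(1), of \<phi>] by (auto simp del: sem.simps(7) simp: gimp_def)
  qed (use model_sem_range[OF v] in blast)
next
  case 3
  show ?case
    by (intro sem_Imp_1I sem_Dia_le) auto
qed

lemma mixed_axioms_valid: "\<phi> \<in> mixed_axioms \<Longrightarrow> sem M \<phi> v = 1"
proof (induction rule: mixed_axioms.induct)
  case (1 \<phi> \<psi>)
  show ?case
  proof (intro sem_Imp_1I sem_Dia_le)
    fix w assume w: "w \<in> worlds M" "acc M v w = 1"
    show "sem M (\<phi> \<^bold>\<longrightarrow> \<psi>) w \<le> sem M (\<box>\<phi> \<^bold>\<longrightarrow> \<diamond>\<psi>) v"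
      using model_Box_le[OF w, of \<phi>] model_Dia_ge[OF w, of \<psi>] model_sem_range[OF w(1), of "\<phi> \<^bold>\<longrightarrow> \<psi>"]
      by (auto simp del: sem.simps(6,7) simp: gimp_def split: if_splits)
  qed (use model_sem_range[OF v] in blast)
next
  case (2 \<phi> \<psi>)
  show ?case
  proof (intro sem_Imp_1I le_sem_Box)
    fix w assume w: "w \<in> worlds M" "acc M v w = 1"
    show "sem M (\<diamond>\<phi> \<^bold>\<longrightarrow> \<box>\<psi>) v \<le> sem M (\<phi> \<^bold>\<longrightarrow> \<psi>) w"
      using model_Dia_ge[OF w, of \<phi>] model_Box_le[OF w, of \<psi>] model_sem_range[OF v, of "\<diamond>\<phi> \<^bold>\<longrightarrow> \<box>\<psi>"]
      by (auto simp del: sem.simps(6,7) simp: gimp_def split: if_splits)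
  qed (use model_sem_range[OF v] in blast)
next
  case (3 \<phi> \<psi>)
  have "sem M (\<box>(\<phi> \<^bold>\<or> \<psi>)) v \<le> max (sem M (\<box>\<phi>) v) (sem M (\<diamond>\<psi>) v)"
    using crisp_witness(1)[OF M v, of \<phi>]
  proof
    assume "sem M (\<box>\<phi>) v = 1"
    then show ?thesis
      using model_sem_range[OF v, of "\<box>(\<phi> \<^bold>\<or> \<psi>)"] by (simp del: sem.simps(6,7) add: le_max_iff_disj)
  next
    assume "\<exists>w\<in>worlds M. acc M v w = 1 \<and> sem M \<phi> w = sem M (\<box>\<phi>) v"
    then obtain w where w: "w \<in> worlds M" "acc M v w = 1" "sem M \<phi> w = sem M (\<box>\<phi>) v" by blast
    then show ?thesis
      using model_Box_le[OF w(1,2), of "\<phi> \<^bold>\<or> \<psi>"] model_Dia_ge[OF w(1,2), of \<psi>]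
      by (auto simp del: sem.simps(6,7))
  qed
  then show ?case by (intro sem_Imp_1I) (simp del: sem.simps(6,7))
qed

text \<open>If \<box>x \<le> \<box>y, look at an accessible world attaining \<box>x: there x \<le>
  y, so the formula under the outer box has the value of x, which is \<box>x and at most
  \<box>y.\<close>

lemma W_box_valid: "\<phi> \<in> W_box \<Longrightarrow> sem M \<phi> v = 1"
proof (induction rule: W_box.induct)
  case (1 x y)
  let ?p = "((x \<^bold>\<longrightarrow> y) \<^bold>\<longrightarrow> y) \<^bold>\<and> (y \<^bold>\<longrightarrow> x)"
  have "sem M (\<box>?p) v \<le> sem M (\<box>y) v" if le: "sem M (\<box>x) v \<le> sem M (\<box>y) v"
    using crisp_witness(1)[OF M v, of x]
  proof
    assume "sem M (\<box>x) v = 1"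
    then show ?thesis
      using le model_sem_range[OF v, of "\<box>?p"] by (simp del: sem.simps(6))
  next
    assume "\<exists>w\<in>worlds M. acc M v w = 1 \<and> sem M x w = sem M (\<box>x) v"
    then obtain w where w: "w \<in> worlds M" "acc M v w = 1" "sem M x w = sem M (\<box>x) v" by blast
    then show ?thesis
      using model_Box_le[OF w(1,2), of ?p] model_Box_le[OF w(1,2), of y] le model_sem_range[OF w(1), of x] model_sem_range[OF w(1), of y]
      by (auto simp del: sem.simps(6) simp: gimp_def split: if_splits)
  qed
  then show ?case
    using model_sem_range[OF v, of "\<box>?p"] model_sem_range[OF v, of "\<box>y"]
    by (intro sem_Imp_1I) (auto simp del: sem.simps(6) simp: gimp_def)
qed

text \<open>At an accessible world attaining \<diamond>y, z lies strictly below y because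
  \<diamond>z < \<diamond>y. If moreover \<diamond>x \<le> \<diamond>y, then x \<le> y there and the
  formula under the last diamond is 1; otherwise it is still at least \<diamond>y.\<close>

lemma W_dia_valid: "\<phi> \<in> W_dia \<Longrightarrow> sem M \<phi> v = 1"
proof (induction rule: W_dia.induct)
  case (1 x y z)
  let ?q = "(x \<^bold>\<longrightarrow> y) \<^bold>\<and> ((y \<^bold>\<longrightarrow> z) \<^bold>\<longrightarrow> z)"
  have "gimp (sem M (\<diamond>x) v) (sem M (\<diamond>y) v) \<le> sem M (\<diamond>?q) v" if lt: "sem M (\<diamond>z) v < sem M (\<diamond>y) v"
    using crisp_witness(2)[OF M v, of y]
  proof
    assume "sem M (\<diamond>y) v = 0"
    then show ?thesis using lt model_sem_range[OF v, of "\<diamond>z"] by (simp del: sem.simps(7))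
  next
    assume "\<exists>w\<in>worlds M. acc M v w = 1 \<and> sem M y w = sem M (\<diamond>y) v"
    then obtain w where w: "w \<in> worlds M" "acc M v w = 1" "sem M y w = sem M (\<diamond>y) v" by blast
    then show ?thesis
      using model_Dia_ge[OF w(1,2), of ?q] model_Dia_ge[OF w(1,2), of x] model_Dia_ge[OF w(1,2), of z] lt
        model_sem_range[OF w(1), of y]
      by (auto simp del: sem.simps(7) simp: gimp_def split: if_splits)
  qed
  then show ?case
    using model_sem_range[OF v, of "\<diamond>z"]
    by (intro sem_Imp_1I) (auto simp del: sem.simps(7) simp: gimp_def le_max_iff_disj min_le_iff_disj)
qed

end

lemma nec_valid:
  fixes \<phi> :: fm
  assumes "valid (crisp_witnessed_models :: 'w gk_model set) \<phi>"
  shows "valid (crisp_witnessed_models :: 'w gk_model set) (\<box>\<phi>)"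
  unfolding valid_def
proof (intro ballI)
  fix M :: "'w gk_model" and v assume M: "M \<in> crisp_witnessed_models" and v: "v \<in> worlds M"
  then show "sem M (\<box>\<phi>) v = 1"
    using crisp_witness(1)[OF M v, of \<phi>] assms by (auto simp: valid_def simp del: sem.simps(6))
qed

text \<open>Either \<chi> is 1 at some accessible world, hence \<diamond>\<chi> = 1, or \<phi> \<le>
  \<psi> at all accessible worlds.\<close>

lemma dia_rule_valid:
  assumes "valid (crisp_witnessed_models :: 'w gk_model set) ((\<phi> \<^bold>\<longrightarrow> \<psi>) \<^bold>\<or> \<chi>)"
  shows "valid (crisp_witnessed_models :: 'w gk_model set) ((\<diamond>\<phi> \<^bold>\<longrightarrow> \<diamond>\<psi>) \<^bold>\<or> \<diamond>\<chi>)"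
  unfolding valid_def
proof (intro ballI)
  fix M :: "'w gk_model" and v assume M: "M \<in> crisp_witnessed_models" and v: "v \<in> worlds M"
  note gk = crisp_witnessed_is_gk[OF M]
  note range = sem_range[OF gk]
  have hyp: "sem M \<phi> w \<le> sem M \<psi> w \<or> sem M \<chi> w = 1" if "w \<in> worlds M" for w
    using assms M that range[OF that, of \<phi>] range[OF that, of \<psi>]
    by (fastforce simp: valid_def gimp_def max_def split: if_splits)
  have "sem M (\<diamond>\<phi>) v \<le> sem M (\<diamond>\<psi>) v \<or> sem M (\<diamond>\<chi>) v = 1"
  proof (cases "\<exists>w\<in>worlds M. acc M v w = 1 \<and> sem M \<chi> w = 1")
    case True
    then show ?thesis
      using sem_Dia_ge[OF gk v, of _ \<chi>] range[OF v, of "\<diamond>\<chi>"] by (fastforce simp del: sem.simps(7))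
  next
    case False
    have "sem M (\<diamond>\<phi>) v \<le> sem M (\<diamond>\<psi>) v"
    proof (rule sem_Dia_le[OF M v])
      show "sem M \<phi> w \<le> sem M (\<diamond>\<psi>) v" if "w \<in> worlds M" "acc M v w = 1" for w
        using hyp[OF that(1)] False that sem_Dia_ge[OF gk v that, of \<psi>] by force
    qed (use range[OF v] in blast)
    then show ?thesis ..
  qed
  then show "sem M ((\<diamond>\<phi> \<^bold>\<longrightarrow> \<diamond>\<psi>) \<^bold>\<or> \<diamond>\<chi>) v = 1"
    using range[OF v, of "\<diamond>\<chi>"] range[OF v, of "\<diamond>\<psi>"]
    by (auto simp del: sem.simps(7) simp: gimp_def max_def)
qed

lemma axioms_valid:
  assumes "\<phi> \<in> gd_axioms \<union> box_axioms \<union> dia_axioms \<union> mixed_axioms \<union> (W_box \<union> W_dia)"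
  shows "valid (crisp_witnessed_models :: 'w gk_model set) \<phi>"
  unfolding valid_def
proof (intro ballI)
  fix M :: "'w gk_model" and v assume M: "M \<in> crisp_witnessed_models" and v: "v \<in> worlds M"
  show "sem M \<phi> v = 1"
    using assms gd_valid[OF _ sem_ghom[OF crisp_witnessed_is_gk[OF M] v]] box_axioms_valid[OF M v]
      dia_axioms_valid[OF M v] mixed_axioms_valid[OF M v] W_box_valid[OF M v] W_dia_valid[OF M v]
    by blast
qed

lemma KG_sound: "\<phi> \<in> KGW \<Longrightarrow> valid (crisp_witnessed_models :: 'w gk_model set) \<phi>"
proof (induction rule: KG.induct)
  case (mono_dia \<phi> \<psi>)
  have "valid (crisp_witnessed_models :: 'w gk_model set) ((\<phi> \<^bold>\<longrightarrow> \<psi>) \<^bold>\<or> \<^bold>\<bottom>)"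
    using mono_dia.IH by (simp add: valid_def)
  from dia_rule_valid[OF this]
  have "valid (crisp_witnessed_models :: 'w gk_model set) ((\<diamond>\<phi> \<^bold>\<longrightarrow> \<diamond>\<psi>) \<^bold>\<or> \<diamond>\<^bold>\<bottom>)" .
  moreover have "valid (crisp_witnessed_models :: 'w gk_model set) (((\<diamond>\<phi> \<^bold>\<longrightarrow> \<diamond>\<psi>) \<^bold>\<or> \<diamond>\<^bold>\<bottom>) \<^bold>\<longrightarrow> (\<diamond>\<phi> \<^bold>\<longrightarrow> \<diamond>\<psi>))"
    unfolding valid_def
  proof (intro ballI)
    fix M :: "'w gk_model" and v assume M: "M \<in> crisp_witnessed_models" and v: "v \<in> worlds M"
    have "sem M (\<diamond>\<^bold>\<bottom>) v \<le> 0" by (rule sem_Dia_le[OF M v]) auto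
    then show "sem M (((\<diamond>\<phi> \<^bold>\<longrightarrow> \<diamond>\<psi>) \<^bold>\<or> \<diamond>\<^bold>\<bottom>) \<^bold>\<longrightarrow> (\<diamond>\<phi> \<^bold>\<longrightarrow> \<diamond>\<psi>)) v = 1"
      using sem_range[OF crisp_witnessed_is_gk[OF M] v, of "\<diamond>\<phi> \<^bold>\<longrightarrow> \<diamond>\<psi>"]
      by (intro sem_Imp_1I[OF M v]) (auto simp del: sem.simps(5,7))
  qed
  ultimately show ?case by (rule valid_mp[rotated])
next
  case (mp \<phi> \<psi>)
  show ?case by (rule valid_mp[OF mp.IH])
qed (auto intro: axioms_valid nec_valid)

lemma KG_box_sound: "\<phi> \<in> KG_box W_box \<Longrightarrow> valid (crisp_witnessed_models :: 'w gk_model set) \<phi>"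
proof (induction rule: KG_box.induct)
  case (mp \<phi> \<psi>)
  show ?case by (rule valid_mp[OF mp.IH])
qed (auto intro: axioms_valid nec_valid)

lemma KG_dia_sound: "\<phi> \<in> KG_dia W_dia \<Longrightarrow> valid (crisp_witnessed_models :: 'w gk_model set) \<phi>"
proof (induction rule: KG_dia.induct)
  case (mp \<phi> \<psi>)
  show ?case by (rule valid_mp[OF mp.IH])
qed (auto intro: axioms_valid dia_rule_valid)

lemma derivable_entails:
  assumes L: "\<And>\<phi>. \<phi> \<in> L \<Longrightarrow> valid (crisp_witnessed_models :: 'w gk_model set) \<phi>"
    and "derivable L \<Gamma> \<phi>"
  shows "entails (crisp_witnessed_models :: 'w gk_model set) \<Gamma> \<phi>"
  unfolding entails_def
proof (intro ballI impI)
  fix M :: "'w gk_model" and v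
  assume M: "M \<in> crisp_witnessed_models" and v: "v \<in> worlds M" and \<Gamma>: "\<forall>\<gamma>\<in>\<Gamma>. sem M \<gamma> v = 1"
  have "lhom L (\<lambda>\<phi>. sem M \<phi> v)"
    using sem_ghom[OF crisp_witnessed_is_gk[OF M] v] L M v by (auto simp: lhom_def valid_def)
  from derivable_sound[OF this assms(2)] show "sem M \<phi> v = 1" using \<Gamma> by blast
qed

section \<open>Countermodels and completeness\<close>

text \<open>Countermodels are built on \<open>nat\<close> and \<open>nat \<times> nat\<close>; an
  injection carries them to an arbitrary infinite type of worlds.\<close>

definition transport :: "('a \<Rightarrow> 'w) \<Rightarrow> 'a gk_model \<Rightarrow> 'w gk_model" where
  "transport g M = \<lparr>worlds = g ` worlds M, acc = (\<lambda>x y. acc M (inv g x) (inv g y)),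
     val = (\<lambda>x. val M (inv g x))\<rparr>"

lemma sem_transport:
  assumes "inj g"
  shows "sem (transport g M) \<phi> (g x) = sem M \<phi> x"
  by (induction \<phi> arbitrary: x) (simp_all add: transport_def image_image inv_f_f[OF assms])

lemma transport_crisp_witnessed:
  assumes g: "inj g" and M: "M \<in> crisp_witnessed_models"
  shows "transport g M \<in> crisp_witnessed_models"
proof -
  have simps: "worlds (transport g M) = g ` worlds M" "acc (transport g M) (g x) (g y) = acc M x y"
    "val (transport g M) (g x) = val M x" for x y
    by (simp_all add: transport_def inv_f_f[OF g])
  show ?thesis
    using M
    unfolding crisp_witnessed_models_def is_gk_model_def crisp_def witnessed_def
    by (simp add: simps sem_transport[OF g] del: sem.simps)
qed

text \<open>The box step of the truth lemmas for the infinite and the finite countermodels. The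
  second conclusion provides witnesses; if a = 1, any world is one.\<close>

lemma crisp_Box_value:
  fixes f :: "'a \<Rightarrow> real"
  assumes "W \<noteq> {}" "a \<le> 1" "\<And>w. w \<in> W \<Longrightarrow> 0 \<le> f w \<and> f w \<le> 1" "\<And>w. w \<in> W \<Longrightarrow> R w \<Longrightarrow> a \<le> f w"
    and "a < 1 \<Longrightarrow> \<exists>w\<in>W. R w \<and> f w = a"
  shows "(INF w\<in>W. gimp (if R w then 1 else 0) (f w)) = a"
    and "\<exists>w\<in>W. a = gimp (if R w then 1 else 0) (f w)"
proof -
  let ?h = "\<lambda>w. gimp (if R w then 1 else 0) (f w)"
  have ge: "a \<le> ?h w" if "w \<in> W" for w
    using assms(2,3,4) that by (auto simp: gimp_def)
  show ex: "\<exists>w\<in>W. a = ?h w"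
  proof (cases "a < 1")
    case True
    then obtain w where "w \<in> W" "R w" "f w = a" using assms(5) by blast
    then show ?thesis using True by (intro bexI[of _ w]) (auto simp: gimp_def)
  next
    case False
    obtain w where w: "w \<in> W" using assms(1) by blast
    then have "?h w \<le> 1" using assms(3)[OF w] by (auto simp: gimp_def)
    then show ?thesis using ge[OF w] w False assms(2) by force
  qed
  then obtain w where "w \<in> W" "a = ?h w" by blast
  then show "(INF w\<in>W. ?h w) = a"
    using ge by (intro cInf_eq_minimum) auto
qed

lemma crisp_Dia_value:
  fixes f :: "'a \<Rightarrow> real"
  assumes "W \<noteq> {}" "0 \<le> a" "\<And>w. w \<in> W \<Longrightarrow> 0 \<le> f w \<and> f w \<le> 1" "\<And>w. w \<in> W \<Longrightarrow> R w \<Longrightarrow> f w \<le> a"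
    and "0 < a \<Longrightarrow> \<exists>w\<in>W. R w \<and> f w = a"
  shows "(SUP w\<in>W. min (if R w then 1 else 0) (f w)) = a"
    and "\<exists>w\<in>W. a = min (if R w then 1 else 0) (f w)"
proof -
  let ?h = "\<lambda>w. min (if R w then 1 else 0) (f w)"
  have le: "?h w \<le> a" "0 \<le> ?h w" if "w \<in> W" for w
    using assms(2,3,4) that by (auto simp: min_le_iff_disj)
  show ex: "\<exists>w\<in>W. a = ?h w"
  proof (cases "0 < a")
    case True
    then obtain w where "w \<in> W" "R w" "f w = a" using assms(5) by blast
    then show ?thesis using assms(3)[of w] by (intro bexI[of _ w]) auto
  next
    case False
    obtain w where "w \<in> W" using assms(1) by blast
    then show ?thesis using le[of w] False by (intro bexI[of _ w]) auto
  qed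
  then obtain w where "w \<in> W" "a = ?h w" by blast
  then show "(SUP w\<in>W. ?h w) = a"
    using le by (intro cSup_eq_maximum) auto
qed

text \<open>The members of the family are the worlds, and accessibility means respecting all box and
  diamond bounds. Truth agrees with \<open>E\<close> for every formula, so the witnesses of the
  family are witnesses of the model.\<close>

lemma KGW_countermodel:
  assumes "\<not> derivable KGW \<Gamma> \<phi>"
  shows "\<exists>M :: nat gk_model. M \<in> crisp_witnessed_models \<and>
    (\<exists>v\<in>worlds M. (\<forall>\<gamma>\<in>\<Gamma>. sem M \<gamma> v = 1) \<and> sem M \<phi> v \<noteq> 1)"
proof -
  obtain v0 where v0: "lhom KGW v0" "\<And>\<gamma>. \<gamma> \<in> \<Gamma> \<Longrightarrow> v0 \<gamma> = 1" "v0 \<phi> \<noteq> 1"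
    using prop_complete[OF KGW_box.gd] assms by metis
  obtain E where E: "witness_family KGW True True E" and E0: "\<And>\<phi>. E 0 \<phi> = 1 \<longleftrightarrow> v0 \<phi> = 1"
    using KGW.witness_family_exists[OF v0(1)] by blast
  have lh: "lhom KGW (E n)" for n using E by (simp add: witness_family_def)
  define M where "M = \<lparr>worlds = (UNIV :: nat set),
    acc = (\<lambda>m n. if accessible True True (E m) (E n) then 1 else 0), val = (\<lambda>n k. E n (Var k))\<rparr>"
  have sel: "worlds M = UNIV" "acc M m n = (if accessible True True (E m) (E n) then 1 else 0)"
    "val M n k = E n (Var k)" for m n k by (simp_all add: M_def)
  note range = lhom_bot_top(3,4)[OF lh]
  have B: "(INF n\<in>UNIV. gimp (acc M m n) (E n \<psi>)) = E m (\<box>\<psi>)"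
    "\<exists>n. E m (\<box>\<psi>) = gimp (acc M m n) (E n \<psi>)" for m \<psi>
    using crisp_Box_value[of UNIV "E m (\<box>\<psi>)" "\<lambda>n. E n \<psi>" "\<lambda>n. accessible True True (E m) (E n)"]
      range E by (auto simp: witness_family_def sel accessible_def)
  have D: "(SUP n\<in>UNIV. min (acc M m n) (E n \<psi>)) = E m (\<diamond>\<psi>)"
    "\<exists>n. E m (\<diamond>\<psi>) = min (acc M m n) (E n \<psi>)" for m \<psi>
    using crisp_Dia_value[of UNIV "E m (\<diamond>\<psi>)" "\<lambda>n. E n \<psi>" "\<lambda>n. accessible True True (E m) (E n)"]
      range E by (auto simp: witness_family_def sel accessible_def)
  have truth: "sem M \<psi> n = E n \<psi>" for \<psi> n
  proof (induction \<psi> arbitrary: n)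
    case (Box \<psi>)
    then show ?case using B(1) by (simp add: sel(1))
  next
    case (Dia \<psi>)
    then show ?case using D(1) by (simp add: sel(1))
  qed (simp_all add: sel ghom_simps(1-4)[OF lhom_ghom[OF lh]])
  have "witnessed M"
    using B(2) D(2) by (simp add: witnessed_def truth sel(1) del: sem.simps)
  then have "M \<in> crisp_witnessed_models"
    using range by (simp add: crisp_witnessed_models_def is_gk_model_def crisp_def sel)
  then show ?thesis
    using v0 E0 by (intro exI[of _ M]) (auto simp: truth sel(1) intro!: exI[of _ 0])
qed

section \<open>Finite countermodels\<close>

primrec subformulas :: "fm \<Rightarrow> fm set" where
  "subformulas (Var n) = {Var n}"
| "subformulas \<^bold>\<bottom> = {\<^bold>\<bottom>}"
| "subformulas (\<phi> \<^bold>\<and> \<psi>) = insert (\<phi> \<^bold>\<and> \<psi>) (subformulas \<phi> \<union> subformulas \<psi>)"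
| "subformulas (\<phi> \<^bold>\<or> \<psi>) = insert (\<phi> \<^bold>\<or> \<psi>) (subformulas \<phi> \<union> subformulas \<psi>)"
| "subformulas (\<phi> \<^bold>\<longrightarrow> \<psi>) = insert (\<phi> \<^bold>\<longrightarrow> \<psi>) (subformulas \<phi> \<union> subformulas \<psi>)"
| "subformulas (\<box>\<phi>) = insert (\<box>\<phi>) (subformulas \<phi>)"
| "subformulas (\<diamond>\<phi>) = insert (\<diamond>\<phi>) (subformulas \<phi>)"

lemma finite_subformulas: "finite (subformulas \<phi>)"
  by (induction \<phi>) auto

lemma finite_crisp_witnessed:
  assumes "is_gk_model M" "crisp M" "finite (worlds M)"
  shows "M \<in> crisp_witnessed_models"
proof -
  have ne: "worlds M \<noteq> {}" using assms(1) by (simp add: is_gk_model_def)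
  have "Inf (f ` worlds M) \<in> f ` worlds M" "Sup (f ` worlds M) \<in> f ` worlds M" for f :: "_ \<Rightarrow> real"
    using ne assms(3) by (simp_all add: cInf_eq_Min cSup_eq_Max)
  then have "\<exists>w\<in>worlds M. (INF w\<in>worlds M. f w) = f w" "\<exists>w\<in>worlds M. (SUP w\<in>worlds M. f w) = f w"
    for f :: "_ \<Rightarrow> real"
    by blast+
  then show ?thesis
    using assms by (simp add: crisp_witnessed_models_def witnessed_def)
qed

text \<open>A fragment model is witnessed only for the modality of the fragment. Unravelling it along
  witnesses for the subformulas of a refuted formula gives a finite model, which is witnessed for
  both modalities.\<close>

lemma finite_countermodel:
  fixes E :: "nat \<Rightarrow> fm \<Rightarrow> real"
  assumes E: "witness_family L ub ud E" and root: "E 0 \<theta> \<noteq> 1"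
    and frag: "ub \<or> box_free \<theta>" "ud \<or> dia_free \<theta>"
  shows "\<exists>M :: (nat \<times> nat) gk_model. M \<in> crisp_witnessed_models \<and> (\<exists>v\<in>worlds M. sem M \<theta> v \<noteq> 1)"
proof -
  have lh: "lhom L (E n)" for n using E by (simp add: witness_family_def)
  have "\<exists>f. \<forall>m \<phi>. (ub \<longrightarrow> E m (\<box>\<phi>) < 1 \<longrightarrow>
      accessible ub ud (E m) (E (f m (\<box>\<phi>))) \<and> E (f m (\<box>\<phi>)) \<phi> = E m (\<box>\<phi>)) \<and>
    (ud \<longrightarrow> 0 < E m (\<diamond>\<phi>) \<longrightarrow>
      accessible ub ud (E m) (E (f m (\<diamond>\<phi>))) \<and> E (f m (\<diamond>\<phi>)) \<phi> = E m (\<diamond>\<phi>))"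
  proof -
    obtain fB where fB: "\<And>m \<phi>. ub \<Longrightarrow> E m (\<box>\<phi>) < 1 \<Longrightarrow>
        accessible ub ud (E m) (E (fB m \<phi>)) \<and> E (fB m \<phi>) \<phi> = E m (\<box>\<phi>)"
      using E unfolding witness_family_def by metis
    obtain fD where fD: "\<And>m \<phi>. ud \<Longrightarrow> 0 < E m (\<diamond>\<phi>) \<Longrightarrow>
        accessible ub ud (E m) (E (fD m \<phi>)) \<and> E (fD m \<phi>) \<phi> = E m (\<diamond>\<phi>)"
      using E unfolding witness_family_def by metis
    show ?thesis
      by (rule exI[of _ "\<lambda>m \<alpha>. case \<alpha> of \<box>\<phi> \<Rightarrow> fB m \<phi> | \<diamond>\<phi> \<Rightarrow> fD m \<phi> | _ \<Rightarrow> 0"])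
         (use fB fD in simp)
  qed
  then obtain f where
    fB: "\<And>m \<phi>. ub \<Longrightarrow> E m (\<box>\<phi>) < 1 \<Longrightarrow> accessible ub ud (E m) (E (f m (\<box>\<phi>))) \<and> E (f m (\<box>\<phi>)) \<phi> = E m (\<box>\<phi>)"
    and fD: "\<And>m \<phi>. ud \<Longrightarrow> 0 < E m (\<diamond>\<phi>) \<Longrightarrow> accessible ub ud (E m) (E (f m (\<diamond>\<phi>))) \<and> E (f m (\<diamond>\<phi>)) \<phi> = E m (\<diamond>\<phi>)"
    by metis
  \<comment> \<open>Witnesses for all subformulas are added at once. What \<open>f\<close> returns
    at other arguments than a demand does not matter: an added world is either inaccessible or
    respects the bounds.\<close>
  define step where "step A = (\<lambda>(m, \<alpha>). f m \<alpha>) ` (A \<times> subformulas \<theta>)" for A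
  define Lv where "Lv k = (step ^^ k) {0}" for k
  have Lv_Suc: "f i \<alpha> \<in> Lv (Suc k)" if "i \<in> Lv k" "\<alpha> \<in> subformulas \<theta>" for i k \<alpha>
    using that by (auto simp: Lv_def step_def)
  have fin: "finite (Lv k)" for k
    by (induction k) (auto simp: Lv_def step_def finite_subformulas)
  \<comment> \<open>Each modal operator descends one level and lowers the size of the formula, so
    \<open>size \<theta>\<close> levels are enough to evaluate \<theta> at the root.\<close>
  define N where "N = size \<theta>"
  define W where "W = (SIGMA k:{..N}. Lv k)"
  \<comment> \<open>The level counter makes the unravelling acyclic even if \<open>f\<close> returns
    to an earlier world. Arrows lead to every accessible world of the next level, not only to the
    chosen witness.\<close>
  define R where "R p q \<longleftrightarrow> fst q = Suc (fst p) \<and> accessible ub ud (E (snd p)) (E (snd q))" for p q :: "nat \<times> nat"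
  define M where "M = \<lparr>worlds = W, acc = (\<lambda>p q. if R p q then 1 else 0),
    val = (\<lambda>p k. E (snd p) (Var k))\<rparr>"
  have sel: "worlds M = W" "acc M p q = (if R p q then 1 else 0)" "val M p k = E (snd p) (Var k)" for p q k
    by (simp_all add: M_def)
  note range = lhom_bot_top(3,4)[OF lh]
  have root_W: "(0, 0) \<in> W" by (simp add: W_def Lv_def)
  then have W_ne: "W \<noteq> {}" by blast
  have gk: "is_gk_model M"
    using range W_ne by (simp add: is_gk_model_def sel)
  have "finite (worlds M)" by (simp add: sel W_def fin)
  then have M: "M \<in> crisp_witnessed_models"
    using gk by (intro finite_crisp_witnessed) (auto simp: crisp_def sel)
  have "sem M \<psi> p = E (snd p) \<psi>"
    if "p \<in> W" "fst p + size \<psi> \<le> N" "subformulas \<psi> \<subseteq> subformulas \<theta>"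
      "ub \<or> box_free \<psi>" "ud \<or> dia_free \<psi>" for \<psi> p
    using that
  proof (induction \<psi> arbitrary: p)
    case (Box \<psi>)
    have ub using Box.prems by simp
    have IH: "sem M \<psi> q = E (snd q) \<psi>" if "q \<in> W" "R p q" for q
      using Box.prems that by (intro Box.IH) (auto simp: R_def)
    have "(INF q\<in>W. gimp (if R p q then 1 else 0) (sem M \<psi> q)) = E (snd p) (\<box>\<psi>)"
    proof (rule crisp_Box_value(1)[OF W_ne range(2)])
      show "0 \<le> sem M \<psi> q \<and> sem M \<psi> q \<le> 1" if "q \<in> W" for q
        using sem_range[OF gk] that by (simp add: sel)
      show "E (snd p) (\<box>\<psi>) \<le> sem M \<psi> q" if "q \<in> W" "R p q" for q
        using IH[OF that] that \<open>ub\<close> by (auto simp: R_def accessible_def)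
      assume lt: "E (snd p) (\<box>\<psi>) < 1"
      let ?q = "(Suc (fst p), f (snd p) (\<box>\<psi>))"
      have "?q \<in> W"
        using Box.prems(1,2,3) Lv_Suc[of "snd p" "fst p" "\<box>\<psi>"] by (auto simp: W_def)
      moreover have "R p ?q" using fB[OF \<open>ub\<close> lt] by (simp add: R_def)
      ultimately show "\<exists>q\<in>W. R p q \<and> sem M \<psi> q = E (snd p) (\<box>\<psi>)"
        using IH[of ?q] fB[OF \<open>ub\<close> lt] by (intro bexI[of _ ?q]) auto
    qed
    then show ?case by (simp add: sel)
  next
    case (Dia \<psi>)
    have ud using Dia.prems by simp
    have IH: "sem M \<psi> q = E (snd q) \<psi>" if "q \<in> W" "R p q" for q
      using Dia.prems that by (intro Dia.IH) (auto simp: R_def)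
    have "(SUP q\<in>W. min (if R p q then 1 else 0) (sem M \<psi> q)) = E (snd p) (\<diamond>\<psi>)"
    proof (rule crisp_Dia_value(1)[OF W_ne range(1)])
      show "0 \<le> sem M \<psi> q \<and> sem M \<psi> q \<le> 1" if "q \<in> W" for q
        using sem_range[OF gk] that by (simp add: sel)
      show "sem M \<psi> q \<le> E (snd p) (\<diamond>\<psi>)" if "q \<in> W" "R p q" for q
        using IH[OF that] that \<open>ud\<close> by (auto simp: R_def accessible_def)
      assume gt: "0 < E (snd p) (\<diamond>\<psi>)"
      let ?q = "(Suc (fst p), f (snd p) (\<diamond>\<psi>))"
      have "?q \<in> W"
        using Dia.prems(1,2,3) Lv_Suc[of "snd p" "fst p" "\<diamond>\<psi>"] by (auto simp: W_def)
      moreover have "R p ?q" using fD[OF \<open>ud\<close> gt] by (simp add: R_def)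
      ultimately show "\<exists>q\<in>W. R p q \<and> sem M \<psi> q = E (snd p) (\<diamond>\<psi>)"
        using IH[of ?q] fD[OF \<open>ud\<close> gt] by (intro bexI[of _ ?q]) auto
    qed
    then show ?case by (simp add: sel)
  qed (auto simp: sel ghom_simps(1-4)[OF lhom_ghom[OF lh]])
  then have "sem M \<theta> (0, 0) = E 0 \<theta>"
    using root_W frag by (simp add: N_def)
  then show ?thesis using M root root_W by (intro exI[of _ M]) (auto simp: sel intro!: bexI[of _ "(0, 0)"])
qed

text \<open>Replacing diamonds by \<bottom> maps axioms to axioms, respects the rules and fixes
  formulas without diamonds. Hence diamonds occurring inside a proof in \<open>box_theorems\<close>
  can be eliminated, and the unrestricted system is conservative over the fragment;
  \<open>drop_box\<close> does the same for boxes.\<close>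

primrec drop_dia :: "fm \<Rightarrow> fm" where
  "drop_dia (Var n) = Var n"
| "drop_dia \<^bold>\<bottom> = \<^bold>\<bottom>"
| "drop_dia (\<phi> \<^bold>\<and> \<psi>) = drop_dia \<phi> \<^bold>\<and> drop_dia \<psi>"
| "drop_dia (\<phi> \<^bold>\<or> \<psi>) = drop_dia \<phi> \<^bold>\<or> drop_dia \<psi>"
| "drop_dia (\<phi> \<^bold>\<longrightarrow> \<psi>) = drop_dia \<phi> \<^bold>\<longrightarrow> drop_dia \<psi>"
| "drop_dia (\<box>\<phi>) = \<box>(drop_dia \<phi>)"
| "drop_dia (\<diamond>\<phi>) = \<^bold>\<bottom>"

primrec drop_box :: "fm \<Rightarrow> fm" where
  "drop_box (Var n) = Var n"
| "drop_box \<^bold>\<bottom> = \<^bold>\<bottom>"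
| "drop_box (\<phi> \<^bold>\<and> \<psi>) = drop_box \<phi> \<^bold>\<and> drop_box \<psi>"
| "drop_box (\<phi> \<^bold>\<or> \<psi>) = drop_box \<phi> \<^bold>\<or> drop_box \<psi>"
| "drop_box (\<phi> \<^bold>\<longrightarrow> \<psi>) = drop_box \<phi> \<^bold>\<longrightarrow> drop_box \<psi>"
| "drop_box (\<box>\<phi>) = \<^bold>\<bottom>"
| "drop_box (\<diamond>\<phi>) = \<diamond>(drop_box \<phi>)"

lemma drop_dia_free: "dia_free (drop_dia \<phi>)" "dia_free \<phi> \<Longrightarrow> drop_dia \<phi> = \<phi>"
  by (induction \<phi>) auto

lemma drop_box_free: "box_free (drop_box \<phi>)" "box_free \<phi> \<Longrightarrow> drop_box \<phi> = \<phi>"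
  by (induction \<phi>) auto

lemma drop_dia_theorems: "\<phi> \<in> box_theorems \<Longrightarrow> drop_dia \<phi> \<in> KG_box W_box"
proof (induction rule: box_theorems.induct)
  case (ax \<phi>)
  have "drop_dia \<phi> \<in> gd_axioms" if "\<phi> \<in> gd_axioms"
    using that by (cases rule: gd_axioms.cases) (simp_all add: gd_axioms.intros)
  moreover have "drop_dia \<phi> \<in> box_axioms" if "\<phi> \<in> box_axioms"
    using that by (cases rule: box_axioms.cases) (simp_all add: box_axioms.intros)
  moreover have "drop_dia \<phi> \<in> W_box" if "\<phi> \<in> W_box"
    using that by (cases rule: W_box.cases) (simp add: W_box.intros)
  ultimately show ?case
    using ax by (intro KG_box.ax) (auto simp: box_fms_def drop_dia_free)
qed (auto intro: KG_box.intros)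

lemma drop_box_theorems: "\<phi> \<in> dia_theorems \<Longrightarrow> drop_box \<phi> \<in> KG_dia W_dia"
proof (induction rule: dia_theorems.induct)
  case (ax \<phi>)
  have "drop_box \<phi> \<in> gd_axioms" if "\<phi> \<in> gd_axioms"
    using that by (cases rule: gd_axioms.cases) (simp_all add: gd_axioms.intros)
  moreover have "drop_box \<phi> \<in> dia_axioms" if "\<phi> \<in> dia_axioms"
    using that by (cases rule: dia_axioms.cases) (simp_all add: dia_axioms.intros)
  moreover have "drop_box \<phi> \<in> W_dia" if "\<phi> \<in> W_dia"
    using that by (cases rule: W_dia.cases) (simp add: W_dia.intros)
  ultimately show ?case
    using ax by (intro KG_dia.ax) (auto simp: dia_fms_def drop_box_free)
qed (auto intro: KG_dia.intros)


section \<open>Weak and strong completeness over an arbitrary infinite type of worlds\<close>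

lemma (in witness_logic) weakly_complete:
  assumes inf: "infinite (UNIV :: 'w set)" and gd: "gd_axioms \<subseteq> L"
    and frag: "ub \<or> box_free \<theta>" "ud \<or> dia_free \<theta>"
    and valid: "valid (crisp_witnessed_models :: 'w gk_model set) \<theta>"
  shows "derivable L {} \<theta>"
proof (rule ccontr)
  assume "\<not> derivable L {} \<theta>"
  then obtain v0 where v0: "lhom L v0" "v0 \<theta> \<noteq> 1"
    using prop_complete[OF gd] by metis
  obtain E where E: "witness_family L ub ud E" and E0: "\<And>\<phi>. E 0 \<phi> = 1 \<longleftrightarrow> v0 \<phi> = 1"
    using witness_family_exists[OF v0(1)] by blast
  have root: "E 0 \<theta> \<noteq> 1" using v0 E0 by simp
  from finite_countermodel[OF E root frag]
  obtain M :: "(nat \<times> nat) gk_model" and v where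
    M: "M \<in> crisp_witnessed_models" "v \<in> worlds M" "sem M \<theta> v \<noteq> 1" by metis
  obtain g :: "nat \<Rightarrow> 'w" where g: "inj g"
    using inf infinite_countable_subset by blast
  define h where "h = g \<circ> prod_encode"
  have h: "inj h" using g inj_prod_encode by (auto simp: h_def intro: inj_compose)
  have "h v \<in> worlds (transport h M)" using M(2) by (simp add: transport_def)
  then have "sem (transport h M) \<theta> (h v) = 1"
    using valid transport_crisp_witnessed[OF h M(1)] by (simp add: valid_def)
  then show False using M(3) by (simp add: sem_transport[OF h])
qed

lemma KGW_complete:
  assumes inf: "infinite (UNIV :: 'w set)"
    and ent: "entails (crisp_witnessed_models :: 'w gk_model set) \<Gamma> \<phi>"
  shows "derivable KGW \<Gamma> \<phi>"
proof (rule ccontr)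
  assume "\<not> derivable KGW \<Gamma> \<phi>"
  from KGW_countermodel[OF this] obtain M :: "nat gk_model" and v where
    M: "M \<in> crisp_witnessed_models" "v \<in> worlds M" "\<And>\<gamma>. \<gamma> \<in> \<Gamma> \<Longrightarrow> sem M \<gamma> v = 1" "sem M \<phi> v \<noteq> 1"
    by metis
  obtain g :: "nat \<Rightarrow> 'w" where g: "inj g"
    using inf infinite_countable_subset by blast
  have "g v \<in> worlds (transport g M)" using M(2) by (simp add: transport_def)
  moreover have "\<forall>\<gamma>\<in>\<Gamma>. sem (transport g M) \<gamma> (g v) = 1" using M(3) by (simp add: sem_transport[OF g])
  ultimately have "sem (transport g M) \<phi> (g v) = 1"
    using ent transport_crisp_witnessed[OF g M(1)] unfolding entails_def by blast
  then show False using M(4) by (simp add: sem_transport[OF g])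
qed

lemma derivable_foldr_Imp:
  assumes gd: "gd_axioms \<subseteq> L"
  shows "derivable L (set xs \<union> \<Gamma>) \<phi> \<Longrightarrow> derivable L \<Gamma> (foldr (\<^bold>\<longrightarrow>) xs \<phi>)"
proof (induction xs arbitrary: \<Gamma>)
  case (Cons x xs)
  then show ?case using Cons.IH[of "insert x \<Gamma>"] deduction[OF gd] by simp
qed simp

lemma derivable_foldr_Imp_mp:
  assumes "derivable L \<Gamma> (foldr (\<^bold>\<longrightarrow>) xs \<phi>)" "set xs \<subseteq> \<Gamma>"
  shows "derivable L \<Gamma> \<phi>"
  using assms
proof (induction xs)
  case (Cons x xs)
  then have "derivable L \<Gamma> (foldr (\<^bold>\<longrightarrow>) xs \<phi>)"
    by (auto intro: derivable.mp[of _ _ x] derivable.premise)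
  with Cons show ?case by simp
qed simp

text \<open>The strong completeness of the fragments follows from their weak completeness, because
  the full logic shows that the semantic consequence relation is finitary.\<close>

lemma entails_finitary:
  assumes "infinite (UNIV :: 'w set)"
    and "entails (crisp_witnessed_models :: 'w gk_model set) \<Gamma> \<phi>"
  obtains xs where "set xs \<subseteq> \<Gamma>"
    "valid (crisp_witnessed_models :: 'w gk_model set) (foldr (\<^bold>\<longrightarrow>) xs \<phi>)"
proof -
  obtain \<Delta> where \<Delta>: "finite \<Delta>" "\<Delta> \<subseteq> \<Gamma>" "derivable KGW \<Delta> \<phi>"
    using derivable_finite[OF KGW_complete[OF assms]] by blast
  obtain xs where xs: "set xs = \<Delta>" using finite_list[OF \<Delta>(1)] by blast
  have "foldr (\<^bold>\<longrightarrow>) xs \<phi> \<in> KGW"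
    using \<Delta>(3) xs derivable_foldr_Imp[OF KGW_box.gd, of xs "{}" \<phi>] KGW_closed by simp
  then show thesis using that xs \<Delta>(2) KG_sound by blast
qed

text \<open>Finitely many premises turn into an iterated implication that stays inside the fragment.
  Weak completeness proves it in \<open>box_theorems\<close>, and erasing diamonds turns that proof
  into one in the fragment.\<close>

lemma KG_box_complete:
  assumes inf: "infinite (UNIV :: 'w set)" and "\<Gamma> \<subseteq> box_fms" "\<phi> \<in> box_fms"
    and "entails (crisp_witnessed_models :: 'w gk_model set) \<Gamma> \<phi>"
  shows "derivable (KG_box W_box) \<Gamma> \<phi>"
proof -
  obtain xs where xs: "set xs \<subseteq> \<Gamma>"
    and valid: "valid (crisp_witnessed_models :: 'w gk_model set) (foldr (\<^bold>\<longrightarrow>) xs \<phi>)"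
    using entails_finitary[OF inf assms(4)] .
  have free: "dia_free (foldr (\<^bold>\<longrightarrow>) xs \<phi>)"
    using xs assms(2,3) by (induction xs) (auto simp: box_fms_def)
  have "foldr (\<^bold>\<longrightarrow>) xs \<phi> \<in> box_theorems"
    using box_theorems.weakly_complete[OF inf box_theorems.gd _ _ valid] free box_theorems_closed
    by blast
  then have "foldr (\<^bold>\<longrightarrow>) xs \<phi> \<in> KG_box W_box"
    using drop_dia_theorems drop_dia_free(2)[OF free] by metis
  then show ?thesis by (intro derivable_foldr_Imp_mp[OF derivable.logic_thm xs])
qed

lemma KG_dia_complete:
  assumes inf: "infinite (UNIV :: 'w set)" and "\<Gamma> \<subseteq> dia_fms" "\<phi> \<in> dia_fms"
    and "entails (crisp_witnessed_models :: 'w gk_model set) \<Gamma> \<phi>"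
  shows "derivable (KG_dia W_dia) \<Gamma> \<phi>"
proof -
  obtain xs where xs: "set xs \<subseteq> \<Gamma>"
    and valid: "valid (crisp_witnessed_models :: 'w gk_model set) (foldr (\<^bold>\<longrightarrow>) xs \<phi>)"
    using entails_finitary[OF inf assms(4)] .
  have free: "box_free (foldr (\<^bold>\<longrightarrow>) xs \<phi>)"
    using xs assms(2,3) by (induction xs) (auto simp: dia_fms_def)
  have "foldr (\<^bold>\<longrightarrow>) xs \<phi> \<in> dia_theorems"
    using dia_theorems.weakly_complete[OF inf dia_theorems.gd _ _ valid] free dia_theorems_closed
    by blast
  then have "foldr (\<^bold>\<longrightarrow>) xs \<phi> \<in> KG_dia W_dia"
    using drop_box_theorems drop_box_free(2)[OF free] by metis
  then show ?thesis by (intro derivable_foldr_Imp_mp[OF derivable.logic_thm xs])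
qed

theorem theorem3:
  assumes "infinite (UNIV :: 'w set)"
  shows "complete_wrt UNIV (KG (W_box \<union> W_dia)) (crisp_witnessed_models :: 'w gk_model set)
       \<and> complete_wrt box_fms (KG_box W_box) (crisp_witnessed_models :: 'w gk_model set)
       \<and> complete_wrt dia_fms (KG_dia W_dia) (crisp_witnessed_models :: 'w gk_model set)"
proof (intro conjI)
  show "complete_wrt UNIV (KG (W_box \<union> W_dia)) (crisp_witnessed_models :: 'w gk_model set)"
    unfolding complete_wrt_def
    using derivable_entails[OF KG_sound] KGW_complete[OF assms] by metis
  show "complete_wrt box_fms (KG_box W_box) (crisp_witnessed_models :: 'w gk_model set)"
    unfolding complete_wrt_def
    using derivable_entails[OF KG_box_sound] KG_box_complete[OF assms] by metis
  show "complete_wrt dia_fms (KG_dia W_dia) (crisp_witnessed_models :: 'w gk_model set)"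
    unfolding complete_wrt_def
    using derivable_entails[OF KG_dia_sound] KG_dia_complete[OF assms] by metis
qed

end
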